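(* In the picking systems Pcart and Robot, the upper bound of 2 is tight for the asymptotic competitive ratio of Reopt, i.e. $$\sigma_{asymp.}(Reopt)\ge 2,$$ where in the case of Pcart warehouses with at least two aisles ($a\ge2$) are required.
   Context: Warehouse. A warehouse is a rectilinear grid of length $L$ and width $W$ consisting of $a\ge 1$ equidistant parallel (vertical) aisles, each a segment of length $W$, and $b\ge 2$ equidistant (horizontal) cross-aisles, each a segment of length $L$; the outermost aisles and cross-aisles form the border of the grid (for $a=1$, $L=0$). The picker moves along aisles and cross-aisles at unit speed (and may wait); $d$ is the resulting shortest-path metric. The depot $l_d$ is a fixed point of the grid. Picking locations are points in aisles. Instance. An instance $I$ consists of the infrastructure ($W,L,a,b,l_d$ and the batching capacity $c\in\mathbb{N}$), a sequence of orders $o_1,\ldots,o_n$, where $o_j=\{s_j^1,\ldots,s_j^{k(j)}\}$ is a set of $k(j)\ge1$ picking locations (items), and arrival times $0\le r_1\le\ldots\le r_n$. The picker starts at $l_d$ at time 0. A solution partitions the orders into batches of at most $c$ orders, sequences the batches, and fixes for each batch a visiting sequence of all picking locations of its orders. Batches are processed one after another; an item of $o_j$ cannot be picked before $r_j$; picking itself takes zero time; an order cannot be split between batches. With a pushcart, every batch starts at the depot and ends with the picker's return to the depot, and the objective (total completion time) is the time of the final return to the depot. With a robot, the picker starts the next batch from the location where she picked the last item of the previous batch (a new empty robot is immediately available there), and the objective is the time at which the last item is picked. $CIOPT(I)$ is the minimum objective value when the whole instance is known in advance (the picker may then move towards locations of orders that have not arrived yet). Online policy Reopt and the systems Pcart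 and Robot. Online, the number of orders is unknown and each order (with its picking locations) becomes known only at its arrival time. Reopt never anticipates future orders; when it reoptimizes at time $t$, it computes a plan with minimal total completion time for the orders that have arrived by $t$ and have not been completely picked, treating them as immediately available, and follows this plan until the next reoptimization; if there is nothing left to do, the picker stays where she is (at the depot initially and in the pushcart system). In Pcart (pushcart, interventionist Reopt) and Robot (robot, interventionist Reopt), reoptimization takes place at every order arrival; the plan starts from the picker's current position, orders having at least one item already in the current cart must be completed as part of the current batch, and all other bins of the current cart (of $c$ bins, one order per bin) can be freely (re)assigned to not yet commenced orders. Ties between optimal plans are broken by an arbitrary fixed deterministic rule. $Reopt(I)$ is the resulting total completion time (pushcart or robot objective according to the system), and $CIOPT(I)$ is taken for the same cart type. Asymptotic competitive ratio. An algorithm $ALG$ is asymptotically $\alpha$-competitive if for any instance $I$ there is a constant $const$, independent of the number and characteristics of the orders in $I$ but possibly dependent on the warehouse geometry, such that $ALG(I)\le\alpha\cdot CIOPT(I)+const$. $\sigma_{asymp.}(ALG)$ is the infimum of all $\alpha$ such that $ALG$ is asymptotically $\alpha$-competitive. *)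

theory Defs
  imports "HOL-Analysis.Analysis"
begin

section \<open>Warehouse, picker movement and distance\<close>

type_synonym loc = "real \<times> real"

record warehouse =
  len :: real
  width :: real
  aisles :: nat
  cross_aisles :: nat
  depot :: loc
  capacity :: nat

text \<open>Aisles are vertical. For a single aisle the division by zero in \<open>aisle_xs\<close>
  yields the coordinate 0, as it should.\<close>

definition aisle_xs :: "warehouse \<Rightarrow> real set" where
  "aisle_xs w = {real i * len w / real (aisles w - 1) | i. i < aisles w}"

definition cross_ys :: "warehouse \<Rightarrow> real set" where
  "cross_ys w = {real j * width w / real (cross_aisles w - 1) | j. j < cross_aisles w}"

definition aisle_points :: "warehouse \<Rightarrow> loc set" where
  "aisle_points w = aisle_xs w \<times> {0..width w}"

definition grid :: "warehouse \<Rightarrow> loc set" where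
  "grid w = aisle_points w \<union> {0..len w} \<times> cross_ys w"

definition valid_warehouse :: "warehouse \<Rightarrow> bool" where
  "valid_warehouse w \<longleftrightarrow>
     aisles w \<ge> 1 \<and> cross_aisles w \<ge> 2 \<and> width w > 0 \<and>
     (if aisles w = 1 then len w = 0 else len w > 0) \<and>
     depot w \<in> grid w \<and> capacity w \<ge> 1"

text \<open>Movements in the grid at speed at most 1. A curve inside the grid is
  1-Lipschitz for the Manhattan metric iff it is so for the arc-length metric of the grid:
  on each segment of the grid both metrics agree with arc length.\<close>

definition manhattan :: "loc \<Rightarrow> loc \<Rightarrow> real" where
  "manhattan p q = \<bar>fst p - fst q\<bar> + \<bar>snd p - snd q\<bar>"

definition movement :: "warehouse \<Rightarrow> (real \<Rightarrow> loc) \<Rightarrow> bool" where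
  "movement w \<gamma> \<longleftrightarrow>
     (\<forall>t. \<gamma> t \<in> grid w) \<and> (\<forall>s t. manhattan (\<gamma> s) (\<gamma> t) \<le> \<bar>s - t\<bar>)"

text \<open>Shortest travel time at unit speed, i.e. the shortest-path metric of the grid.\<close>

definition travel :: "warehouse \<Rightarrow> loc \<Rightarrow> loc \<Rightarrow> real" where
  "travel w p q = Inf {T. T \<ge> 0 \<and> (\<exists>\<gamma>. movement w \<gamma> \<and> \<gamma> 0 = p \<and> \<gamma> T = q)}"


section \<open>Orders, batches and schedules\<close>

text \<open>An order is its arrival time together with its picking locations. Orders are
  referred to by their index in the sequence, and a pair \<open>(j, s)\<close> is
  the item of order \<open>j\<close> at location \<open>s\<close>.\<close>

type_synonym order = "real \<times> loc set"
type_synonym item = "nat \<times> loc"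
type_synonym batch = "item list"

definition valid_orders :: "warehouse \<Rightarrow> order list \<Rightarrow> bool" where
  "valid_orders w os \<longleftrightarrow>
     sorted (map fst os) \<and>
     (\<forall>(r, S) \<in> set os. r \<ge> 0 \<and> finite S \<and> S \<noteq> {} \<and> S \<subseteq> aisle_points w)"

definition items :: "order list \<Rightarrow> item set" where
  "items os = {(j, s). j < length os \<and> s \<in> snd (os ! j)}"

datatype system = Pushcart | Robot

text \<open>\<open>Close\<close> ends a batch: with a pushcart the picker returns to the depot,
  with a robot a new empty robot is available where the picker stands.\<close>

datatype event = Pick nat loc | Close

definition events :: "batch list \<Rightarrow> event list" where
  "events bs = concat (map (\<lambda>b. map (\<lambda>(j, s). Pick j s) b @ [Close]) bs)"

fun event_loc :: "system \<Rightarrow> warehouse \<Rightarrow> loc \<Rightarrow> event \<Rightarrow> loc" where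
  "event_loc sys w p (Pick j s) = s"
| "event_loc Pushcart w p Close = depot w"
| "event_loc Robot w p Close = p"

fun not_before :: "order list \<Rightarrow> real \<Rightarrow> event \<Rightarrow> real" where
  "not_before os t (Pick j s) = max t (fst (os ! j))"
| "not_before os t Close = t"

text \<open>Earliest times (and locations) at which the events can happen in the given order,
  when the picker is at \<open>p\<close> at time \<open>t\<close>. She may travel to the location of an
  order that has not arrived yet, and then waits there.\<close>

fun schedule :: "system \<Rightarrow> warehouse \<Rightarrow> order list \<Rightarrow> real \<Rightarrow> loc \<Rightarrow> event list
    \<Rightarrow> (real \<times> loc \<times> event) list" where
  "schedule sys w os t p [] = []"
| "schedule sys w os t p (e # es) =
    (let q = event_loc sys w p e; t' = not_before os (t + travel w p q) e
     in (t', q, e) # schedule sys w os t' q es)"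

text \<open>For a robot, the last event is a \<open>Close\<close> at the time of the last pick.\<close>

definition completion :: "system \<Rightarrow> warehouse \<Rightarrow> order list \<Rightarrow> real \<Rightarrow> loc \<Rightarrow> batch list \<Rightarrow> real" where
  "completion sys w os t p bs = last (t # map fst (schedule sys w os t p (events bs)))"

text \<open>\<open>feasible w os C D bs\<close>: the items \<open>D\<close> have been picked already, the orders
  \<open>C\<close> occupy bins of the current cart, and \<open>bs\<close> completes the current batch (by its
  first element, possibly without any further pick) and then processes new batches,
  such that all remaining items of \<open>os\<close> are picked, no batch has more orders
  than the cart has bins, and no order is split between batches. In particular, the
  remaining items of an order in \<open>C\<close> all belong to the current batch. A complete solution
  of an instance is the case \<open>C = D = {}\<close>.\<close>

definition feasible ::
  "warehouse \<Rightarrow> order list \<Rightarrow> nat set \<Rightarrow> item set \<Rightarrow> batch list \<Rightarrow> bool" where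
  "feasible w os C D bs \<longleftrightarrow>
     bs \<noteq> [] \<and> [] \<notin> set (tl bs) \<and>
     distinct (concat bs) \<and> set (concat bs) = items os - D \<and>
     (let carts = (C \<union> fst ` set (hd bs)) # map (\<lambda>b. fst ` set b) (tl bs)
      in (\<forall>B \<in> set carts. card B \<le> capacity w) \<and>
         sorted_wrt (\<lambda>B B'. B \<inter> B' = {}) carts)"

definition ciopt :: "system \<Rightarrow> warehouse \<Rightarrow> order list \<Rightarrow> real" where
  "ciopt sys w os = Inf {completion sys w os 0 (depot w) bs | bs. feasible w os {} {} bs}"


section \<open>Interventionist reoptimization\<close>

record state =
  now :: real
  position :: loc
  cart :: "nat set"
  picked :: "item set"

text \<open>A plan consists of the batches and of the picker's route, as a function of
  absolute time.\<close>

type_synonym plan = "batch list \<times> (real \<Rightarrow> loc)"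

definition known :: "order list \<Rightarrow> real \<Rightarrow> order list" where
  "known os t = takeWhile (\<lambda>(r, S). r \<le> t) os"

definition route :: "system \<Rightarrow> warehouse \<Rightarrow> order list \<Rightarrow> state \<Rightarrow> batch list \<Rightarrow> (real \<Rightarrow> loc) \<Rightarrow> bool" where
  "route sys w os st bs \<gamma> \<longleftrightarrow>
     movement w \<gamma> \<and> \<gamma> (now st) = position st \<and>
     (\<forall>(t, q, e) \<in> set (schedule sys w os (now st) (position st) (events bs)). \<gamma> t = q) \<and>
     (let T = completion sys w os (now st) (position st) bs in \<forall>t \<ge> T. \<gamma> t = \<gamma> T)"

text \<open>Here \<open>os\<close> are the orders known at time \<open>now st\<close>. They have all arrived, so that
  arrival times do not restrict the plan.\<close>

definition optimal_plans :: "system \<Rightarrow> warehouse \<Rightarrow> order list \<Rightarrow> state \<Rightarrow> plan set" where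
  "optimal_plans sys w os st =
     {(bs, \<gamma>). feasible w os (cart st) (picked st) bs \<and>
        (\<forall>bs'. feasible w os (cart st) (picked st) bs' \<longrightarrow>
           completion sys w os (now st) (position st) bs
             \<le> completion sys w os (now st) (position st) bs') \<and>
        route sys w os st bs \<gamma>}"

text \<open>A deterministic tie-breaking rule selects one of the optimal plans; it may
  use everything that is known to the picker when the plan is made.\<close>

type_synonym tie_rule = "warehouse \<Rightarrow> order list \<Rightarrow> state \<Rightarrow> plan set \<Rightarrow> plan"

definition tie_breaking :: "tie_rule \<Rightarrow> bool" where
  "tie_breaking tb \<longleftrightarrow> (\<forall>w os st P. P \<noteq> {} \<longrightarrow> tb w os st P \<in> P)"

fun perform :: "event \<Rightarrow> state \<Rightarrow> state" where
  "perform (Pick j s) st = st\<lparr>cart := insert j (cart st), picked := insert (j, s) (picked st)\<rparr>"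
| "perform Close st = st\<lparr>cart := {}\<rparr>"

text \<open>Following a plan until time \<open>t\<close>: events due at \<open>t\<close> itself take place.\<close>

definition follow :: "system \<Rightarrow> warehouse \<Rightarrow> order list \<Rightarrow> plan \<Rightarrow> real \<Rightarrow> state \<Rightarrow> state" where
  "follow sys w os P t st =
     (let due = takeWhile (\<lambda>(t', q, e). t' \<le> t)
                  (schedule sys w os (now st) (position st) (events (fst P)))
      in (fold (\<lambda>(t', q, e). perform e) due st)\<lparr>now := t, position := snd P t\<rparr>)"

definition reoptimize :: "system \<Rightarrow> tie_rule \<Rightarrow> warehouse \<Rightarrow> order list \<Rightarrow> real
    \<Rightarrow> state \<times> plan \<Rightarrow> state \<times> plan" where
  "reoptimize sys tb w os t sp =
     (let st = follow sys w os (snd sp) t (fst sp); ks = known os t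
      in (st, tb w ks st (optimal_plans sys w ks st)))"

text \<open>Orders that arrive simultaneously become known together. Initially the
  picker idles at the depot.\<close>

definition reopt_run :: "system \<Rightarrow> tie_rule \<Rightarrow> warehouse \<Rightarrow> order list \<Rightarrow> state \<times> plan" where
  "reopt_run sys tb w os =
     fold (reoptimize sys tb w os) (remdups (map fst os))
       (\<lparr>now = 0, position = depot w, cart = {}, picked = {}\<rparr>, ([], \<lambda>_. depot w))"

text \<open>After the last arrival the current plan is followed to its end.\<close>

definition reopt :: "system \<Rightarrow> tie_rule \<Rightarrow> warehouse \<Rightarrow> order list \<Rightarrow> real" where
  "reopt sys tb w os =
     (let (st, P) = reopt_run sys tb w os
      in completion sys w os (now st) (position st) (fst P))"


section \<open>Asymptotic competitive ratio\<close>

text \<open>The ratio is taken over the instances in a given class of warehouses. The additive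
  constant may depend on the whole infrastructure, but not on the orders.\<close>

definition asymp_competitive ::
  "(warehouse \<Rightarrow> order list \<Rightarrow> real) \<Rightarrow> system \<Rightarrow> warehouse set \<Rightarrow> real \<Rightarrow> bool" where
  "asymp_competitive alg sys \<W> \<alpha> \<longleftrightarrow>
     (\<forall>w \<in> \<W>. \<exists>const. \<forall>os. valid_orders w os \<longrightarrow> alg w os \<le> \<alpha> * ciopt sys w os + const)"

definition asymp_ratio ::
  "(warehouse \<Rightarrow> order list \<Rightarrow> real) \<Rightarrow> system \<Rightarrow> warehouse set \<Rightarrow> ereal" where
  "asymp_ratio alg sys \<W> = Inf {ereal \<alpha> | \<alpha>. asymp_competitive alg sys \<W> \<alpha>}"

end

theory Submission
  imports Defs
begin

text \<open>For each cart type and each \<open>\<alpha> < 2\<close> it suffices to give one warehouse and a stream of orders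
  on which Reopt takes more than \<open>\<alpha>\<close> times the optimum, up to a constant. In both streams, Reopt is
  lured back and forth in a stretch of an aisle that contains no item: just before the picker
  reaches an item, the next order arrives and every optimal plan now starts in the opposite
  direction. When the last order arrives, nothing has been picked and the whole work remains to be
  done. The time between two arrivals is almost the work per order, and a picker who knows the
  instance processes the orders one after another as they arrive. She is done about when the
  stream ends, and Reopt needs almost twice as long (\<open>reopt_lured\<close>, \<open>growth_le_competitive\<close>).
  Everything rests on the two reasons why the plan turns round; both are parity effects.

  \<^bold>\<open>Robots.\<close> Take a single aisle [0,4] and one bin. There are single items at 0 and at 4 and \<open>k > 0\<close>
  orders with the two items 1 and 2, and the picker is between 2 and 3. Each of the \<open>k\<close> orders
  forces a crossing of [1,2]. A route that goes left first and ends at 4 crosses [1,2] an even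
  number of times, and a route that goes right first and ends at 0 an odd number of times. So going
  left first is best for even \<open>k\<close>, and going right first for odd \<open>k\<close>, wherever the picker is between 2
  and 3 (\<open>tour_left_first\<close>, \<open>tour_right_first\<close>). A new order has work 1 and changes the direction, and
  she has walked almost distance 1 when it arrives.

  \<^bold>\<open>Pushcarts.\<close> Take three aisles of length \<open>N\<close> at distance 1 and two bins, with the depot at one end of
  the middle aisle and a hub at the other. One order consists of the hub. Each order of the stream,
  a sweep, has items all along the two outer aisles, so that a batch with sweeps is a loop of
  length \<open>2 N + 4\<close>, which passes by the hub. If the number of sweeps is even, they fill the carts and
  the hub needs its own batch, which is best started right now from the middle aisle. If the number is
  odd, then the hub is picked for free together with a single sweep, and nothing is better than to
  return to the depot and to start with the loops. To sweep from the hub's end is no alternative: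
  a tour that starts near the hub, covers both outer aisles and ends at the depot
  has to walk almost all of one of them a second time (\<open>sweep_tour\<close>, from winding numbers on a circle).
  Two sweeps have work \<open>2 N + 4\<close>, and the picker walks up and down almost the whole middle aisle
  while they arrive.\<close>

section \<open>Movements and travel times\<close>

definition reaches :: "warehouse \<Rightarrow> real \<Rightarrow> loc \<Rightarrow> loc \<Rightarrow> bool" where
  "reaches w T p q \<longleftrightarrow> T \<ge> 0 \<and> (\<exists>\<gamma>. movement w \<gamma> \<and> \<gamma> 0 = p \<and> \<gamma> T = q)"

lemma manhattan_triangle: "manhattan p r \<le> manhattan p q + manhattan q r"
  by (auto simp: manhattan_def)

lemma manhattan_commute: "manhattan p q = manhattan q p"
  by (auto simp: manhattan_def)

lemma movement_reparametrize:
  assumes "movement w \<gamma>" "\<And>s t. \<bar>h s - h t\<bar> \<le> \<bar>s - t\<bar>"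
  shows "movement w (\<lambda>t. \<gamma> (h t))"
  using assms unfolding movement_def by (meson order_trans)

lemma movement_join:
  assumes "movement w \<gamma>" "movement w \<eta>" "\<gamma> c = \<eta> c"
  shows "movement w (\<lambda>t. if t \<le> c then \<gamma> t else \<eta> t)"
proof -
  have mixed: "manhattan (\<gamma> s) (\<eta> t) \<le> t - s" if "s \<le> c" "c \<le> t" for s t
  proof -
    have "manhattan (\<gamma> s) (\<gamma> c) \<le> \<bar>s - c\<bar>" "manhattan (\<eta> c) (\<eta> t) \<le> \<bar>c - t\<bar>"
      using assms(1,2) by (auto simp: movement_def)
    then show ?thesis
      using manhattan_triangle[of "\<gamma> s" "\<eta> t" "\<gamma> c"] assms(3) that by simp
  qed
  show ?thesis
    unfolding movement_def
  proof (intro conjI allI)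
    fix t show "(if t \<le> c then \<gamma> t else \<eta> t) \<in> grid w"
      using assms by (auto simp: movement_def)
  next
    fix s t
    show "manhattan (if s \<le> c then \<gamma> s else \<eta> s) (if t \<le> c then \<gamma> t else \<eta> t) \<le> \<bar>s - t\<bar>"
      using assms mixed[of s t] mixed[of t s] by (auto simp: movement_def manhattan_commute)
  qed
qed

lemma reaches_trans:
  assumes "reaches w S p q" "reaches w T q r"
  shows "reaches w (S + T) p r"
proof -
  obtain \<gamma> where \<gamma>: "movement w \<gamma>" "\<gamma> 0 = p" "\<gamma> S = q" "S \<ge> 0"
    using assms by (auto simp: reaches_def)
  obtain \<eta> where \<eta>: "movement w \<eta>" "\<eta> 0 = q" "\<eta> T = r" "T \<ge> 0"
    using assms by (auto simp: reaches_def)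
  have "movement w (\<lambda>t. if t \<le> S then \<gamma> t else \<eta> (t - S))"
    by (rule movement_join[OF \<gamma>(1) movement_reparametrize[OF \<eta>(1)]]) (use \<gamma> \<eta> in auto)
  then show ?thesis
    unfolding reaches_def using \<gamma> \<eta>
    by (intro conjI exI[of _ "\<lambda>t. if t \<le> S then \<gamma> t else \<eta> (t - S)"]) auto
qed

lemma reaches_straight:
  assumes seg: "\<And>u v. min (fst p) (fst q) \<le> u \<Longrightarrow> u \<le> max (fst p) (fst q) \<Longrightarrow>
      min (snd p) (snd q) \<le> v \<Longrightarrow> v \<le> max (snd p) (snd q) \<Longrightarrow> (u, v) \<in> grid w"
    and straight: "fst p = fst q \<or> snd p = snd q"
  shows "reaches w (manhattan p q) p q"
proof -
  define m where "m = manhattan p q"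
  define \<sigma> \<tau> where "\<sigma> = sgn (fst q - fst p)" and "\<tau> = sgn (snd q - snd p)"
  define \<gamma> where "\<gamma> = (\<lambda>t. (fst p + \<sigma> * max 0 (min t m), snd p + \<tau> * max 0 (min t m)))"
  have m: "m \<ge> 0" by (simp add: m_def manhattan_def)
  have clip: "\<bar>max 0 (min s m) - max 0 (min t m)\<bar> \<le> \<bar>s - t\<bar>" for s t :: real by linarith
  have st: "(\<sigma> = 0 \<and> \<bar>\<tau>\<bar> \<le> 1) \<or> (\<tau> = 0 \<and> \<bar>\<sigma>\<bar> \<le> 1)"
    using straight by (auto simp: \<sigma>_def \<tau>_def sgn_if)
  have lip: "manhattan (\<gamma> s) (\<gamma> t) \<le> \<bar>s - t\<bar>" for s t
  proof -
    define c where "c = max 0 (min s m) - max 0 (min t m)"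
    have "manhattan (\<gamma> s) (\<gamma> t) = \<bar>\<sigma> * c\<bar> + \<bar>\<tau> * c\<bar>"
      by (simp add: \<gamma>_def manhattan_def c_def algebra_simps)
    also have "\<dots> \<le> \<bar>c\<bar>"
      using st by (auto simp: \<sigma>_def \<tau>_def sgn_if)
    finally show ?thesis using clip[of s t] by (simp add: c_def)
  qed
  have "\<gamma> t \<in> grid w" for t
  proof -
    define c where "c = max 0 (min t m)"
    have c: "0 \<le> c" "c \<le> m" using m by (auto simp: c_def)
    show ?thesis
      unfolding \<gamma>_def c_def[symmetric]
      by (rule seg) (use c straight in \<open>auto simp: \<sigma>_def \<tau>_def sgn_if m_def manhattan_def\<close>)
  qed
  with lip have "movement w \<gamma>" by (simp add: movement_def)
  moreover have "\<gamma> 0 = p" using m by (simp add: \<gamma>_def)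
  moreover have "\<gamma> m = q"
    using straight m
    by (cases p; cases q) (auto simp: \<gamma>_def \<sigma>_def \<tau>_def sgn_if m_def manhattan_def)
  ultimately show ?thesis using m by (auto simp: reaches_def m_def)
qed

lemma travel_eqI:
  assumes "reaches w T p q" "\<And>T'. reaches w T' p q \<Longrightarrow> T \<le> T'"
  shows "travel w p q = T"
  unfolding travel_def
  by (rule cInf_eq_minimum) (use assms in \<open>auto simp: reaches_def\<close>)

lemma Lipschitz_of_local:
  fixes h :: "real \<Rightarrow> real"
  assumes "d > 0" and loc: "\<And>s t. \<bar>s - t\<bar> < d \<Longrightarrow> \<bar>h s - h t\<bar> \<le> \<bar>s - t\<bar>"
  shows "\<bar>h s - h t\<bar> \<le> \<bar>s - t\<bar>"
proof -
  have main: "\<bar>h s - h t\<bar> \<le> t - s" if "s \<le> t" "t - s \<le> real n * (d / 2)" for n s t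
    using that
  proof (induction n arbitrary: t)
    case 0
    then show ?case by auto
  next
    case (Suc n)
    show ?case
    proof (cases "t - s \<le> real n * (d / 2)")
      case True
      then show ?thesis using Suc by auto
    next
      case False
      define m where "m = s + real n * (d / 2)"
      have "s \<le> m" using \<open>d > 0\<close> by (auto simp: m_def)
      then have "\<bar>h s - h m\<bar> \<le> m - s" by (intro Suc.IH) (auto simp: m_def)
      moreover have "\<bar>h m - h t\<bar> \<le> \<bar>m - t\<bar>"
        using Suc.prems False \<open>d > 0\<close> by (intro loc) (auto simp: m_def algebra_simps)
      moreover have "m \<le> t" using False by (auto simp: m_def)
      ultimately show ?thesis by linarith
    qed
  qed
  have wlog: "\<bar>h s - h t\<bar> \<le> t - s" if "s \<le> t" for s t
  proof -
    obtain n where "(t - s) / (d / 2) \<le> real n" using real_arch_simple by blast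
    then show ?thesis using main[of s t n] that \<open>d > 0\<close> by (simp add: field_simps)
  qed
  show ?thesis using wlog[of s t] wlog[of t s] by (cases "s \<le> t") (auto simp: abs_minus_commute)
qed

text \<open>Along a movement only nearby points matter, and for them the grid distance is the Manhattan
  distance. So the distance of the grid, which is not 1-Lipschitz for the Manhattan distance
  between far points of different aisles, can still be used to bound travel times from below.\<close>

lemma movement_Lipschitz:
  assumes "movement w \<gamma>" "d > 0"
    and "\<And>p q. p \<in> grid w \<Longrightarrow> q \<in> grid w \<Longrightarrow> manhattan p q < d \<Longrightarrow> \<bar>F p - F q\<bar> \<le> manhattan p q"
  shows "\<bar>F (\<gamma> s) - F (\<gamma> t)\<bar> \<le> \<bar>s - t\<bar>"
proof (rule Lipschitz_of_local[OF \<open>d > 0\<close>, of "\<lambda>t. F (\<gamma> t)"])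
  fix s t :: real assume st: "\<bar>s - t\<bar> < d"
  have g: "\<gamma> s \<in> grid w" "\<gamma> t \<in> grid w" "manhattan (\<gamma> s) (\<gamma> t) \<le> \<bar>s - t\<bar>"
    using assms(1) by (auto simp: movement_def)
  have "manhattan (\<gamma> s) (\<gamma> t) < d" using g(3) st by linarith
  from assms(3)[OF g(1,2) this] g(3)
  show "\<bar>F (\<gamma> s) - F (\<gamma> t)\<bar> \<le> \<bar>s - t\<bar>" by linarith
qed

text \<open>A route is only specified at the events. Between two locations of the same aisle that are reached
  in the shortest possible time there is no freedom, and this gives the position of the picker when the
  next order interrupts her.\<close>

lemma movement_along_aisle:
  assumes "movement w \<gamma>" "\<gamma> s = (a, y)" "\<gamma> t = (a, z)" "t - s = \<bar>z - y\<bar>" "s \<le> r" "r \<le> t"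
  shows "\<gamma> r = (a, y + sgn (z - y) * (r - s))"
proof -
  obtain u v where uv: "\<gamma> r = (u, v)" by (cases "\<gamma> r")
  have "manhattan (\<gamma> s) (\<gamma> r) \<le> \<bar>s - r\<bar>" "manhattan (\<gamma> r) (\<gamma> t) \<le> \<bar>r - t\<bar>"
    using assms(1) by (auto simp: movement_def)
  then have "\<bar>a - u\<bar> + \<bar>y - v\<bar> \<le> r - s" "\<bar>u - a\<bar> + \<bar>v - z\<bar> \<le> t - r"
    using assms uv by (auto simp: manhattan_def)
  then have "u = a" "v = y + sgn (z - y) * (r - s)"
    using assms(4) by (auto simp: sgn_if split: if_splits)
  then show ?thesis using uv by simp
qed

text \<open>A set of locations, containing the depot, between which shortest paths exist.\<close>

definition geodesic :: "warehouse \<Rightarrow> loc set \<Rightarrow> bool" where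
  "geodesic w X \<longleftrightarrow> depot w \<in> X \<and> (\<forall>p\<in>X. \<forall>q\<in>X. reaches w (travel w p q) p q)"

lemma geodesicD: "geodesic w X \<Longrightarrow> p \<in> X \<Longrightarrow> q \<in> X \<Longrightarrow> reaches w (travel w p q) p q"
  by (auto simp: geodesic_def)

lemma travel_nonneg: "geodesic w X \<Longrightarrow> p \<in> X \<Longrightarrow> q \<in> X \<Longrightarrow> travel w p q \<ge> 0"
  by (auto simp: geodesic_def reaches_def)

section \<open>Schedules\<close>

text \<open>The walking time of the events when all orders have arrived.\<close>

fun trip :: "system \<Rightarrow> warehouse \<Rightarrow> loc \<Rightarrow> event list \<Rightarrow> real" where
  "trip sys w p [] = 0"
| "trip sys w p (e # es) =
     travel w p (event_loc sys w p e) + trip sys w (event_loc sys w p e) es"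

text \<open>The completion time without the list of intermediate stops, so that plans can be cut into batches.\<close>

fun finish :: "system \<Rightarrow> warehouse \<Rightarrow> order list \<Rightarrow> real \<Rightarrow> loc \<Rightarrow> event list \<Rightarrow> real" where
  "finish sys w os t p [] = t"
| "finish sys w os t p (e # es) =
     (let q = event_loc sys w p e in finish sys w os (not_before os (t + travel w p q) e) q es)"

definition dest :: "system \<Rightarrow> warehouse \<Rightarrow> loc \<Rightarrow> event list \<Rightarrow> loc" where
  "dest sys w p es = foldl (event_loc sys w) p es"

lemma dest_simps [simp]:
  "dest sys w p [] = p" "dest sys w p (e # es) = dest sys w (event_loc sys w p e) es"
  "dest sys w p (es @ es') = dest sys w (dest sys w p es) es'"
  by (auto simp: dest_def)

lemma last_schedule:
  "last (t # map fst (schedule sys w os t p es)) = finish sys w os t p es"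
proof (induction es arbitrary: t p)
  case (Cons e es)
  define q where "q = event_loc sys w p e"
  define t' where "t' = not_before os (t + travel w p q) e"
  show ?case using Cons[of t' q] by (simp add: Let_def q_def[symmetric] t'_def[symmetric])
qed simp

lemma completion_finish: "completion sys w os t p bs = finish sys w os t p (events bs)"
  by (simp only: completion_def last_schedule)

lemma finish_append:
  "finish sys w os t p (es @ es') = finish sys w os (finish sys w os t p es) (dest sys w p es) es'"
  by (induction es arbitrary: t p) (auto simp: Let_def)

lemma trip_append: "trip sys w p (es @ es') = trip sys w p es + trip sys w (dest sys w p es) es'"
  by (induction es arbitrary: p) auto

lemma events_simps [simp]:
  "events [] = []" "events (b # bs) = map (\<lambda>(j, s). Pick j s) b @ Close # events bs"
  by (auto simp: events_def)

lemma events_append: "events (bs @ bs') = events bs @ events bs'"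
  by (simp add: events_def)

lemma Pick_in_events: "Pick j s \<in> set (events bs) \<longleftrightarrow> (j, s) \<in> set (concat bs)"
  by (induction bs) auto

definition picks_in :: "loc set \<Rightarrow> event list \<Rightarrow> bool" where
  "picks_in X es \<longleftrightarrow> (\<forall>j s. Pick j s \<in> set es \<longrightarrow> s \<in> X)"

lemma picks_in_simps [simp]:
  "picks_in X []" "picks_in X (Pick j s # es) \<longleftrightarrow> s \<in> X \<and> picks_in X es"
  "picks_in X (Close # es) \<longleftrightarrow> picks_in X es"
  "picks_in X (es @ es') \<longleftrightarrow> picks_in X es \<and> picks_in X es'"
  unfolding picks_in_def by (simp_all del: split_paired_All) blast+

lemma event_loc_in:
  "geodesic w X \<Longrightarrow> p \<in> X \<Longrightarrow> picks_in X (e # es) \<Longrightarrow> event_loc sys w p e \<in> X \<and> picks_in X es"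
  by (cases e; cases sys) (auto simp: geodesic_def)

lemma not_before_ge: "t \<le> not_before os t e"
  by (cases e) auto

lemma trip_nonneg:
  "geodesic w X \<Longrightarrow> p \<in> X \<Longrightarrow> picks_in X es \<Longrightarrow> trip sys w p es \<ge> 0"
proof (induction es arbitrary: p)
  case (Cons e es)
  then show ?case using event_loc_in[OF Cons.prems] travel_nonneg[of w X p] by (auto intro: add_nonneg_nonneg)
qed simp

lemma finish_ge:
  assumes "geodesic w X" "p \<in> X" "picks_in X es"
  shows "t \<le> finish sys w os t p es"
  using assms(2,3)
proof (induction es arbitrary: t p)
  case (Cons e es)
  define q where "q = event_loc sys w p e"
  have q: "q \<in> X" "picks_in X es" using event_loc_in[OF assms(1) Cons.prems] by (auto simp: q_def)
  have "t \<le> t + travel w p q" using travel_nonneg[OF assms(1) Cons.prems(1) q(1)] by simp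
  also have "\<dots> \<le> not_before os (t + travel w p q) e" by (rule not_before_ge)
  also have "\<dots> \<le> finish sys w os (not_before os (t + travel w p q) e) q es"
    by (rule Cons.IH[OF q])
  finally show ?case by (simp add: Let_def q_def)
qed simp

lemma schedule_ge:
  assumes "geodesic w X" "p \<in> X" "picks_in X es" "(t', q, e) \<in> set (schedule sys w os t p es)"
  shows "t \<le> t'"
  using assms(2-4)
proof (induction es arbitrary: t p)
  case (Cons e' es)
  define r where "r = event_loc sys w p e'"
  have r: "r \<in> X" "picks_in X es" using event_loc_in[OF assms(1) Cons.prems(1,2)] by (auto simp: r_def)
  have "t \<le> t + travel w p r" using travel_nonneg[OF assms(1) Cons.prems(1) r(1)] by simp
  also have le: "\<dots> \<le> not_before os (t + travel w p r) e'" by (rule not_before_ge)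
  finally have "t \<le> not_before os (t + travel w p r) e'" .
  with Cons.IH[OF r] Cons.prems(3) show ?case
    by (auto simp: Let_def r_def[symmetric] intro: order_trans)
qed simp

text \<open>Waiting for all releases first can only delay the picker.\<close>

lemma finish_le_trip:
  assumes "geodesic w X" "p \<in> X" "picks_in X es"
    and "\<And>j s. Pick j s \<in> set es \<Longrightarrow> fst (os ! j) \<le> \<tau>" "t \<le> \<tau>"
  shows "finish sys w os t p es \<le> \<tau> + trip sys w p es"
  using assms(2-)
proof (induction es arbitrary: t \<tau> p)
  case (Cons e es)
  define q where "q = event_loc sys w p e"
  have q: "q \<in> X" "picks_in X es" using event_loc_in[OF assms(1) Cons.prems(1,2)] by (auto simp: q_def)
  have d: "travel w p q \<ge> 0" by (rule travel_nonneg[OF assms(1) Cons.prems(1) q(1)])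
  have "finish sys w os (not_before os (t + travel w p q) e) q es
    \<le> (\<tau> + travel w p q) + trip sys w q es"
  proof (rule Cons.IH[OF q])
    show "fst (os ! j) \<le> \<tau> + travel w p q" if "Pick j s \<in> set es" for j s
      using Cons.prems(3)[of j s] that d by simp
    show "not_before os (t + travel w p q) e \<le> \<tau> + travel w p q"
    proof (cases e)
      case (Pick j s)
      then show ?thesis using Cons.prems(3)[of j s] Cons.prems(4) d by simp
    qed (use Cons.prems in simp)
  qed
  then show ?case by (simp add: Let_def q_def)
qed simp

lemma finish_ge_trip: "t + trip sys w p es \<le> finish sys w os t p es"
proof (induction es arbitrary: t p)
  case (Cons e es)
  define q where "q = event_loc sys w p e"
  have "t + travel w p q + trip sys w q es \<le> not_before os (t + travel w p q) e + trip sys w q es"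
    using not_before_ge by simp
  also note Cons.IH
  finally show ?case by (simp add: Let_def q_def add.assoc)
qed simp

lemma schedule_cong:
  assumes "\<And>j s. Pick j s \<in> set es \<Longrightarrow> fst (os ! j) = fst (os' ! j)"
  shows "schedule sys w os t p es = schedule sys w os' t p es"
  using assms
proof (induction es arbitrary: t p)
  case (Cons e es)
  have "not_before os u e = not_before os' u e" for u
  proof (cases e)
    case (Pick j s)
    then show ?thesis using Cons.prems[of j s] by simp
  qed simp
  moreover have "schedule sys w os u r es = schedule sys w os' u r es" for u r
    by (rule Cons.IH) (use Cons.prems in auto)
  ultimately show ?case by (simp add: Let_def)
qed simp

text \<open>If each batch costs at most \<open>c\<close> and the orders of batch number \<open>i\<close> have arrived by
  \<open>\<tau> + i c\<close>, then the picker never waits for long and needs at most \<open>c\<close> per batch.\<close>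

lemma pipelined_batches:
  assumes "geodesic w X" "c \<ge> 0" "d \<ge> 0"
    and "\<And>i. i \<le> length bs \<Longrightarrow> z i \<in> X"
    and "\<And>i. i < length bs \<Longrightarrow> trip sys w (z i) (events [bs ! i]) \<le> c + (if i = 0 then d else 0)"
    and "\<And>i. i < length bs \<Longrightarrow> dest sys w (z i) (events [bs ! i]) = z (Suc i)"
    and "\<And>i j s. i < length bs \<Longrightarrow> (j, s) \<in> set (bs ! i) \<Longrightarrow> s \<in> X"
    and "\<And>i j s. i < length bs \<Longrightarrow> (j, s) \<in> set (bs ! i) \<Longrightarrow> fst (os ! j) \<le> \<tau> + real i * c"
    and "t \<le> \<tau>"
  shows "finish sys w os t (z 0) (events bs) \<le> \<tau> + d + real (length bs) * c \<and>
    dest sys w (z 0) (events bs) = z (length bs)"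
  using assms(3-)
proof (induction bs arbitrary: t \<tau> z d)
  case (Cons b bs)
  have p: "picks_in X (events [b])"
    using Cons.prems(5)[of 0] by (auto simp: picks_in_def)
  have e: "dest sys w (z 0) (events [b]) = z (Suc 0)" using Cons.prems(4)[of 0] by simp
  have "finish sys w os t (z 0) (events [b]) \<le> \<tau> + trip sys w (z 0) (events [b])"
  proof (rule finish_le_trip[OF assms(1) _ p _ Cons.prems(7)])
    show "z 0 \<in> X" using Cons.prems(2)[of 0] by simp
    show "fst (os ! j) \<le> \<tau>" if "Pick j s \<in> set (events [b])" for j s
      using Cons.prems(6)[of 0 j s] that by (auto simp del: events_simps simp: Pick_in_events)
  qed
  also have "\<dots> \<le> \<tau> + c + d" using Cons.prems(3)[of 0] by simp
  finally have f: "finish sys w os t (z 0) (events [b]) \<le> \<tau> + c + d" .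
  have "finish sys w os (finish sys w os t (z 0) (events [b])) (z (Suc 0)) (events bs)
      \<le> (\<tau> + c + d) + 0 + real (length bs) * c \<and>
    dest sys w (z (Suc 0)) (events bs) = z (Suc (length bs))"
  proof (rule Cons.IH[of 0 "\<lambda>i. z (Suc i)" "\<tau> + c + d"])
    show "fst (os ! j) \<le> \<tau> + c + d + real i * c" if "i < length bs" "(j, s) \<in> set (bs ! i)" for i j s
      using Cons.prems(6)[of "Suc i" j s] that \<open>d \<ge> 0\<close> by (simp add: algebra_simps)
  qed (use Cons.prems(2-5)[of "Suc _"] f in auto)
  moreover have "events (b # bs) = events [b] @ events bs" by simp
  ultimately show ?case
    by (simp only: finish_append dest_simps e) (simp add: algebra_simps)
qed simp

text \<open>The shortest paths between consecutive stops are concatenated, and the picker waits at a stop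
  until the item is available. This makes sets of optimal plans nonempty, without which a tie-breaking
  rule promises nothing.\<close>

lemma route_exists:
  assumes "geodesic w X" "p \<in> X" "picks_in X es"
  shows "\<exists>\<gamma>. movement w \<gamma> \<and> (\<forall>s\<le>t. \<gamma> s = p) \<and>
    (\<forall>(t', q, e) \<in> set (schedule sys w os t p es). \<gamma> t' = q) \<and>
    (\<forall>s\<ge>finish sys w os t p es. \<gamma> s = \<gamma> (finish sys w os t p es))"
  using assms(2-)
proof (induction es arbitrary: t p)
  case Nil
  have "p \<in> grid w" using geodesicD[OF assms(1) Nil(1) Nil(1)] by (auto simp: reaches_def movement_def)
  then show ?case by (auto intro!: exI[of _ "\<lambda>_. p"] simp: movement_def manhattan_def)
next
  case (Cons e es)
  define q where "q = event_loc sys w p e"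
  have q: "q \<in> X" "picks_in X es" using event_loc_in[OF assms(1) Cons.prems] by (auto simp: q_def)
  define d where "d = travel w p q"
  define t' where "t' = not_before os (t + d) e"
  obtain \<eta> where \<eta>: "movement w \<eta>" "\<eta> 0 = p" "\<eta> d = q" "d \<ge> 0"
    using geodesicD[OF assms(1) Cons.prems(1) q(1)] by (auto simp: reaches_def d_def)
  have t': "t + d \<le> t'" by (simp add: t'_def not_before_ge)
  obtain \<gamma> where \<gamma>: "movement w \<gamma>" "\<forall>s\<le>t'. \<gamma> s = q"
      "\<forall>(t'', q'', e'') \<in> set (schedule sys w os t' q es). \<gamma> t'' = q''"
      "\<forall>s\<ge>finish sys w os t' q es. \<gamma> s = \<gamma> (finish sys w os t' q es)"
    using Cons.IH[OF q, of t'] by blast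
  define \<theta> where "\<theta> = (\<lambda>s. if s \<le> t' then \<eta> (max 0 (min (s - t) d)) else \<gamma> s)"
  have 1: "movement w \<theta>"
    unfolding \<theta>_def
    by (rule movement_join[OF movement_reparametrize[OF \<eta>(1)] \<gamma>(1)]) (use t' \<eta> \<gamma> in auto)
  have 2: "\<forall>s\<le>t. \<theta> s = p" using t' \<eta> by (auto simp: \<theta>_def)
  have at': "\<theta> t' = q" using t' \<eta> by (auto simp: \<theta>_def)
  have later: "\<theta> s = \<gamma> s" if "s \<ge> t'" for s
    using that at' \<gamma>(2) by (cases "s = t'") (auto simp: \<theta>_def)
  have 3: "\<forall>(t'', q'', e'') \<in> set (schedule sys w os t' q es). \<theta> t'' = q''"
  proof clarify
    fix t'' q1 q2 e''
    assume m: "(t'', (q1, q2), e'') \<in> set (schedule sys w os t' q es)"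
    show "\<theta> t'' = (q1, q2)" using \<gamma>(3) m later[OF schedule_ge[OF assms(1) q m]] by auto
  qed
  have 4: "\<forall>s\<ge>finish sys w os t' q es. \<theta> s = \<theta> (finish sys w os t' q es)"
  proof (intro allI impI)
    fix s assume s: "s \<ge> finish sys w os t' q es"
    have "t' \<le> finish sys w os t' q es" by (rule finish_ge[OF assms(1) q])
    with s have "\<theta> s = \<gamma> s" "\<theta> (finish sys w os t' q es) = \<gamma> (finish sys w os t' q es)"
      by (auto intro: later)
    then show "\<theta> s = \<theta> (finish sys w os t' q es)" using \<gamma>(4)[rule_format, OF s] by simp
  qed
  have sch: "schedule sys w os t p (e # es) = (t', q, e) # schedule sys w os t' q es"
      and fin: "finish sys w os t p (e # es) = finish sys w os t' q es"
    by (simp_all add: Let_def q_def d_def t'_def)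
  have 5: "\<forall>(t'', q'', e'') \<in> set (schedule sys w os t p (e # es)). \<theta> t'' = q''"
    unfolding sch using 3 at' by simp
  show ?case
    by (intro exI[of _ \<theta>] conjI 1 2 5) (unfold fin, rule 4)
qed

section \<open>Feasible plans\<close>

definition orders_of :: "batch \<Rightarrow> nat set" where
  "orders_of b = fst ` set b"

lemma feasible_iff:
  "feasible w os {} {} bs \<longleftrightarrow> bs \<noteq> [] \<and> [] \<notin> set (tl bs) \<and> distinct (concat bs) \<and>
     set (concat bs) = items os \<and> (\<forall>b\<in>set bs. card (orders_of b) \<le> capacity w) \<and>
     sorted_wrt (\<lambda>b b'. orders_of b \<inter> orders_of b' = {}) bs"
  by (cases bs) (auto simp: feasible_def Let_def orders_of_def sorted_wrt_map)

text \<open>All items of an order are in some batch, and no other batch contains an item of the order.\<close>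

lemma feasible_whole_orders:
  assumes "feasible w os {} {} bs" "b \<in> set bs" "j \<in> orders_of b" "s \<in> snd (os ! j)"
  shows "(j, s) \<in> set b"
proof -
  obtain s' where "(j, s') \<in> set b" using assms(3) by (auto simp: orders_of_def)
  then have "(j, s') \<in> items os" using assms(1,2) by (auto simp: feasible_iff)
  then have "(j, s) \<in> items os" using assms(4) by (auto simp: items_def)
  then obtain b' where b': "b' \<in> set bs" "(j, s) \<in> set b'" using assms(1) by (auto simp: feasible_iff)
  have "b = b'"
  proof (rule ccontr)
    assume "b \<noteq> b'"
    moreover obtain i i' where "i < length bs" "bs ! i = b" "i' < length bs" "bs ! i' = b'"
      using assms(2) b' by (metis in_set_conv_nth)
    ultimately have "orders_of b \<inter> orders_of b' = {}"
      using assms(1) unfolding feasible_iff sorted_wrt_iff_nth_less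
      by (metis (no_types, lifting) Int_commute linorder_neqE_nat)
    moreover have "j \<in> orders_of b'" using b' by (force simp: orders_of_def)
    ultimately show False using assms(3) by blast
  qed
  then show ?thesis using b' by simp
qed

lemma feasibleI:
  assumes "bs \<noteq> []" "[] \<notin> set bs" "\<And>b. b \<in> set bs \<Longrightarrow> distinct b"
    and whole: "\<And>b. b \<in> set bs \<Longrightarrow> set b = {(j, s). j \<in> orders_of b \<and> s \<in> snd (os ! j)}"
    and "\<And>b. b \<in> set bs \<Longrightarrow> card (orders_of b) \<le> capacity w"
    and disj: "sorted_wrt (\<lambda>b b'. orders_of b \<inter> orders_of b' = {}) bs"
    and all: "(\<Union>b\<in>set bs. orders_of b) = {..<length os}"
  shows "feasible w os {} {} bs"
proof -
  have "distinct (concat bs)"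
    using assms(3) disj
  proof (induction bs)
    case (Cons b bs)
    have "set b \<inter> set (concat bs) = {}" using Cons.prems(2) by (force simp: orders_of_def)
    with Cons show ?case by auto
  qed simp
  moreover have "set (concat bs) = items os"
  proof -
    have "set (concat bs) = (\<Union>b\<in>set bs. {(j, s). j \<in> orders_of b \<and> s \<in> snd (os ! j)})"
      using whole by auto
    also have "\<dots> = {(j, s). j \<in> (\<Union>b\<in>set bs. orders_of b) \<and> s \<in> snd (os ! j)}" by auto
    finally show ?thesis using all by (auto simp: items_def)
  qed
  ultimately show ?thesis using assms by (auto simp: feasible_iff dest: list.set_sel(2))
qed

text \<open>The first batch may be empty, in which case the plan starts by closing it.\<close>

lemma feasible_first_pick:
  assumes "feasible w os {} {} bs" "items os \<noteq> {}"
  obtains Cs j s es c where "events bs = Cs @ Pick j s # es" "Cs = [] \<or> Cs = [Close]"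
    "concat bs = (j, s) # c" "(j, s) \<in> items os" "hd bs = [] \<longleftrightarrow> Cs = [Close]"
proof (cases "hd bs")
  case Nil
  then obtain bs' where bs: "bs = [] # bs'" using assms(1) by (cases bs) (auto simp: feasible_iff)
  then have "bs' \<noteq> []" "[] \<notin> set bs'" using assms by (auto simp: feasible_iff)
  then obtain a b bs'' where bs': "bs' = (a # b) # bs''" by (metis list.set_intros(1) neq_Nil_conv)
  obtain j s where a: "a = (j, s)" by (rule prod.exhaust)
  show ?thesis
  proof (rule that)
    show "events bs = [Close] @ Pick j s # map (\<lambda>(j, s). Pick j s) b @ Close # events bs''"
      "concat bs = (j, s) # b @ concat bs''" by (simp_all add: bs bs' a)
    show "(j, s) \<in> items os" using assms(1) by (auto simp: feasible_iff bs bs' a)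
  qed (use Nil in simp_all)
next
  case (Cons a b)
  then obtain bs' where bs: "bs = (a # b) # bs'" using assms(1) by (cases bs) (auto simp: feasible_iff)
  obtain j s where a: "a = (j, s)" by (rule prod.exhaust)
  show ?thesis
  proof (rule that)
    show "events bs = [] @ Pick j s # map (\<lambda>(j, s). Pick j s) b @ Close # events bs'"
      "concat bs = (j, s) # b @ concat bs'" by (simp_all add: bs a)
    show "(j, s) \<in> items os" using assms(1) by (auto simp: feasible_iff bs a)
  qed (use Cons in simp_all)
qed

text \<open>An optimum is attained because plans permute finitely many items and only the first batch may be
  empty.\<close>

lemma finite_feasible:
  assumes "finite (items os)"
  shows "finite {bs. feasible w os {} {} bs}"
proof (rule finite_subset)
  define L where "L = {b :: batch. set b \<subseteq> items os \<and> length b \<le> card (items os)}"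
  define M where "M = {bs. set bs \<subseteq> L \<and> length bs \<le> Suc (card (items os))}"
  have "finite L" unfolding L_def by (rule finite_lists_length_le[OF assms])
  then show "finite M" unfolding M_def by (rule finite_lists_length_le)
  show "{bs. feasible w os {} {} bs} \<subseteq> M"
  proof clarify
    fix bs assume f: "feasible w os {} {} bs"
    then have d: "distinct (concat bs)" "set (concat bs) = items os" by (auto simp: feasible_iff)
    then have len: "length (concat bs) = card (items os)" by (metis distinct_card)
    have "length b \<le> card (items os)" if "b \<in> set bs" for b
      using that by (subst len[symmetric]) (simp add: length_concat member_le_sum_list)
    moreover have "length bs \<le> Suc (card (items os))"
    proof -
      have nonempty: "length bs' \<le> length (concat bs')" if "[] \<notin> set bs'" for bs' :: "batch list"
        using that
      proof (induction bs')
        case (Cons b bs')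
        then have "length b > 0" "length bs' \<le> length (concat bs')" by auto
        then show ?case unfolding concat.simps length_append list.size by linarith
      qed simp
      have "length bs = Suc (length (tl bs))" using f by (auto simp: feasible_iff)
      also have "length (tl bs) \<le> length (concat (tl bs))" using f by (intro nonempty) (auto simp: feasible_iff)
      also have "\<dots> \<le> length (concat bs)" by (cases bs) auto
      finally show ?thesis using len by simp
    qed
    ultimately show "bs \<in> M" using d by (auto simp: M_def L_def)
  qed
qed

lemma finite_items: "valid_orders w os \<Longrightarrow> finite (items os)"
proof -
  assume v: "valid_orders w os"
  have "items os = (\<Union>j<length os. Pair j ` snd (os ! j))" by (auto simp: items_def)
  moreover have "finite (snd (os ! j))" if "j < length os" for j
  proof -
    obtain r S where rS: "os ! j = (r, S)" by (cases "os ! j")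
    then have "(r, S) \<in> set os" using that by (metis nth_mem)
    then show ?thesis using v rS by (auto simp: valid_orders_def)
  qed
  ultimately show ?thesis by auto
qed

lemma items_in_aisles: "valid_orders w os \<Longrightarrow> (j, s) \<in> items os \<Longrightarrow> s \<in> aisle_points w"
proof -
  assume v: "valid_orders w os" and m: "(j, s) \<in> items os"
  obtain r S where rS: "os ! j = (r, S)" by (cases "os ! j")
  then have "(r, S) \<in> set os" using m by (metis (mono_tags, lifting) case_prodD items_def mem_Collect_eq nth_mem)
  then show ?thesis using v rS m by (auto simp: valid_orders_def items_def)
qed

lemma feasible_picks_in:
  assumes "valid_orders w os" "feasible w os {} {} bs"
  shows "picks_in (aisle_points w) (events bs)"
  using assms items_in_aisles unfolding picks_in_def Pick_in_events by (auto simp: feasible_iff)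

lemma optimal_plans_nonempty:
  assumes "geodesic w (aisle_points w)" "valid_orders w os" "feasible w os {} {} bs"
    and "position st \<in> aisle_points w" "cart st = {}" "picked st = {}"
  shows "optimal_plans sys w os st \<noteq> {}"
proof -
  define c where "c = completion sys w os (now st) (position st)"
  define B where "B = {bs. feasible w os {} {} bs}"
  have "finite B" unfolding B_def by (rule finite_feasible[OF finite_items[OF assms(2)]])
  moreover have "B \<noteq> {}" using assms(3) by (auto simp: B_def)
  ultimately obtain bs' where bs': "bs' \<in> B" "\<forall>bs\<in>B. c bs' \<le> c bs"
    using finite_has_minimal[of "c ` B"] by (metis (no_types, lifting) arg_min_if_finite(1) arg_min_least)
  then have f: "feasible w os {} {} bs'" by (simp add: B_def)
  obtain \<gamma> where \<gamma>: "movement w \<gamma>" "\<forall>s\<le>now st. \<gamma> s = position st"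
      "\<forall>(t', q, e) \<in> set (schedule sys w os (now st) (position st) (events bs')). \<gamma> t' = q"
      "\<forall>s\<ge>finish sys w os (now st) (position st) (events bs').
        \<gamma> s = \<gamma> (finish sys w os (now st) (position st) (events bs'))"
    using route_exists[OF assms(1) assms(4) feasible_picks_in[OF assms(2) f], of "now st" sys os]
    by (elim exE conjE) (rule that)
  have "route sys w os st bs' \<gamma>"
    unfolding route_def Let_def completion_finish
    by (intro conjI \<gamma>(1,3,4)) (simp add: \<gamma>(2))
  then have "(bs', \<gamma>) \<in> optimal_plans sys w os st"
    using f bs' by (auto simp: optimal_plans_def assms B_def c_def)
  then show ?thesis by blast
qed

lemma ciopt_bounds:
  assumes "geodesic w (aisle_points w)" "valid_orders w os" "feasible w os {} {} bs"
  shows "0 \<le> ciopt sys w os" "ciopt sys w os \<le> completion sys w os 0 (depot w) bs"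
proof -
  have "depot w \<in> aisle_points w" using assms(1) by (simp add: geodesic_def)
  then have nn: "0 \<le> completion sys w os 0 (depot w) bs" if "feasible w os {} {} bs" for bs
    unfolding completion_finish
    by (rule finish_ge[OF assms(1) _ feasible_picks_in[OF assms(2) that]])
  define V where "V = {completion sys w os 0 (depot w) bs | bs. feasible w os {} {} bs}"
  have V: "completion sys w os 0 (depot w) bs \<in> V" using assms(3) by (auto simp: V_def)
  have "0 \<le> v" if "v \<in> V" for v using that nn by (auto simp: V_def)
  note V_nonneg = this
  show "0 \<le> ciopt sys w os"
    unfolding ciopt_def V_def[symmetric] by (rule cInf_greatest) (use V V_nonneg in blast)+
  have "bdd_below V" using V_nonneg by (rule bdd_belowI)
  with V show "ciopt sys w os \<le> completion sys w os 0 (depot w) bs"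
    unfolding ciopt_def V_def[symmetric] by (rule cInf_lower)
qed

section \<open>A picker who is lured back and forth\<close>

definition stream :: "order list \<Rightarrow> (nat \<Rightarrow> real) \<Rightarrow> loc set \<Rightarrow> nat \<Rightarrow> order list" where
  "stream base T S n = base @ map (\<lambda>i. (T i, S)) [1..<Suc n]"

definition idle :: "real \<Rightarrow> loc \<Rightarrow> state" where
  "idle t p = \<lparr>now = t, position = p, cart = {}, picked = {}\<rparr>"

lemma idle_simps [simp]:
  "now (idle t p) = t" "position (idle t p) = p" "cart (idle t p) = {}" "picked (idle t p) = {}"
  by (simp_all add: idle_def)

lemma length_stream [simp]: "length (stream base T S n) = length base + n"
  by (simp add: stream_def)

lemma nth_stream_base: "j < length base \<Longrightarrow> stream base T S n ! j = base ! j"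
  by (simp add: stream_def nth_append)

lemma nth_stream: "i < n \<Longrightarrow> stream base T S n ! (length base + i) = (T (Suc i), S)"
  by (simp add: stream_def nth_append del: upt_Suc)

lemma stream_split:
  assumes "i \<le> n"
  shows "stream base T S n = stream base T S i @ map (\<lambda>i. (T i, S)) [Suc i..<Suc n]"
proof -
  have "[1..<Suc n] = [1..<Suc i] @ [Suc i..<Suc n]"
    using assms by (metis Suc_le_mono le_add1 plus_1_eq_Suc upt_add_eq_append le_Suc_ex add_Suc)
  then show ?thesis by (simp add: stream_def del: upt_Suc)
qed

lemma valid_stream:
  assumes base: "\<And>r R. (r, R) \<in> set base \<Longrightarrow> r = 0 \<and> finite R \<and> R \<noteq> {} \<and> R \<subseteq> aisle_points w"
    and T: "T 0 = 0" "strict_mono T"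
    and S: "finite S" "S \<noteq> {}" "S \<subseteq> aisle_points w"
  shows "valid_orders w (stream base T S n)"
proof -
  have nn: "T i \<ge> 0" for i using T by (metis less_eq_nat.simps(1) strict_mono_less_eq)
  have 0: "fst a = 0" if "a \<in> set base" for a using base[of "fst a" "snd a"] that by simp
  have "sorted (map T [1..<Suc n])"
    using T(2) by (auto simp: sorted_iff_nth_mono strict_mono_less_eq simp del: upt_Suc)
  moreover have "sorted (map fst base)"
    unfolding sorted_iff_nth_mono using 0 by (auto simp: nth_mem)
  ultimately have "sorted (map fst (stream base T S n))"
    using nn by (simp add: stream_def sorted_append 0 comp_def del: upt_Suc)
  moreover have "0 \<le> r \<and> finite R \<and> R \<noteq> {} \<and> R \<subseteq> aisle_points w"
    if "(r, R) \<in> set (stream base T S n)" for r R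
  proof -
    have "(r, R) \<in> set base \<or> (\<exists>i. r = T i \<and> R = S)"
      using that by (auto simp: stream_def simp del: upt_Suc)
    then show ?thesis
    proof
      assume "(r, R) \<in> set base"
      from base[OF this] show ?thesis by simp
    next
      assume "\<exists>i. r = T i \<and> R = S"
      then show ?thesis using S nn by blast
    qed
  qed
  ultimately show ?thesis unfolding valid_orders_def by blast
qed

lemma known_stream:
  assumes base: "\<And>a. a \<in> set base \<Longrightarrow> fst a = 0"
    and T: "T 0 = 0" "strict_mono T" and "i \<le> n"
  shows "known (stream base T S n) (T i) = stream base T S i"
proof -
  have nn: "T i \<ge> 0" for i using T by (metis less_eq_nat.simps(1) strict_mono_less_eq)
  have "takeWhile (\<lambda>(r, S). r \<le> T i) (map (\<lambda>i. (T i, S)) [Suc i..<Suc n]) = []"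
  proof (cases "i < n")
    case True
    then have "[Suc i..<Suc n] = Suc i # [Suc (Suc i)..<Suc n]" by (subst upt_conv_Cons) auto
    moreover have "\<not> T (Suc i) \<le> T i" using T(2) by (simp add: strict_mono_less_eq)
    ultimately show ?thesis by (simp del: upt_Suc)
  qed simp
  moreover have "(\<lambda>(r, S). r \<le> T i) a" if "a \<in> set (stream base T S i)" for a
    using that base nn T by (fastforce simp: stream_def strict_mono_less_eq simp del: upt_Suc)
  ultimately show ?thesis
    unfolding known_def stream_split[OF \<open>i \<le> n\<close>] by (subst takeWhile_append2) (auto simp del: upt_Suc)
qed

lemma remdups_replicate_append:
  "m > 0 \<Longrightarrow> distinct (x # ys) \<Longrightarrow> remdups (replicate m x @ ys) = x # ys"
proof (induction m)
  case (Suc m)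
  then show ?case by (cases m) (auto simp: distinct_remdups_id)
qed simp

lemma arrival_times_stream:
  assumes base: "base \<noteq> []" "\<And>a. a \<in> set base \<Longrightarrow> fst a = 0"
    and T: "T 0 = 0" "strict_mono T"
  shows "remdups (map fst (stream base T S n)) = map T [0..<Suc n]"
proof -
  have "map fst base = replicate (length base) 0"
    using base(2) by (intro replicate_eqI) auto
  then have "map fst (stream base T S n) = replicate (length base) 0 @ map T [1..<Suc n]"
    by (simp add: stream_def comp_def del: upt_Suc)
  moreover have d: "distinct (0 # map T [1..<Suc n])"
    using T by (auto simp: distinct_map strict_mono_imp_inj_on strict_mono_eq
        simp flip: T(1) simp del: upt_Suc)
  moreover have "[0..<Suc n] = 0 # [1..<Suc n]" by (simp add: upt_rec)
  ultimately show ?thesis using remdups_replicate_append[OF _ d, of "length base"] base(1) T(1)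
    by (simp del: upt_Suc)
qed

lemma fold_perform_Close:
  "\<forall>x\<in>set xs. snd (snd x) = Close \<Longrightarrow> fold (\<lambda>(t', q, e). perform e) xs (idle t p) = idle t p"
  by (induction xs) (auto simp: idle_def)

text \<open>As long as nothing is picked, the state at an arrival consists of the time and the position only.
  So it does not matter which optimal plans the tie-breaking rule selects, if all of them lead to
  the same position at the next arrival. Closing an empty cart on the way is harmless.\<close>

lemma reopt_lured:
  assumes tb: "tie_breaking tb"
    and base: "base \<noteq> []" "\<And>a. a \<in> set base \<Longrightarrow> fst a = 0"
    and T: "T 0 = 0" "strict_mono T" and start: "pos 0 = depot w"
    and nonempty: "\<And>i. optimal_plans sys w (stream base T S i) (idle (T i) (pos i)) \<noteq> {}"
    and lured: "\<And>i bs \<gamma>. (bs, \<gamma>) \<in> optimal_plans sys w (stream base T S i) (idle (T i) (pos i)) \<Longrightarrow>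
      \<gamma> (T (Suc i)) = pos (Suc i) \<and>
      (\<forall>x\<in>set (takeWhile (\<lambda>(t', q, e). t' \<le> T (Suc i))
          (schedule sys w (stream base T S i) (T i) (pos i) (events bs))). snd (snd x) = Close)"
  shows "\<exists>bs. feasible w (stream base T S n) {} {} bs \<and>
    reopt sys tb w (stream base T S n) = completion sys w (stream base T S n) (T n) (pos n) bs"
proof -
  define os where "os = stream base T S"
  define plans where "plans = (\<lambda>i. optimal_plans sys w (os i) (idle (T i) (pos i)))"
  define chosen where "chosen = (\<lambda>i. tb w (os i) (idle (T i) (pos i)) (plans i))"
  have chosen: "chosen i \<in> plans i" for i
    using tb nonempty[of i] by (auto simp: chosen_def plans_def os_def tie_breaking_def)
  have step: "follow sys w (os n) (chosen i) (T (Suc i)) (idle (T i) (pos i))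
      = idle (T (Suc i)) (pos (Suc i))" if "i < n" for i
  proof -
    obtain bs \<gamma> where P: "chosen i = (bs, \<gamma>)" by (cases "chosen i")
    then have opt: "(bs, \<gamma>) \<in> plans i" using chosen[of i] by simp
    have "fst (os n ! j) = fst (os i ! j)" if "Pick j s \<in> set (events bs)" for j s
    proof -
      have "(j, s) \<in> items (os i)"
        using opt that unfolding plans_def optimal_plans_def Pick_in_events by (auto simp: feasible_iff)
      then have "j < length (os i)" by (simp add: items_def)
      then show ?thesis using stream_split[of i n base T S] \<open>i < n\<close> by (simp add: os_def nth_append)
    qed
    then have same: "schedule sys w (os n) t p (events bs) = schedule sys w (os i) t p (events bs)" for t p
      by (rule schedule_cong)
    have l: "\<gamma> (T (Suc i)) = pos (Suc i)"
        "\<forall>x\<in>set (takeWhile (\<lambda>(t', q, e). t' \<le> T (Suc i))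
          (schedule sys w (os i) (T i) (pos i) (events bs))). snd (snd x) = Close"
      using lured[of bs \<gamma> i] opt by (auto simp: plans_def os_def)
    show ?thesis
      unfolding follow_def P Let_def
      using fold_perform_Close[OF l(2)] l(1) by (simp add: same) 
  qed
  define init :: "state \<times> plan" where
    "init = (\<lparr>now = 0, position = depot w, cart = {}, picked = {}\<rparr>, ([], \<lambda>_. depot w))"
  have known: "known (os n) (T i) = os i" if "i \<le> n" for i
    unfolding os_def by (rule known_stream[OF base(2) T that])
  have "fold (reoptimize sys tb w (os n)) (map T [0..<Suc i]) init = (idle (T i) (pos i), chosen i)"
    if "i \<le> n" for i
    using that
  proof (induction i)
    case 0
    show ?case
      using known[of 0]
      by (simp add: init_def reoptimize_def Let_def follow_def T(1) chosen_def plans_def start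
          idle_def)
  next
    case (Suc i)
    have "fold (reoptimize sys tb w (os n)) (map T [0..<Suc (Suc i)]) init
      = reoptimize sys tb w (os n) (T (Suc i)) (idle (T i) (pos i), chosen i)"
      using Suc by (subst upt_Suc) simp
    also have "\<dots> = (idle (T (Suc i)) (pos (Suc i)), chosen (Suc i))"
      using step[of i] known[of "Suc i"] Suc.prems
      by (simp add: reoptimize_def Let_def chosen_def plans_def)
    finally show ?case .
  qed
  then have "reopt_run sys tb w (os n) = (idle (T n) (pos n), chosen n)"
    unfolding reopt_run_def init_def
    using arrival_times_stream[OF base T, of S n] by (simp add: os_def)
  then have "reopt sys tb w (os n) = completion sys w (os n) (T n) (pos n) (fst (chosen n))"
    by (simp add: reopt_def)
  moreover have "feasible w (os n) {} {} (fst (chosen n))"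
    using chosen[of n] by (auto simp: plans_def optimal_plans_def)
  ultimately show ?thesis by (auto simp: os_def)
qed

section \<open>Linear growth and the asymptotic ratio\<close>

text \<open>On a fixed warehouse the additive constant is fixed, and only the slopes in the number of orders
  count. A negative \<open>\<alpha>\<close> is excluded since the optimum is nonnegative.\<close>

lemma growth_le_competitive:
  assumes comp: "asymp_competitive alg sys \<W> \<alpha>" and "w \<in> \<W>"
    and valid: "\<And>n. valid_orders w (os n)"
    and alg: "\<And>n. alg w (os n) \<ge> a * real n - c"
    and opt: "\<And>n. 0 \<le> ciopt sys w (os n)" "\<And>n. ciopt sys w (os n) \<le> b * real n + c"
    and "a > 0"
  shows "a \<le> \<alpha> * b"
proof -
  obtain K where K: "\<And>n. alg w (os n) \<le> \<alpha> * ciopt sys w (os n) + K"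
    using comp \<open>w \<in> \<W>\<close> valid unfolding asymp_competitive_def by blast
  define \<beta> where "\<beta> = max 0 \<alpha>"
  have "a * real n - c \<le> \<beta> * (b * real n + c) + K" for n
  proof -
    have "\<alpha> * ciopt sys w (os n) \<le> \<beta> * ciopt sys w (os n)"
      using opt(1) by (intro mult_right_mono) (auto simp: \<beta>_def)
    also have "\<dots> \<le> \<beta> * (b * real n + c)"
      using opt(2) by (intro mult_left_mono) (auto simp: \<beta>_def)
    finally show ?thesis using K[of n] alg[of n] by linarith
  qed
  then have bd: "(a - \<beta> * b) * real n \<le> \<beta> * c + c + K" for n
    by (simp add: algebra_simps)
  have "a \<le> \<beta> * b"
  proof (rule ccontr)
    assume "\<not> a \<le> \<beta> * b"
    then have pos: "a - \<beta> * b > 0" by simp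
    obtain n where "(\<beta> * c + c + K) / (a - \<beta> * b) < real n" using reals_Archimedean2 by blast
    then show False using bd[of n] pos by (simp add: field_simps)
  qed
  then show ?thesis using \<open>a > 0\<close> by (auto simp: \<beta>_def max_def split: if_splits)
qed

lemma asymp_ratio_geI:
  assumes "\<And>\<alpha>. asymp_competitive alg sys \<W> \<alpha> \<Longrightarrow> r \<le> \<alpha>"
  shows "asymp_ratio alg sys \<W> \<ge> ereal r"
  unfolding asymp_ratio_def by (rule Inf_greatest) (use assms in auto)

section \<open>Lengths of tours\<close>

fun tour :: "('a \<Rightarrow> 'a \<Rightarrow> real) \<Rightarrow> 'a list \<Rightarrow> real" where
  "tour d (x # y # zs) = d x y + tour d (y # zs)"
| "tour d _ = 0"

abbreviation variation :: "real list \<Rightarrow> real" where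
  "variation \<equiv> tour (\<lambda>x y. \<bar>x - y\<bar>)"

lemma tour_append: "tour d (xs @ y # zs) = tour d (xs @ [y]) + tour d (y # zs)"
proof (induction xs)
  case (Cons x xs)
  then show ?case by (cases xs) auto
qed simp

lemma variation_visit:
  "z \<in> set (x # xs) \<Longrightarrow> \<bar>x - z\<bar> + \<bar>z - last (x # xs)\<bar> \<le> variation (x # xs)"
proof (induction xs arbitrary: x z)
  case (Cons y xs)
  show ?case
  proof (cases "z \<in> set (y # xs)")
    case True
    then show ?thesis using Cons.IH[of z y] by auto
  next
    case False
    then show ?thesis using Cons.IH[of y y] Cons.prems by auto
  qed
qed simp

lemma variation_nonneg: "0 \<le> variation xs"
  using variation_visit[of "hd xs" "hd xs" "tl xs"] by (cases xs) auto

text \<open>Whichever of the two points is visited first, the tour covers the distance between them once.\<close>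

lemma variation_visit_two:
  assumes "a \<in> set (x # xs)" "b \<in> set (x # xs)"
  shows "\<bar>x - a\<bar> + \<bar>a - b\<bar> + \<bar>b - last (x # xs)\<bar> \<le> variation (x # xs) \<or>
    \<bar>x - b\<bar> + \<bar>b - a\<bar> + \<bar>a - last (x # xs)\<bar> \<le> variation (x # xs)"
  using assms
proof (induction xs arbitrary: x)
  case (Cons y xs)
  consider "a = x" | "b = x" | "a \<in> set (y # xs)" "b \<in> set (y # xs)" using Cons.prems by auto
  then show ?case
  proof cases
    case 1
    then show ?thesis using variation_visit[OF Cons.prems(2)] by simp
  next
    case 2
    then show ?thesis using variation_visit[OF Cons.prems(1)] by simp
  next
    case 3
    have step: "variation (x # y # xs) = \<bar>x - y\<bar> + variation (y # xs)"
        "last (x # y # xs) = last (y # xs)" by simp_all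
    from Cons.IH[OF 3] show ?thesis
      unfolding step by (rule disjE) linarith+
  qed
qed auto

text \<open>With the coordinates for \<open>f\<close> and \<open>g\<close>, this treats horizontal and vertical moves separately.\<close>

lemma tour_mono:
  assumes "\<And>p q. p \<in> set ps \<Longrightarrow> q \<in> set ps \<Longrightarrow> \<bar>f p - f q\<bar> + \<bar>g p - g q\<bar> \<le> d p q"
  shows "variation (map f ps) + variation (map g ps) \<le> tour d ps"
  using assms
proof (induction ps)
  case (Cons p ps)
  have IH: "variation (map f ps) + variation (map g ps) \<le> tour d ps"
    by (rule Cons.IH) (use Cons.prems in auto)
  show ?case
  proof (cases ps)
    case (Cons q qs)
    then show ?thesis using IH Cons.prems[of p q] by simp
  qed simp
qed simp

section \<open>Robots in a single aisle\<close>

definition line_warehouse :: "real \<Rightarrow> warehouse" where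
  "line_warehouse \<epsilon> = \<lparr>len = 0, width = 4, aisles = 1, cross_aisles = 2,
     depot = (0, 3 - \<epsilon>), capacity = 1\<rparr>"

lemma line_grid:
  "aisle_points (line_warehouse \<epsilon>) = {0} \<times> {0..4}" "grid (line_warehouse \<epsilon>) = {0} \<times> {0..4}"
proof -
  show a: "aisle_points (line_warehouse \<epsilon>) = {0} \<times> {0..4}"
    by (auto simp: aisle_points_def aisle_xs_def line_warehouse_def)
  have "cross_ys (line_warehouse \<epsilon>) \<subseteq> {0..4}"
    by (auto simp: cross_ys_def line_warehouse_def)
  then show "grid (line_warehouse \<epsilon>) = {0} \<times> {0..4}"
    unfolding grid_def a by (auto simp: line_warehouse_def)
qed

lemma line_reaches:
  assumes "p \<in> {0} \<times> {0..4}" "q \<in> {0} \<times> {0..4}"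
  shows "reaches (line_warehouse \<epsilon>) \<bar>snd p - snd q\<bar> p q"
proof -
  have "reaches (line_warehouse \<epsilon>) (manhattan p q) p q"
    by (rule reaches_straight) (use assms in \<open>auto simp: line_grid\<close>)
  then show ?thesis using assms by (auto simp: manhattan_def)
qed

lemma line_travel:
  assumes "p \<in> {0} \<times> {0..4}" "q \<in> {0} \<times> {0..4}"
  shows "travel (line_warehouse \<epsilon>) p q = \<bar>snd p - snd q\<bar>"
proof (rule travel_eqI[OF line_reaches[OF assms]])
  fix T assume "reaches (line_warehouse \<epsilon>) T p q"
  then obtain \<gamma> where "movement (line_warehouse \<epsilon>) \<gamma>" "\<gamma> 0 = p" "\<gamma> T = q" "T \<ge> 0"
    by (auto simp: reaches_def)
  then have "manhattan p q \<le> \<bar>0 - T\<bar>" by (metis movement_def)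
  then show "\<bar>snd p - snd q\<bar> \<le> T" using \<open>T \<ge> 0\<close> by (auto simp: manhattan_def)
qed

definition heights :: "event list \<Rightarrow> real list" where
  "heights es = concat (map (\<lambda>e. case e of Pick j s \<Rightarrow> [snd s] | Close \<Rightarrow> []) es)"

lemma heights_simps [simp]:
  "heights [] = []" "heights (Pick j s # es) = snd s # heights es"
  "heights (Close # es) = heights es" "heights (es @ es') = heights es @ heights es'"
  by (auto simp: heights_def)

lemma heights_events: "heights (events bs) = map (\<lambda>(j, s). snd s) (concat bs)"
proof -
  have "heights (map (\<lambda>(j, s). Pick j s) b) = map (\<lambda>(j, s). snd s) b" for b
    by (induction b) auto
  then show ?thesis by (induction bs) auto
qed

text \<open>Closing a batch does not move a robot picker, so that only the sequence of picks counts.\<close>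

lemma line_trip:
  assumes "p \<in> {0} \<times> {0..4}" "picks_in ({0} \<times> {0..4}) es"
  shows "trip Robot (line_warehouse \<epsilon>) p es = variation (snd p # heights es)"
  using assms
proof (induction es arbitrary: p)
  case (Cons e es)
  then show ?case by (cases e) (auto simp: line_travel)
qed simp

text \<open>Clamping to a segment turns the variation of a tour into the distance walked in this segment.\<close>

definition clamp :: "real \<Rightarrow> real \<Rightarrow> real \<Rightarrow> real" where
  "clamp l r x = max l (min r x)"

lemma clamp_values:
  "clamp 0 1 0 = 0" "clamp 0 1 1 = 1" "clamp 0 1 2 = 1" "clamp 0 1 4 = 1"
  "clamp 1 2 0 = 1" "clamp 1 2 1 = 1" "clamp 1 2 2 = 2" "clamp 1 2 4 = 2"
  "clamp 2 4 0 = 2" "clamp 2 4 1 = 2" "clamp 2 4 2 = 2" "clamp 2 4 4 = 4"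
  by (simp_all add: clamp_def)

lemma variation_clamp:
  assumes "set xs \<subseteq> {0..4}"
  shows "variation xs = variation (map (clamp 0 1) xs) + variation (map (clamp 1 2) xs)
    + variation (map (clamp 2 4) xs)"
  using assms
proof (induction xs)
  case (Cons x xs)
  then show ?case
  proof (cases xs)
    case Cons': (Cons y ys)
    have "\<bar>x - y\<bar> = \<bar>clamp 0 1 x - clamp 0 1 y\<bar> + \<bar>clamp 1 2 x - clamp 1 2 y\<bar>
      + \<bar>clamp 2 4 x - clamp 2 4 y\<bar>"
      using Cons.prems Cons' by (auto simp: clamp_def max_def min_def abs_if)
    then show ?thesis using Cons Cons' by simp
  qed simp
qed simp

text \<open>Each step between 1 and 2 changes the side, and the end points determine the parity of their
  number.\<close>

lemma variation_parity:
  assumes "set (x # xs) \<subseteq> {1, 2}"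
  shows "\<exists>m::int. variation (x # xs) = \<bar>x - last (x # xs)\<bar> + 2 * of_int m"
  using assms
proof (induction xs arbitrary: x)
  case (Cons y xs)
  obtain m :: int where m: "variation (y # xs) = \<bar>y - last (y # xs)\<bar> + 2 * of_int m"
    using Cons.IH[of y] Cons.prems by auto
  have l: "last (y # xs) \<in> {1, 2}" using Cons.prems last_in_set[of "y # xs"]
    by (meson list.distinct(2) set_subset_Cons subsetD)
  define z where "z = last (y # xs)"
  have "\<exists>n::int. \<bar>x - y\<bar> + \<bar>y - z\<bar> = \<bar>x - z\<bar> + 2 * of_int n"
  proof (rule exI[of _ "if x = z \<and> x \<noteq> y then 1 else 0"])
    have "x \<in> {1, 2}" "y \<in> {1, 2}" "z \<in> {1, 2}" using l Cons.prems by (simp_all add: z_def)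
    then show "\<bar>x - y\<bar> + \<bar>y - z\<bar> = \<bar>x - z\<bar> + 2 * of_int (if x = z \<and> x \<noteq> y then 1 else 0)"
      by auto
  qed
  then obtain n :: int where n: "\<bar>x - y\<bar> + \<bar>y - z\<bar> = \<bar>x - z\<bar> + 2 * of_int n" by blast
  have "variation (x # y # xs) = \<bar>x - last (x # y # xs)\<bar> + 2 * of_int (m + n)"
    using m n by (simp add: z_def)
  then show ?case by blast
qed auto

lemma variation_append_ge: "variation xs + variation ys \<le> variation (xs @ ys)"
proof (induction xs)
  case (Cons x xs)
  show ?case
  proof (cases xs)
    case Nil
    then show ?thesis by (cases ys) auto
  qed (use Cons in auto)
qed (simp add: variation_nonneg)

text \<open>With one bin, the two items of an order are consecutive, so that each order has its own crossing
  of [1,2].\<close>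

lemma crossings_ge_card:
  assumes "\<And>b. b \<in> set bs \<Longrightarrow> card (orders_of b) \<le> 1"
    and "\<And>b j. b \<in> set bs \<Longrightarrow> j \<in> orders_of b \<inter> J \<Longrightarrow> (j, (0, 1)) \<in> set b \<and> (j, (0, 2)) \<in> set b"
  shows "real (card ((\<Union>b\<in>set bs. orders_of b) \<inter> J))
    \<le> variation (map (clamp 1 2) (map (\<lambda>(j, s). snd s) (concat bs)))"
  using assms
proof (induction bs)
  case (Cons b bs)
  define f where "f = (\<lambda>b :: batch. map (clamp 1 2) (map (\<lambda>(j, s). snd s) b))"
  have fin: "finite (orders_of b)" by (simp add: orders_of_def)
  have b: "real (card (orders_of b \<inter> J)) \<le> variation (f b)"
  proof (cases "orders_of b \<inter> J = {}")
    case True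
    then show ?thesis by (simp add: variation_nonneg)
  next
    case False
    then obtain j where "j \<in> orders_of b \<inter> J" by blast
    then have "(j, (0, 1)) \<in> set b" "(j, (0, 2)) \<in> set b" using Cons.prems(2)[of b j] by auto
    then have "clamp 1 2 1 \<in> set (f b)" "clamp 1 2 2 \<in> set (f b)" by (force simp: f_def)+
    then have v: "1 \<in> set (f b)" "2 \<in> set (f b)" by (simp_all add: clamp_def)
    then obtain x xs where "f b = x # xs" by (cases "f b") auto
    then have "1 \<le> variation (f b)" using variation_visit_two[of 1 x xs 2] v by auto
    moreover have "card (orders_of b \<inter> J) \<le> 1"
      using Cons.prems(1)[of b] card_mono[OF fin, of "orders_of b \<inter> J"] by simp
    ultimately show ?thesis by linarith
  qed
  have "card ((\<Union>b\<in>set (b # bs). orders_of b) \<inter> J)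
      \<le> card (orders_of b \<inter> J) + card ((\<Union>b\<in>set bs. orders_of b) \<inter> J)"
    using card_Un_le[of "orders_of b \<inter> J" "(\<Union>b\<in>set bs. orders_of b) \<inter> J"]
    by (simp add: Int_Un_distrib2)
  also have "real \<dots> \<le> variation (f b) + variation (f (concat bs))"
    using b Cons by (simp add: f_def)
  also have "\<dots> \<le> variation (f b @ f (concat bs))" by (rule variation_append_ge)
  finally show ?case by (simp add: f_def)
qed simp

text \<open>Both bounds count the distance walked in [0,1], [1,2] and [2,4]. A tour that starts in the left
  part has to go to 4, and either it ends there, after an even number of crossings of [1,2]
  if it comes from the right of 2, or it walks [2,4] back as well. As \<open>k\<close> is odd, an even number of
  crossings is at least \<open>k + 1\<close>.\<close>

lemma tour_left_first:
  assumes xs: "set (y # ys) = {0, 1, 2, 4}" and y: "y \<le> 2" "2 \<le> p"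
    and k: "real k \<le> variation (map (clamp 1 2) (y # ys))" "odd k"
  shows "p + real k + 3 \<le> variation (p # y # ys)"
proof -
  define e where "e = last (y # ys)"
  define V where "V = (\<lambda>l r. variation (map (clamp l r) (y # ys)))"
  have e: "e \<in> {0, 1, 2, 4}" using xs last_in_set[of "y # ys"] by (simp add: e_def)
  have l: "last (map f (y # ys)) = f e" for f :: "real \<Rightarrow> real"
    by (simp only: last_map[OF list.distinct(2)] e_def)
  have "clamp 0 1 0 \<in> set (map (clamp 0 1) (y # ys))" "clamp 2 4 4 \<in> set (map (clamp 2 4) (y # ys))"
    using xs by (metis image_eqI insertCI list.set_map)+
  then have 1: "\<bar>clamp 0 1 y - clamp 0 1 0\<bar> + \<bar>clamp 0 1 0 - clamp 0 1 e\<bar> \<le> V 0 1"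
      and 2: "\<bar>clamp 2 4 y - clamp 2 4 4\<bar> + \<bar>clamp 2 4 4 - clamp 2 4 e\<bar> \<le> V 2 4"
    using variation_visit[of _ "clamp 0 1 y" "map (clamp 0 1) ys"]
      variation_visit[of _ "clamp 2 4 y" "map (clamp 2 4) ys"] l by (auto simp: V_def)
  have "set (map (clamp 1 2) (y # ys)) \<subseteq> {1, 2}" unfolding set_map xs by (auto simp: clamp_def)
  then obtain m :: int where 3: "V 1 2 = \<bar>clamp 1 2 y - clamp 1 2 e\<bar> + 2 * of_int m"
    using variation_parity[of "clamp 1 2 y" "map (clamp 1 2) ys"] l unfolding V_def by auto
  have 4: "real k \<le> V 1 2" using k by (simp add: V_def)
  have "variation (y # ys) = V 0 1 + V 1 2 + V 2 4"
    unfolding V_def by (rule variation_clamp) (use xs in auto)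
  then have v: "variation (p # y # ys) = p - y + V 0 1 + V 1 2 + V 2 4" using y by simp
  have 5: "clamp 1 2 y = clamp 1 2 e \<longrightarrow> real k + 1 \<le> V 1 2"
  proof
    assume that: "clamp 1 2 y = clamp 1 2 e"
    have "int k \<le> 2 * m" using 3 4 that by linarith
    moreover have "int k \<noteq> 2 * m" using k(2) by presburger
    ultimately have "int k + 1 \<le> 2 * m" by simp
    then show "real k + 1 \<le> V 1 2" using 3 that by linarith
  qed
  have "y \<in> {0, 1, 2, 4}" by (subst xs[symmetric]) simp
  then have "y \<in> {0, 1, 2}" using y by auto
  then show ?thesis
    using e unfolding v
    by (elim insertE emptyE, insert 1 2 4 5) (simp_all add: clamp_values)
qed

text \<open>A tour that starts at 4 has to go to 0, and either it ends there, after an odd number of crossings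
  of [1,2], hence at least \<open>k + 1\<close> since \<open>k\<close> is even, or it walks [0,1] twice.\<close>

lemma tour_right_first:
  assumes xs: "set (4 # ys) = {0, 1, 2, 4}" and p: "p \<le> 4"
    and k: "real k \<le> variation (map (clamp 1 2) (4 # ys))" "even k"
  shows "8 - p + real k \<le> variation (p # 4 # ys)"
proof -
  define e where "e = last (4 # ys)"
  define V where "V = (\<lambda>l r. variation (map (clamp l r) (4 # ys)))"
  have e: "e \<in> {0, 1, 2, 4}" using xs last_in_set[of "4 # ys"] by (simp add: e_def)
  have l: "last (map f (4 # ys)) = f e" for f :: "real \<Rightarrow> real"
    by (simp only: last_map[OF list.distinct(2)] e_def)
  have "clamp 0 1 0 \<in> set (map (clamp 0 1) (4 # ys))" "clamp 2 4 0 \<in> set (map (clamp 2 4) (4 # ys))"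
    using xs by (metis image_eqI insertCI list.set_map)+
  then have 1: "\<bar>clamp 0 1 4 - clamp 0 1 0\<bar> + \<bar>clamp 0 1 0 - clamp 0 1 e\<bar> \<le> V 0 1"
      and 2: "\<bar>clamp 2 4 4 - clamp 2 4 0\<bar> + \<bar>clamp 2 4 0 - clamp 2 4 e\<bar> \<le> V 2 4"
    using variation_visit[of _ "clamp 0 1 4" "map (clamp 0 1) ys"]
      variation_visit[of _ "clamp 2 4 4" "map (clamp 2 4) ys"] l by (auto simp: V_def)
  have "set (map (clamp 1 2) (4 # ys)) \<subseteq> {1, 2}" unfolding set_map xs by (auto simp: clamp_def)
  then obtain m :: int where 3: "V 1 2 = \<bar>clamp 1 2 4 - clamp 1 2 e\<bar> + 2 * of_int m"
    using variation_parity[of "clamp 1 2 4" "map (clamp 1 2) ys"] l unfolding V_def by auto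
  have 4: "real k \<le> V 1 2" using k by (simp add: V_def)
  have "variation (4 # ys) = V 0 1 + V 1 2 + V 2 4"
    unfolding V_def by (rule variation_clamp) (use xs in auto)
  then have v: "variation (p # 4 # ys) = 4 - p + V 0 1 + V 1 2 + V 2 4" using p by simp
  have 5: "clamp 1 2 e = 1 \<longrightarrow> real k + 1 \<le> V 1 2"
  proof
    assume "clamp 1 2 e = 1"
    then have that: "\<bar>clamp 1 2 4 - clamp 1 2 e\<bar> = 1" by (simp add: clamp_values)
    have "int k \<le> 1 + 2 * m" using 3 4 that by linarith
    moreover have "int k \<noteq> 1 + 2 * m" using k(2) by presburger
    ultimately have "int k + 1 \<le> 1 + 2 * m" by simp
    then show "real k + 1 \<le> V 1 2" using 3 that by linarith
  qed
  show ?thesis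
    using e unfolding v
    by (elim insertE emptyE, insert 1 2 4 5) (simp_all add: clamp_values)
qed

definition pair :: "loc set" where
  "pair = {(0, 1), (0, 2)}"

definition line_base :: "order list" where
  "line_base = [(0, {(0, 0)}), (0, {(0, 4)}), (0, pair), (0, pair)]"

definition leg :: "bool \<Rightarrow> nat \<Rightarrow> batch" where
  "leg up j = (if up then [(j, (0, 1)), (j, (0, 2))] else [(j, (0, 2)), (j, (0, 1))])"

text \<open>An even number of pairs leads back to 2, an odd number from 2 to 1.\<close>

definition zigzag :: "nat list \<Rightarrow> batch list" where
  "zigzag js = map (\<lambda>i. leg (odd i) (js ! i)) [0..<length js]"

text \<open>For even \<open>n\<close> the zigzag of \<open>n + 1\<close> pairs ends at 1, and the item at 0 is a detour before the last pair is
  crossed on the way to the right.\<close>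

definition left_plan :: "nat \<Rightarrow> batch list" where
  "left_plan n = zigzag [2..<3 + n] @ [[(0, (0, 0))], leg True (3 + n), [(1, (0, 4))]]"

definition right_plan :: "nat \<Rightarrow> batch list" where
  "right_plan n = [(1, (0, 4))] # zigzag [2..<4 + n] @ [[(0, (0, 0))]]"

lemma orders_of_leg [simp]: "orders_of (leg up j) = {j}"
  by (auto simp: orders_of_def leg_def)

lemma orders_of_single [simp]: "orders_of [(j, s)] = {j}"
  by (simp add: orders_of_def)

lemma set_leg: "set (leg up j) = {j} \<times> pair"
  by (auto simp: leg_def pair_def)

lemma length_zigzag [simp]: "length (zigzag js) = length js"
  by (simp add: zigzag_def)

lemma set_zigzag: "b \<in> set (zigzag js) \<Longrightarrow> \<exists>up j. j \<in> set js \<and> b = leg up j"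
  unfolding zigzag_def by (auto simp del: orders_of_leg) (metis nth_mem)

lemma orders_zigzag: "(\<Union>b\<in>set (zigzag js). orders_of b) = set js"
  by (auto simp: zigzag_def set_conv_nth)

lemma disjoint_zigzag:
  "distinct js \<Longrightarrow> sorted_wrt (\<lambda>b b'. orders_of b \<inter> orders_of b' = {}) (zigzag js)"
  by (auto simp: zigzag_def sorted_wrt_iff_nth_less nth_eq_iff_index_eq)

text \<open>The pairs arrive a little faster than at unit rate, such that the picker, who turns round at
  \<open>2 + \<epsilon>\<close> and \<open>3 - \<epsilon>\<close>, never gets to an item. Two pairs are available from the beginning,
  since the parity argument needs at least one pair.\<close>

locale line_instance =
  fixes \<epsilon> :: real
  assumes eps: "0 < \<epsilon>" "\<epsilon> < 1 / 4"
begin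

abbreviation "w \<equiv> line_warehouse \<epsilon>"

definition time :: "nat \<Rightarrow> real" where
  "time i = real i * (1 - 2 * \<epsilon>)"

definition os :: "nat \<Rightarrow> order list" where
  "os = stream line_base time pair"

definition pos :: "nat \<Rightarrow> loc" where
  "pos i = (0, if even i then 3 - \<epsilon> else 2 + \<epsilon>)"

lemma simps [simp]: "capacity w = 1" "depot w = (0, 3 - \<epsilon>)"
  by (simp_all add: line_warehouse_def)

lemma valid_w: "valid_warehouse w"
  using eps by (simp add: valid_warehouse_def line_grid) (simp add: line_warehouse_def)

lemma geodesic: "geodesic w (aisle_points w)"
  unfolding geodesic_def line_grid
  using eps by (auto simp: line_travel intro!: line_reaches[where p = "(_, _)" and q = "(_, _)", simplified])

lemma time: "time 0 = 0" "strict_mono time" "time i \<ge> 0" "time (Suc i) = time i + (1 - 2 * \<epsilon>)"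
proof -
  show "time 0 = 0" "time i \<ge> 0" using eps by (simp_all add: time_def)
  show "time (Suc i) = time i + (1 - 2 * \<epsilon>)" by (simp add: time_def algebra_simps)
  show "strict_mono time"
    unfolding time_def using eps by (intro strict_monoI mult_strict_right_mono) auto
qed

lemma length_os [simp]: "length (os n) = 4 + n"
  by (simp add: os_def line_base_def)

lemma nth_os: "2 \<le> j \<Longrightarrow> j < 4 + n \<Longrightarrow> os n ! j = (time (j - 3), pair)"
  "os n ! 0 = (0, {(0, 0)})" "os n ! Suc 0 = (0, {(0, 4)})"
proof -
  assume j: "2 \<le> j" "j < 4 + n"
  show "os n ! j = (time (j - 3), pair)"
  proof (cases "j < 4")
    case True
    then have "j = 2 \<or> j = 3" using j by auto
    then show ?thesis by (auto simp: os_def nth_stream_base line_base_def time)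
  next
    case False
    then obtain m where m: "j = 4 + m" by (metis le_add_diff_inverse not_less)
    have "length line_base = 4" by (simp add: line_base_def)
    then show ?thesis using nth_stream[of m n line_base time pair] j m by (simp add: os_def)
  qed
qed (simp_all add: os_def nth_stream_base line_base_def)

lemma release_le: "2 \<le> j \<Longrightarrow> j < 4 + n \<Longrightarrow> fst (os n ! j) \<le> time n"
  using time(2) by (simp add: nth_os strict_mono_less_eq)

lemma valid_os: "valid_orders w (os n)"
  unfolding os_def by (rule valid_stream[OF _ time(1,2)]) (auto simp: line_grid line_base_def pair_def)

lemma items_os: "items (os n) = {(0, (0, 0)), (1, (0, 4))} \<union> {2..<4 + n} \<times> pair"
proof -
  have "items (os n) = (\<Union>j\<in>{..<4 + n}. {j} \<times> snd (os n ! j))" by (auto simp: items_def)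
  also have "{..<4 + n} = {0, 1} \<union> {2..<4 + n}" by auto
  finally show ?thesis by (auto simp: nth_os)
qed

lemma feasible_plan:
  assumes "\<And>b. b \<in> set bs \<Longrightarrow> b = [(0, (0, 0))] \<or> b = [(1, (0, 4))] \<or> (\<exists>up j. 2 \<le> j \<and> j < 4 + n \<and> b = leg up j)"
    and "sorted_wrt (\<lambda>b b'. orders_of b \<inter> orders_of b' = {}) bs"
    and "(\<Union>b\<in>set bs. orders_of b) = {..<4 + n}"
  shows "feasible w (os n) {} {} bs"
proof (rule feasibleI)
  have "0 \<in> {..<4 + n}" by simp
  then show "bs \<noteq> []" using assms(3) by (metis UN_empty empty_iff list.set(1))
  show "[] \<notin> set bs" using assms(1)[of "[]"] by (auto simp: leg_def split: if_splits)
  fix b assume "b \<in> set bs"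
  from assms(1)[OF this] have "distinct b \<and> set b = {(j, s). j \<in> orders_of b \<and> s \<in> snd (os n ! j)} \<and>
      card (orders_of b) \<le> 1"
    by (elim disjE exE) (auto simp: set_leg nth_os, auto simp: leg_def)
  then show "distinct b" "set b = {(j, s). j \<in> orders_of b \<and> s \<in> snd (os n ! j)}"
      "card (orders_of b) \<le> capacity w" by simp_all
qed (use assms in simp_all)

lemma feasible_left: "feasible w (os n) {} {} (left_plan n)"
proof (rule feasible_plan)
  show "(\<Union>b\<in>set (left_plan n). orders_of b) = {..<4 + n}"
    by (auto simp: left_plan_def orders_zigzag)
  show "sorted_wrt (\<lambda>b b'. orders_of b \<inter> orders_of b' = {}) (left_plan n)"
    using disjoint_zigzag[of "[2..<3 + n]"]
    by (auto simp: left_plan_def sorted_wrt_append dest!: set_zigzag)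
  fix b assume "b \<in> set (left_plan n)"
  then consider "b = [(0, (0, 0))]" | "b = [(1, (0, 4))]" | "b = leg True (3 + n)"
    | "b \<in> set (zigzag [2..<3 + n])" by (auto simp: left_plan_def)
  then show "b = [(0, (0, 0))] \<or> b = [(1, (0, 4))] \<or> (\<exists>up j. 2 \<le> j \<and> j < 4 + n \<and> b = leg up j)"
  proof cases
    case 3
    then show ?thesis by (intro disjI2 exI[of _ True] exI[of _ "3 + n"]) simp
  next
    case 4
    then obtain up j where "2 \<le> j" "j < 3 + n" "b = leg up j"
      using set_zigzag by (metis atLeastLessThan_iff set_upt)
    then show ?thesis by (intro disjI2 exI[of _ up] exI[of _ j]) simp
  qed simp_all
qed

lemma feasible_right: "feasible w (os n) {} {} (right_plan n)"
proof (rule feasible_plan)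
  show "(\<Union>b\<in>set (right_plan n). orders_of b) = {..<4 + n}"
    by (auto simp: right_plan_def orders_zigzag)
  show "sorted_wrt (\<lambda>b b'. orders_of b \<inter> orders_of b' = {}) (right_plan n)"
    using disjoint_zigzag[of "[2..<4 + n]"]
    by (auto simp: right_plan_def sorted_wrt_append dest!: set_zigzag)
  fix b assume "b \<in> set (right_plan n)"
  then consider "b = [(0, (0, 0))]" | "b = [(1, (0, 4))]" | "b \<in> set (zigzag [2..<4 + n])"
    by (auto simp: right_plan_def)
  then show "b = [(0, (0, 0))] \<or> b = [(1, (0, 4))] \<or> (\<exists>up j. 2 \<le> j \<and> j < 4 + n \<and> b = leg up j)"
  proof cases
    case 3
    then obtain up j where "2 \<le> j" "j < 4 + n" "b = leg up j"
      using set_zigzag by (metis atLeastLessThan_iff set_upt)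
    then show ?thesis by (intro disjI2 exI[of _ up] exI[of _ j]) simp
  qed simp_all
qed

text \<open>Alternating directions cost exactly 1 per pair once the picker is at 2, so that she never waits for
  orders that arrive at unit rate.\<close>

lemma finish_zigzag:
  assumes "p \<in> {0} \<times> {2..4}" "\<And>i. i < length js \<Longrightarrow> fst (os n ! (js ! i)) \<le> \<tau> + real i" "t \<le> \<tau>"
  shows "finish Robot w (os n) t p (events (zigzag js)) \<le> \<tau> + (snd p - 2) + real (length js) \<and>
    (js \<noteq> [] \<longrightarrow> dest Robot w p (events (zigzag js)) = (0, if even (length js) then 2 else 1))"
proof -
  define z where "z = (\<lambda>i :: nat. if i = 0 then p else (0, if even i then 2 else 1 :: real))"
  have z: "z i \<in> {0} \<times> {0..4}" for i using assms(1) by (auto simp: z_def)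
  have "finish Robot w (os n) t (z 0) (events (zigzag js))
      \<le> \<tau> + (snd p - 2) + real (length (zigzag js)) * 1 \<and>
    dest Robot w (z 0) (events (zigzag js)) = z (length (zigzag js))"
  proof (rule pipelined_batches[OF geodesic, unfolded line_grid])
    fix i assume "i < length (zigzag js)"
    then have nth: "zigzag js ! i = leg (odd i) (js ! i)" by (simp add: zigzag_def)
    have "trip Robot w (z i) (events [zigzag js ! i])
        = variation (snd (z i) # heights (events [zigzag js ! i]))"
      by (rule line_trip) (auto simp: z[of i, simplified] nth leg_def)
    also have "\<dots> \<le> 1 + (if i = 0 then snd p - 2 else 0)"
      using assms(1) by (auto simp: nth leg_def z_def)
    finally show "trip Robot w (z i) (events [zigzag js ! i]) \<le> 1 + (if i = 0 then snd p - 2 else 0)" .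
    show "dest Robot w (z i) (events [zigzag js ! i]) = z (Suc i)"
      by (auto simp: nth leg_def z_def)
    fix j s assume "(j, s) \<in> set (zigzag js ! i)"
    then show "s \<in> {0} \<times> {0..4}" "fst (os n ! j) \<le> \<tau> + real i * 1"
      using assms(2)[of i] \<open>i < length (zigzag js)\<close> by (auto simp: nth set_leg pair_def)
  qed (use z assms in auto)
  then show ?thesis by (auto simp: z_def)
qed

lemma finish_left:
  assumes "p \<in> {0} \<times> {2..4}" "even n" "time n \<le> t"
  shows "finish Robot w (os n) t p (events (left_plan n)) \<le> t + snd p + real n + 4"
proof -
  define T where "T = finish Robot w (os n) t p (events (zigzag [2..<3 + n]))"
  have "fst (os n ! ([2..<3 + n] ! i)) \<le> t + real i" if "i < length [2..<3 + n]" for i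
    using release_le[of "2 + i" n] that assms(3) by (simp del: upt_Suc)
  from finish_zigzag[OF assms(1) this order_refl]
  have T: "T \<le> t + (snd p - 2) + real (n + 1)"
      and d: "dest Robot w p (events (zigzag [2..<3 + n])) = (0, 1)"
    using assms(2) by (auto simp: T_def simp del: upt_Suc)
  have "t \<le> T"
    unfolding T_def
    by (rule finish_ge[OF geodesic])
      (use assms(1) in \<open>auto simp: line_grid picks_in_def Pick_in_events pair_def set_leg dest!: set_zigzag\<close>)
  then have "time n \<le> T" using assms(3) by simp
  then have late: "0 \<le> T" "fst (os n ! (3 + n)) \<le> T"
    using time(3)[of n] release_le[of "3 + n" n] by auto
  define es where "es = events [[(0, (0, 0))], leg True (3 + n), [(1, (0, 4))]]"
  have picks: "picks_in ({0} \<times> {0..4}) es" by (simp add: es_def leg_def)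
  have "finish Robot w (os n) T (0, 1) es \<le> T + trip Robot w (0, 1) es"
  proof (rule finish_le_trip[OF geodesic, unfolded line_grid, OF _ picks _ order_refl])
    fix j s assume "Pick j s \<in> set es"
    then have "j = 0 \<or> j = 3 + n \<or> j = Suc 0" by (auto simp: es_def leg_def)
    then show "fst (os n ! j) \<le> T" using late nth_os(2,3)[of n] by auto
  qed simp
  also have "trip Robot w (0, 1) es = 5"
    by (subst line_trip[OF _ picks]) (simp_all add: es_def leg_def)
  finally have "finish Robot w (os n) T (0, 1) es \<le> T + 5" .
  then show ?thesis
    using T unfolding left_plan_def events_append finish_append d T_def[symmetric] es_def by simp
qed

lemma finish_right:
  assumes "p \<in> {0} \<times> {2..4}" "0 \<le> t" "t + (4 - snd p) \<le> \<tau>"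
    and "\<And>i. i < n + 2 \<Longrightarrow> fst (os n ! (2 + i)) \<le> \<tau> + real i"
  shows "finish Robot w (os n) t p (events (right_plan n)) \<le> \<tau> + real n + (if even n then 6 else 5)"
proof -
  define T where "T = finish Robot w (os n) (t + (4 - snd p)) (0, 4) (events (zigzag [2..<4 + n]))"
  have "fst (os n ! ([2..<4 + n] ! i)) \<le> \<tau> + real i" if "i < length [2..<4 + n]" for i
    using assms(4)[of i] that by (simp del: upt_Suc)
  from finish_zigzag[OF _ this assms(3), of "(0, 4)"]
  have T: "T \<le> \<tau> + 2 + real (n + 2)"
      and d: "dest Robot w (0, 4) (events (zigzag [2..<4 + n])) = (0, if even n then 2 else 1)"
    by (auto simp: T_def simp del: upt_Suc)
  have "0 \<le> t + (4 - snd p)" using assms by auto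
  also have "t + (4 - snd p) \<le> T"
    unfolding T_def
    by (rule finish_ge[OF geodesic])
      (auto simp: line_grid picks_in_def Pick_in_events pair_def set_leg dest!: set_zigzag)
  finally have "0 \<le> T" .
  have "finish Robot w (os n) t p (events (right_plan n))
    = finish Robot w (os n) T (0, if even n then 2 else 1) (events [[(0, (0, 0))]])"
    using assms(1,2) d
    by (auto simp: right_plan_def events_append finish_append T_def nth_os line_travel Let_def)
  also have "\<dots> = T + (if even n then 2 else 1)"
    using \<open>0 \<le> T\<close> by (simp add: nth_os line_travel Let_def)
  finally show ?thesis using T by simp
qed

lemma first_pick:
  assumes f: "feasible w (os n) {} {} bs"
  obtains Cs j s es ys where "events bs = Cs @ Pick j s # es" "Cs = [] \<or> Cs = [Close]"
    "j < 4 + n" "fst s = 0" "set (snd s # ys) = {0, 1, 2, 4}"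
    "real (n + 2) \<le> variation (map (clamp 1 2) (snd s # ys))"
    "\<forall>p\<in>{0} \<times> {0..4}. trip Robot w p (events bs) = variation (snd p # snd s # ys)"
proof -
  have "items (os n) \<noteq> {}" by (simp add: items_os)
  from feasible_first_pick[OF f this] obtain Cs j s es c where
    e: "events bs = Cs @ Pick j s # es" "Cs = [] \<or> Cs = [Close]"
    "concat bs = (j, s) # c" "(j, s) \<in> items (os n)" by metis
  define ys where "ys = map (\<lambda>(j, s). snd s) c"
  have h: "map (\<lambda>(j, s). snd s) (concat bs) = snd s # ys" by (simp add: e ys_def)
  have "set (snd s # ys) = (\<lambda>(j, s). snd s) ` items (os n)"
    using f unfolding h[symmetric] feasible_iff by simp
  also have "\<dots> = {0, 1, 2, 4}" by (force simp: items_os pair_def)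
  finally have set: "set (snd s # ys) = {0, 1, 2, 4}" .
  have "(\<Union>b\<in>set bs. orders_of b) = fst ` set (concat bs)" by (simp add: orders_of_def image_UN)
  also have "set (concat bs) = items (os n)" using f by (simp add: feasible_iff)
  also have "fst ` items (os n) = {..<4 + n}" by (force simp: items_os pair_def image_Un)
  finally have all: "(\<Union>b\<in>set bs. orders_of b) = {..<4 + n}" .
  have "(\<Union>b\<in>set bs. orders_of b) \<inter> {2..<4 + n} = {2..<4 + n}" unfolding all by auto
  moreover have "real (card ((\<Union>b\<in>set bs. orders_of b) \<inter> {2..<4 + n}))
      \<le> variation (map (clamp 1 2) (map (\<lambda>(j, s). snd s) (concat bs)))"
  proof (rule crossings_ge_card)
    show "card (orders_of b) \<le> 1" if "b \<in> set bs" for b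
      using f that by (simp add: feasible_iff)
    show "(j, (0, 1)) \<in> set b \<and> (j, (0, 2)) \<in> set b"
      if "b \<in> set bs" "j \<in> orders_of b \<inter> {2..<4 + n}" for b j
      using feasible_whole_orders[OF f that(1), of j] that(2) by (simp add: nth_os pair_def)
  qed
  ultimately have "real (n + 2) \<le> variation (map (clamp 1 2) (snd s # ys))" by (simp add: h)
  moreover have "trip Robot w p (events bs) = variation (snd p # snd s # ys)" if "p \<in> {0} \<times> {0..4}" for p
    using line_trip[OF that feasible_picks_in[OF valid_os f, unfolded line_grid]]
    by (simp add: heights_events h)
  ultimately show ?thesis
    using that[OF e(1,2) _ _ set] e(4) by (auto simp: items_os pair_def)
qed

text \<open>The first pick is too far away to take place before the next arrival, and a shortest way to it in
  the single aisle is unique.\<close>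

lemma followed_until_next_arrival:
  assumes \<gamma>: "route Robot w (os i) (idle (time i) (pos i)) bs \<gamma>"
    and e: "events bs = Cs @ Pick j s # es" "Cs = [] \<or> Cs = [Close]" "j < 4 + i" "s \<in> {0} \<times> {0..4}"
    and far: "1 - 2 * \<epsilon> < \<bar>snd s - snd (pos i)\<bar>"
  shows "\<gamma> (time (Suc i)) = (0, snd (pos i) + sgn (snd s - snd (pos i)) * (1 - 2 * \<epsilon>))"
    and "\<forall>x\<in>set (takeWhile (\<lambda>(t', q, e). t' \<le> time (Suc i))
          (schedule Robot w (os i) (time i) (pos i) (events bs))). snd (snd x) = Close"
proof -
  have p: "pos i \<in> {0} \<times> {0..4}" using eps by (auto simp: pos_def)
  define u where "u = time i + \<bar>snd s - snd (pos i)\<bar>"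
  have "fst (os i ! j) \<le> time i"
    using release_le[of j i] e(3) time(3)[of i]
    by (cases "2 \<le> j") (auto simp: nth_os less_2_cases_iff not_le)
  then have "max (time i + \<bar>snd (pos i) - snd s\<bar>) (fst (os i ! j)) = u" by (simp add: u_def abs_minus_commute)
  then have sch: "schedule Robot w (os i) (time i) (pos i) (events bs)
      = map (\<lambda>c. (time i, pos i, Close)) Cs @ (u, s, Pick j s) # schedule Robot w (os i) u s es"
    using e(2) p e(4) by (auto simp: e(1) Let_def line_travel)
  have late: "\<not> u \<le> time (Suc i)" using far by (simp add: u_def time(4))
  have "\<gamma> (time i) = pos i" "movement w \<gamma>" "\<gamma> u = s"
    using \<gamma> unfolding route_def by (auto simp: sch)
  moreover have "s = (0, snd s)" "pos i = (0, snd (pos i))" using p e(4) by (auto simp: pos_def)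
  ultimately have "\<gamma> (time (Suc i)) = (0, snd (pos i) + sgn (snd s - snd (pos i)) * (time (Suc i) - time i))"
    using eps late by (intro movement_along_aisle[where t = u and z = "snd s"]) (auto simp: u_def time(4))
  then show "\<gamma> (time (Suc i)) = (0, snd (pos i) + sgn (snd s - snd (pos i)) * (1 - 2 * \<epsilon>))"
    by (simp add: time(4))
  show "\<forall>x\<in>set (takeWhile (\<lambda>(t', q, e). t' \<le> time (Suc i))
          (schedule Robot w (os i) (time i) (pos i) (events bs))). snd (snd x) = Close"
    unfolding sch using e(2) late by auto
qed

lemma lured:
  assumes opt: "(bs, \<gamma>) \<in> optimal_plans Robot w (os i) (idle (time i) (pos i))"
  shows "\<gamma> (time (Suc i)) = pos (Suc i) \<and>
    (\<forall>x\<in>set (takeWhile (\<lambda>(t', q, e). t' \<le> time (Suc i))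
        (schedule Robot w (os i) (time i) (pos i) (events bs))). snd (snd x) = Close)"
proof -
  have f: "feasible w (os i) {} {} bs" and route: "route Robot w (os i) (idle (time i) (pos i)) bs \<gamma>"
    and best: "\<And>bs'. feasible w (os i) {} {} bs' \<Longrightarrow>
      finish Robot w (os i) (time i) (pos i) (events bs) \<le> finish Robot w (os i) (time i) (pos i) (events bs')"
    using opt by (auto simp: optimal_plans_def completion_finish)
  have p: "pos i \<in> {0} \<times> {2..4}" "pos i \<in> {0} \<times> {0..4}" using eps by (auto simp: pos_def)
  from first_pick[OF f] obtain Cs j s es ys where
    e: "events bs = Cs @ Pick j s # es" "Cs = [] \<or> Cs = [Close]" "j < 4 + i" "fst s = 0"
    and set: "set (snd s # ys) = {0, 1, 2, 4}"
    and k: "real (i + 2) \<le> variation (map (clamp 1 2) (snd s # ys))"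
    and trip: "\<forall>p\<in>{0} \<times> {0..4}. trip Robot w p (events bs) = variation (snd p # snd s # ys)" .
  have lower: "time i + variation (snd (pos i) # snd s # ys)
      \<le> finish Robot w (os i) (time i) (pos i) (events bs)"
    using finish_ge_trip[of "time i" Robot w "pos i"] trip p(2) by metis
  have "snd s \<in> {0, 1, 2, 4}" by (subst set[symmetric]) simp
  then have s: "snd s \<le> 2 \<or> snd s = 4" and s': "s \<in> {0} \<times> {0..4}"
    using e(4) by (auto simp: mem_Times_iff)
  show ?thesis
  proof (cases "even i")
    case True
    then have h: "snd (pos i) = 3 - \<epsilon>" by (simp add: pos_def)
    have "snd s \<noteq> 4"
    proof
      assume "snd s = 4"
      then have "8 - snd (pos i) + real (i + 2) \<le> variation (snd (pos i) # snd s # ys)"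
        using tour_right_first[of ys "snd (pos i)" "i + 2"] set k True p by auto
      then show False
        using best[OF feasible_left] finish_left[OF p(1) True order_refl] lower h eps by simp
    qed
    then have "snd s \<le> 2" using s by blast
    then show ?thesis
      using followed_until_next_arrival[OF route e(1-3) s'] True eps by (simp add: h pos_def)
  next
    case False
    then have h: "snd (pos i) = 2 + \<epsilon>" by (simp add: pos_def)
    have "\<not> snd s \<le> 2"
    proof
      assume "snd s \<le> 2"
      then have "snd (pos i) + real (i + 2) + 3 \<le> variation (snd (pos i) # snd s # ys)"
        using tour_left_first[of "snd s" ys "snd (pos i)" "i + 2"] set k False p by auto
      moreover have "fst (os i ! (2 + l)) \<le> time i + (4 - snd (pos i)) + real l" if "l < i + 2" for l
        using release_le[of "2 + l" i] that h eps by simp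
      then have "finish Robot w (os i) (time i) (pos i) (events (right_plan i))
          \<le> time i + (4 - snd (pos i)) + real i + 5"
        using finish_right[OF p(1) time(3) order_refl, of i i] False by simp
      ultimately show False using best[OF feasible_right] lower h eps by simp
    qed
    then have "snd s = 4" using s by blast
    then show ?thesis
      using followed_until_next_arrival[OF route e(1-3) s'] False eps by (simp add: h pos_def)
  qed
qed

lemma reopt_ge:
  assumes "tie_breaking tb"
  shows "reopt Robot tb w (os n) \<ge> (2 - 2 * \<epsilon>) * real n"
proof -
  have p: "pos n \<in> {0} \<times> {0..4}" for n using eps by (auto simp: pos_def)
  have "\<exists>bs. feasible w (os n) {} {} bs \<and>
      reopt Robot tb w (os n) = completion Robot w (os n) (time n) (pos n) bs"
    unfolding os_def
  proof (rule reopt_lured[OF assms _ _ time(1,2), where pos = pos])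
    fix i
    show "optimal_plans Robot w (stream line_base time pair i) (idle (time i) (pos i)) \<noteq> {}"
      by (rule optimal_plans_nonempty[OF geodesic valid_os[unfolded os_def] feasible_left[unfolded os_def]])
        (simp_all only: idle_simps line_grid p)
  next
    fix i bs \<gamma> assume "(bs, \<gamma>) \<in> optimal_plans Robot w (stream line_base time pair i) (idle (time i) (pos i))"
    from lured[unfolded os_def, OF this]
    show "\<gamma> (time (Suc i)) = pos (Suc i) \<and>
      (\<forall>x\<in>set (takeWhile (\<lambda>(t', q, e). t' \<le> time (Suc i))
        (schedule Robot w (stream line_base time pair i) (time i) (pos i) (events bs))). snd (snd x) = Close)" .
  qed (auto simp: line_base_def pos_def)
  then obtain bs where f: "feasible w (os n) {} {} bs"
    and eq: "reopt Robot tb w (os n) = finish Robot w (os n) (time n) (pos n) (events bs)"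
    by (auto simp: completion_finish)
  from first_pick[OF f] obtain Cs j s es ys where
    "events bs = Cs @ Pick j s # es" "Cs = [] \<or> Cs = [Close]" "j < 4 + n" "fst s = 0" and
    set: "set (snd s # ys) = {0, 1, 2, 4}" and
    k: "real (n + 2) \<le> variation (map (clamp 1 2) (snd s # ys))" and
    trip: "\<forall>p\<in>{0} \<times> {0..4}. trip Robot w p (events bs) = variation (snd p # snd s # ys)" .
  have sub: "set (snd s # ys) \<subseteq> {0..4}" unfolding set by auto
  have "real (n + 2) \<le> variation (snd s # ys)"
    unfolding variation_clamp[OF sub]
    using k variation_nonneg[of "map (clamp 0 1) (snd s # ys)"]
      variation_nonneg[of "map (clamp 2 4) (snd s # ys)"] by linarith
  also have "\<dots> \<le> trip Robot w (pos n) (events bs)" using bspec[OF trip p] by simp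
  finally have "time n + real n \<le> reopt Robot tb w (os n)"
    using finish_ge_trip[of "time n" Robot w "pos n" "events bs" "os n"] by (simp add: eq)
  then show ?thesis by (simp add: time_def algebra_simps)
qed

lemma ciopt_le: "ciopt Robot w (os n) \<le> real n + 8"
proof -
  have "fst (os n ! (2 + i)) \<le> 2 + real i" if "i < n + 2" for i
  proof -
    have "fst (os n ! (2 + i)) = real (2 + i - 3) * (1 - 2 * \<epsilon>)"
      using that nth_os(1)[of "2 + i" n] by (simp add: time_def)
    also have "\<dots> \<le> real (2 + i - 3) * 1" using eps by (intro mult_left_mono) auto
    finally show ?thesis by linarith
  qed
  then have "finish Robot w (os n) 0 (depot w) (events (right_plan n)) \<le> 2 + real n + (if even n then 6 else 5)"
    using eps by (intro finish_right) auto
  then show ?thesis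
    using ciopt_bounds(2)[OF geodesic valid_os feasible_right, of Robot n]
    by (simp add: completion_finish split: if_splits)
qed

end

text \<open>The slopes are \<open>2 - 2 \<epsilon>\<close> and 1 per pair.\<close>

lemma robot_ratio:
  assumes "tie_breaking tb"
  shows "asymp_ratio (reopt Robot tb) Robot {w. valid_warehouse w} \<ge> 2"
proof -
  have "2 \<le> \<alpha>" if comp: "asymp_competitive (reopt Robot tb) Robot {w. valid_warehouse w} \<alpha>" for \<alpha>
  proof (rule field_le_epsilon)
    fix e :: real assume "e > 0"
    define \<epsilon> where "\<epsilon> = min (e / 2) (1 / 8)"
    interpret line_instance \<epsilon> by unfold_locales (use \<open>e > 0\<close> in \<open>auto simp: \<epsilon>_def\<close>)
    have "2 - 2 * \<epsilon> \<le> \<alpha> * 1"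
    proof (rule growth_le_competitive[OF comp, of w os _ 8])
      show "w \<in> {w. valid_warehouse w}" by (simp add: valid_w)
      show "(2 - 2 * \<epsilon>) * real n - 8 \<le> reopt Robot tb w (os n)" for n
        using reopt_ge[OF assms, of n] by simp
      show "0 \<le> ciopt Robot w (os n)" for n
        by (rule ciopt_bounds(1)[OF geodesic valid_os feasible_right])
    qed (use valid_os ciopt_le eps in auto)
    moreover have "2 * \<epsilon> \<le> e" by (simp add: \<epsilon>_def)
    ultimately show "2 \<le> \<alpha> + e" by simp
  qed
  from asymp_ratio_geI[OF this] show ?thesis by simp
qed

section \<open>A warehouse with three aisles\<close>

text \<open>Three paths connect the two ends of the middle aisle: the middle aisle and the detours by the
  left and by the right aisle.\<close>

definition theta_warehouse :: "nat \<Rightarrow> warehouse" where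
  "theta_warehouse N = \<lparr>len = 2, width = real N, aisles = 3, cross_aisles = 2,
     depot = (1, 0), capacity = 2\<rparr>"

text \<open>Different aisles are connected by the cross-aisle at height 0 and by the one at height \<open>N\<close>.\<close>

definition theta_dist :: "nat \<Rightarrow> loc \<Rightarrow> loc \<Rightarrow> real" where
  "theta_dist N p q =
     (if fst p = fst q then \<bar>snd p - snd q\<bar>
      else \<bar>fst p - fst q\<bar> + min (snd p + snd q) (2 * real N - snd p - snd q))"

lemma theta_grid:
  "aisle_points (theta_warehouse N) = {0, 1, 2} \<times> {0..real N}"
  "grid (theta_warehouse N) = {0, 1, 2} \<times> {0..real N} \<union> {0..2} \<times> {0, real N}"
proof -
  have "{i :: nat. i < 3} = {0, 1, 2}" by auto
  then have "aisle_xs (theta_warehouse N) = {0, 1, 2}"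
    unfolding aisle_xs_def setcompr_eq_image by (simp add: theta_warehouse_def)
  then show a: "aisle_points (theta_warehouse N) = {0, 1, 2} \<times> {0..real N}"
    by (simp add: aisle_points_def theta_warehouse_def)
  have "{j :: nat. j < 2} = {0, 1}" by auto
  then have "cross_ys (theta_warehouse N) = {0, real N}"
    unfolding cross_ys_def setcompr_eq_image by (simp add: theta_warehouse_def)
  then show "grid (theta_warehouse N) = {0, 1, 2} \<times> {0..real N} \<union> {0..2} \<times> {0, real N}"
    unfolding grid_def a by (simp add: theta_warehouse_def)
qed

text \<open>Points at distance less than 1 are on a common segment or on two segments that share an end. In
  the second case one of them is on a cross-aisle, and there the distance from \<open>p\<close> has one formula for
  all aisles.\<close>

lemma theta_dist_local:
  assumes p: "p \<in> {0, 1, 2} \<times> {0..real N}" and "N \<ge> 1"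
    and g: "q \<in> grid (theta_warehouse N)" "q' \<in> grid (theta_warehouse N)" and near: "manhattan q q' < 1"
  shows "\<bar>theta_dist N p q - theta_dist N p q'\<bar> \<le> manhattan q q'"
proof -
  obtain a y where ay: "p = (a, y)" "0 \<le> y" "y \<le> real N" using p by auto
  obtain u v where uv: "q = (u, v)" "0 \<le> v" "v \<le> real N"
    using g(1) by (cases q) (auto simp: theta_grid)
  obtain u' v' where uv': "q' = (u', v')" "0 \<le> v'" "v' \<le> real N"
    using g(2) by (cases q') (auto simp: theta_grid)
  have near': "\<bar>u - u'\<bar> + \<bar>v - v'\<bar> < 1" using near by (simp add: uv uv' manhattan_def)
  define h where "h = (\<lambda>v. min (y + v) (2 * real N - y - v))"
  have h: "\<bar>h v - h v'\<bar> \<le> \<bar>v - v'\<bar>" unfolding h_def by linarith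
  \<comment> \<open>at the ends of the aisles both cases of \<open>theta_dist\<close> agree\<close>
  have cross: "theta_dist N p (c, d) = \<bar>a - c\<bar> + h d" if "d = 0 \<or> d = real N" for c d
    using that ay by (cases "a = c"; elim disjE; simp add: theta_dist_def h_def)
  have one_cross: "\<bar>theta_dist N p (c, d) - theta_dist N p (c', d')\<bar> \<le> \<bar>c - c'\<bar> + \<bar>d - d'\<bar>"
    if "d' = 0 \<or> d' = real N" "0 \<le> d" "d \<le> real N" for c d c' d'
  proof (cases "c = a")
    case True
    then have "theta_dist N p (c, d) = \<bar>y - d\<bar>" by (simp add: theta_dist_def ay)
    moreover from that(1) have "h d' = \<bar>y - d'\<bar>"
      using ay by (elim disjE) (simp_all add: h_def)
    ultimately show ?thesis using cross[OF that(1), of c'] True by linarith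
  next
    case False
    then have "theta_dist N p (c, d) = \<bar>a - c\<bar> + h d" by (auto simp: theta_dist_def ay h_def)
    moreover have "\<bar>h d - h d'\<bar> \<le> \<bar>d - d'\<bar>" unfolding h_def by linarith
    ultimately show ?thesis using cross[OF that(1), of c'] by linarith
  qed
  consider "u = u'" | "v = 0 \<or> v = real N" | "v' = 0 \<or> v' = real N"
  proof -
    have "u = u'" if "\<not> (v = 0 \<or> v = real N)" "\<not> (v' = 0 \<or> v' = real N)"
    proof (rule ccontr)
      have "u \<in> {0, 1, 2}" "u' \<in> {0, 1, 2}" using g that by (simp_all add: theta_grid uv uv')
      moreover assume "u \<noteq> u'"
      ultimately have "1 \<le> \<bar>u - u'\<bar>" by (elim insertE emptyE) simp_all
      then show False using near' by linarith
    qed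
    then show ?thesis using that by blast
  qed
  then show ?thesis
  proof cases
    case 1
    then have m: "manhattan q q' = \<bar>v - v'\<bar>" by (simp add: uv uv' manhattan_def)
    show ?thesis
    proof (cases "a = u")
      case True
      then have "theta_dist N p q = \<bar>y - v\<bar>" "theta_dist N p q' = \<bar>y - v'\<bar>"
        using 1 by (simp_all add: uv uv' ay theta_dist_def)
      then show ?thesis unfolding m by linarith
    next
      case False
      then have "theta_dist N p q = \<bar>a - u\<bar> + h v" "theta_dist N p q' = \<bar>a - u\<bar> + h v'"
        using 1 by (simp_all add: uv uv' ay theta_dist_def h_def)
      then show ?thesis using h unfolding m by linarith
    qed
  next
    case 2
    from one_cross[OF this uv'(2,3), of u' u] show ?thesis
      by (simp add: uv uv' manhattan_def abs_minus_commute)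
  next
    case 3
    from one_cross[OF this uv(2,3), of u u'] show ?thesis
      by (simp add: uv uv' manhattan_def)
  qed
qed

lemma movement_theta_dist:
  assumes "movement (theta_warehouse N) \<gamma>" "p \<in> {0, 1, 2} \<times> {0..real N}" "N \<ge> 1"
  shows "\<bar>theta_dist N p (\<gamma> s) - theta_dist N p (\<gamma> t)\<bar> \<le> \<bar>s - t\<bar>"
  by (rule movement_Lipschitz[OF assms(1), of 1]) (use theta_dist_local assms in auto)

lemma theta_reaches:
  assumes "p \<in> {0, 1, 2} \<times> {0..real N}" "q \<in> {0, 1, 2} \<times> {0..real N}"
  shows "reaches (theta_warehouse N) (theta_dist N p q) p q"
proof -
  let ?w = "theta_warehouse N"
  obtain a y where ay: "p = (a, y)" "0 \<le> y" "y \<le> real N" "a \<in> {0, 1, 2}" using assms(1) by auto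
  obtain u v where uv: "q = (u, v)" "0 \<le> v" "v \<le> real N" "u \<in> {0, 1, 2}" using assms(2) by auto
  have aisle: "reaches ?w \<bar>d - d'\<bar> (c, d) (c, d')"
    if "c \<in> {0, 1, 2}" "d \<in> {0..real N}" "d' \<in> {0..real N}" for c d d'
  proof -
    have "reaches ?w (manhattan (c, d) (c, d')) (c, d) (c, d')"
    proof (rule reaches_straight)
      fix u v assume "min (fst (c, d)) (fst (c, d')) \<le> u" "u \<le> max (fst (c, d)) (fst (c, d'))"
        "min (snd (c, d)) (snd (c, d')) \<le> v" "v \<le> max (snd (c, d)) (snd (c, d'))"
      then have "u = c" "v \<in> {0..real N}" using that(2,3) by auto
      then show "(u, v) \<in> grid ?w" using that(1) by (simp add: theta_grid)
    qed simp
    then show ?thesis by (simp add: manhattan_def)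
  qed
  have in_cross: "0 \<le> min a u" "max a u \<le> 2" using ay(4) uv(4) by (elim insertE emptyE; simp)+
  have crossing: "reaches ?w \<bar>a - u\<bar> (a, d) (u, d)" if "d \<in> {0, real N}" for d
  proof -
    have "reaches ?w (manhattan (a, d) (u, d)) (a, d) (u, d)"
    proof (rule reaches_straight)
      fix c v assume "min (fst (a, d)) (fst (u, d)) \<le> c" "c \<le> max (fst (a, d)) (fst (u, d))"
        "min (snd (a, d)) (snd (u, d)) \<le> v" "v \<le> max (snd (a, d)) (snd (u, d))"
      then have "v = d" "c \<in> {0..2}" using in_cross by auto
      then show "(c, v) \<in> grid ?w" using that by (simp add: theta_grid)
    qed simp
    then show ?thesis by (simp add: manhattan_def)
  qed
  have via: "reaches ?w (\<bar>y - d\<bar> + \<bar>a - u\<bar> + \<bar>d - v\<bar>) p q" if d: "d \<in> {0, real N}" for d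
  proof -
    have "d \<in> {0..real N}" "y \<in> {0..real N}" "v \<in> {0..real N}" using d ay uv by auto
    then show ?thesis
      unfolding ay(1) uv(1)
      by (intro reaches_trans[OF reaches_trans[OF aisle crossing[OF d]] aisle] ay(4) uv(4))
  qed
  show ?thesis
  proof (cases "a = u")
    case True
    then show ?thesis using aisle[OF ay(4), of y v] ay(1-3) uv(1-3) by (simp add: theta_dist_def)
  next
    case False
    have "theta_dist N p q = (if y + v \<le> 2 * real N - y - v then \<bar>y - 0\<bar> + \<bar>a - u\<bar> + \<bar>0 - v\<bar>
        else \<bar>y - real N\<bar> + \<bar>a - u\<bar> + \<bar>real N - v\<bar>)"
      using False ay(1-3) uv(1-3) by (simp add: theta_dist_def min_def)
    then show ?thesis using via[of 0] via[of "real N"] by (simp split: if_splits)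
  qed
qed

lemma theta_travel:
  assumes "p \<in> {0, 1, 2} \<times> {0..real N}" "q \<in> {0, 1, 2} \<times> {0..real N}" "N \<ge> 1"
  shows "travel (theta_warehouse N) p q = theta_dist N p q"
proof (rule travel_eqI[OF theta_reaches[OF assms(1,2)]])
  fix T assume "reaches (theta_warehouse N) T p q"
  then obtain \<gamma> where g: "movement (theta_warehouse N) \<gamma>" "\<gamma> 0 = p" "\<gamma> T = q" "T \<ge> 0"
    by (auto simp: reaches_def)
  have "theta_dist N p p = 0" by (simp add: theta_dist_def)
  then show "theta_dist N p q \<le> T"
    using movement_theta_dist[OF g(1) assms(1,3), of 0 T] g by simp
qed

lemma theta_geodesic:
  assumes "N \<ge> 1"
  shows "geodesic (theta_warehouse N) (aisle_points (theta_warehouse N))"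
  unfolding geodesic_def theta_grid
proof (intro conjI ballI)
  show "depot (theta_warehouse N) \<in> {0, 1, 2} \<times> {0..real N}" by (simp add: theta_warehouse_def)
  fix p q :: loc assume pq: "p \<in> {0, 1, 2} \<times> {0..real N}" "q \<in> {0, 1, 2} \<times> {0..real N}"
  show "reaches (theta_warehouse N) (travel (theta_warehouse N) p q) p q"
    unfolding theta_travel[OF pq assms] by (rule theta_reaches[OF pq])
qed

section \<open>Winding around the outer aisles\<close>

text \<open>If the lengths of cross-aisles are neglected, the two outer aisles form a circle of
  circumference \<open>2 N\<close>. The middle aisle can be folded onto the left one without increasing
  distances. The angle is measured from the depot, and is negative in the right aisle.\<close>

definition angle :: "loc \<Rightarrow> real" where
  "angle p = (if fst p = 2 then - snd p else snd p)"

lemma angle_step: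
  assumes "p \<in> {0, 1, 2} \<times> {0..real N}" "q \<in> {0, 1, 2} \<times> {0..real N}"
  shows "\<exists>z::int. \<bar>angle p - angle q + 2 * real N * of_int z\<bar> \<le> theta_dist N p q"
proof -
  define y v where "y = snd p" and "v = snd q"
  have yv: "0 \<le> y" "y \<le> real N" "0 \<le> v" "v \<le> real N" using assms by (auto simp: y_def v_def)
  have near: "\<bar>y - v\<bar> \<le> theta_dist N p q"
    unfolding theta_dist_def y_def[symmetric] v_def[symmetric] using yv by (simp add: min_def) linarith
  have far: "min (y + v) (2 * real N - y - v) \<le> theta_dist N p q" if "fst p \<noteq> fst q"
    unfolding theta_dist_def y_def[symmetric] v_def[symmetric] using that by simp
  consider "fst p = 2 \<longleftrightarrow> fst q = 2" | "fst p \<noteq> 2" "fst q = 2" | "fst p = 2" "fst q \<noteq> 2" by blast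
  then show ?thesis
  proof cases
    case 1
    then have "\<bar>angle p - angle q\<bar> = \<bar>y - v\<bar>" by (auto simp: angle_def y_def v_def)
    then show ?thesis using near by (intro exI[of _ 0]) simp
  next
    case 2
    then have a: "angle p - angle q = y + v" by (simp add: angle_def y_def v_def)
    show ?thesis
    proof (cases "y + v \<le> 2 * real N - y - v")
      case True
      then show ?thesis using far 2 yv by (intro exI[of _ 0]) (simp add: a)
    next
      case False
      then show ?thesis using far 2 yv by (intro exI[of _ "-1"]) (simp add: a)
    qed
  next
    case 3
    then have a: "angle p - angle q = - (y + v)" by (simp add: angle_def y_def v_def)
    show ?thesis
    proof (cases "y + v \<le> 2 * real N - y - v")
      case True
      then show ?thesis using far 3 yv by (intro exI[of _ 0]) (simp add: a)
    next
      case False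
      then show ?thesis using far 3 yv by (intro exI[of _ 1]) (simp add: a)
    qed
  qed
qed

text \<open>The tour on the circle is unrolled to a walk on the line, step by step, with the choice of the
  representative that is given by the shorter arc.\<close>

lemma lift_tour:
  assumes "set (q # qs) \<subseteq> {0, 1, 2} \<times> {0..real N}" "\<exists>z::int. x = angle q + 2 * real N * of_int z"
  shows "\<exists>xs. list_all2 (\<lambda>q x. \<exists>z::int. x = angle q + 2 * real N * of_int z) (q # qs) (x # xs) \<and>
    variation (x # xs) \<le> tour (theta_dist N) (q # qs)"
  using assms
proof (induction qs arbitrary: q x)
  case Nil
  then show ?case by (intro exI[of _ "[]"]) auto
next
  case (Cons q' qs)
  obtain z :: int where z: "x = angle q + 2 * real N * of_int z" using Cons.prems(2) by blast
  obtain z' :: int where z': "\<bar>angle q - angle q' + 2 * real N * of_int z'\<bar> \<le> theta_dist N q q'"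
    using angle_step[of q N q'] Cons.prems(1) by auto
  define x' where "x' = angle q' + 2 * real N * of_int (z - z')"
  have d: "\<bar>x - x'\<bar> \<le> theta_dist N q q'" using z' by (simp add: x'_def z algebra_simps)
  have "set (q' # qs) \<subseteq> {0, 1, 2} \<times> {0..real N}" using Cons.prems(1) by simp
  moreover have "\<exists>z::int. x' = angle q' + 2 * real N * of_int z" unfolding x'_def by blast
  ultimately obtain xs where
      xs: "list_all2 (\<lambda>q x. \<exists>z::int. x = angle q + 2 * real N * of_int z) (q' # qs) (x' # xs)"
      "variation (x' # xs) \<le> tour (theta_dist N) (q' # qs)"
    using Cons.IH[of q' x'] by blast
  show ?case
  proof (intro exI[of _ "x' # xs"] conjI)
    show "list_all2 (\<lambda>q x. \<exists>z::int. x = angle q + 2 * real N * of_int z) (q # q' # qs) (x # x' # xs)"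
      using xs(1) Cons.prems(2) by (subst list_all2_Cons) blast
    show "variation (x # x' # xs) \<le> tour (theta_dist N) (q # q' # qs)" using xs(2) d by simp
  qed
qed

text \<open>An interval that meets all \<open>2 N\<close> residue classes modulo \<open>2 N\<close> contains \<open>2 N\<close> different integers.\<close>

lemma range_of_all_residues:
  fixes X :: "real set"
  assumes "N > 0" and X: "\<And>x. x \<in> X \<Longrightarrow> lo \<le> x \<and> x \<le> hi"
    and all: "\<And>j::int. - int N < j \<Longrightarrow> j \<le> int N \<Longrightarrow> \<exists>z::int. of_int j + 2 * real N * of_int z \<in> X"
  shows "2 * real N - 1 \<le> hi - lo"
proof -
  define J where "J = {- int N<..int N}"
  obtain z where z: "\<And>j. j \<in> J \<Longrightarrow> of_int j + 2 * real N * of_int (z j) \<in> X"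
    using all unfolding J_def by (metis greaterThanAtMost_iff)
  define f where "f = (\<lambda>j. j + 2 * int N * z j)"
  have "inj_on f J"
  proof (rule inj_onI)
    fix i j assume ij: "i \<in> J" "j \<in> J" "f i = f j"
    then have "i - j = 2 * int N * (z j - z i)" by (simp add: f_def algebra_simps)
    moreover have "\<bar>i - j\<bar> < 2 * int N" using ij by (auto simp: J_def)
    ultimately have "i - j = 0"
      using dvd_imp_le_int[of "i - j" "2 * int N"] by (metis abs_of_nat dvd_triv_left linorder_not_le
          abs_mult abs_numeral)
    then show "i = j" by simp
  qed
  moreover have "f ` J \<subseteq> {\<lceil>lo\<rceil>..\<lfloor>hi\<rfloor>}"
  proof clarify
    fix j assume "j \<in> J"
    then have "real_of_int (f j) \<in> X" using z by (simp add: f_def)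
    then show "f j \<in> {\<lceil>lo\<rceil>..\<lfloor>hi\<rfloor>}" using X by (auto simp: ceiling_le_iff le_floor_iff)
  qed
  ultimately have "card J \<le> card {\<lceil>lo\<rceil>..\<lfloor>hi\<rfloor>}"
    by (metis card_image card_mono finite_atLeastAtMost_int)
  then have "2 * int N \<le> \<lfloor>hi\<rfloor> - \<lceil>lo\<rceil> + 1" using \<open>N > 0\<close> by (simp add: J_def)
  then have "2 * real N \<le> real_of_int \<lfloor>hi\<rfloor> - real_of_int \<lceil>lo\<rceil> + 1" by linarith
  also have "\<dots> \<le> hi - lo + 1" by linarith
  finally show ?thesis by simp
qed

text \<open>The unrolled walk has to reach both ends of a range of length at least \<open>2 N - 1\<close> and to end at a
  multiple of \<open>2 N\<close>. The worst case is an end at \<open>2 N\<close> for \<open>x \<ge> 0\<close>: the walk goes down first and then covers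
  the range upwards. The term 2 is the saving of one gap between neighbouring items: if she turns round at 1, the gap
  from 0 to 1 is not walked twice.\<close>

lemma winding_length:
  fixes x :: real
  assumes "N > 0" and x: "\<bar>x\<bar> \<le> real N"
    and all: "\<And>j::int. - int N < j \<Longrightarrow> j \<le> int N \<Longrightarrow>
      \<exists>z::int. of_int j + 2 * real N * of_int z \<in> set (x # xs)"
    and last: "last (x # xs) = 2 * real N * of_int (z::int)"
  shows "2 * real N + \<bar>x\<bar> - 2 \<le> variation (x # xs)"
proof -
  define lo hi e where "lo = Min (set (x # xs))" and "hi = Max (set (x # xs))" and "e = last (x # xs)"
  have range: "lo \<le> y" "y \<le> hi" if "y \<in> set (x # xs)" for y
    using that by (simp_all add: lo_def hi_def del: list.set)
  have "e \<in> set (x # xs)" unfolding e_def by (rule last_in_set) simp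
  note 1 = range[OF this] range[of x, simplified]
  have 2: "2 * real N - 1 \<le> hi - lo"
    by (rule range_of_all_residues[where X = "set (x # xs)"]) (use \<open>N > 0\<close> range all in auto)
  have "lo \<in> set (x # xs)" "hi \<in> set (x # xs)"
    unfolding lo_def hi_def by (rule Min_in Max_in; simp)+
  note two = variation_visit_two[OF this]
  have "\<bar>x - lo\<bar> = x - lo" "\<bar>x - hi\<bar> = hi - x" "\<bar>lo - hi\<bar> = hi - lo" "\<bar>hi - lo\<bar> = hi - lo"
      "\<bar>hi - e\<bar> = hi - e" "\<bar>lo - e\<bar> = e - lo" using 1 by auto
  note two = two[folded e_def, unfolded this]
  have 3: "2 * (hi - lo) - \<bar>x - e\<bar> \<le> variation (x # xs)"
  proof (rule disjE[OF two])
    assume "x - lo + (hi - lo) + (hi - e) \<le> variation (x # xs)"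
    then show ?thesis by (auto simp: abs_if)
  next
    assume "hi - x + (hi - lo) + (e - lo) \<le> variation (x # xs)"
    then show ?thesis by (auto simp: abs_if)
  qed
  have e: "e = 2 * real N * of_int z" using last by (simp add: e_def)
  consider "z = 0" | "z = 1 \<and> x \<ge> 0 \<or> z = -1 \<and> x \<le> 0" | "2 * real N + \<bar>x\<bar> \<le> \<bar>x - e\<bar>"
  proof -
    have A: "2 * real N + \<bar>x\<bar> \<le> \<bar>x - e\<bar>" if "z \<ge> 2"
    proof -
      have "2 * real N * 2 \<le> e" unfolding e using that by (intro mult_left_mono) auto
      then show ?thesis using x by linarith
    qed
    have B: "2 * real N + \<bar>x\<bar> \<le> \<bar>x - e\<bar>" if "z \<le> -2"
    proof -
      have "e \<le> 2 * real N * (-2)" unfolding e using that by (intro mult_left_mono) auto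
      then show ?thesis using x by linarith
    qed
    have C: "2 * real N + \<bar>x\<bar> \<le> \<bar>x - e\<bar>" if "z = 1 \<and> x < 0 \<or> z = -1 \<and> x > 0"
      using that by (auto simp: e)
    \<comment> \<open>either the walk ends so far away that its length is clear, or next to the start\<close>
    consider "z \<ge> 2" | "z \<le> -2" | "z = 1 \<and> x < 0 \<or> z = -1 \<and> x > 0" | "z = 0"
      | "z = 1 \<and> x \<ge> 0 \<or> z = -1 \<and> x \<le> 0" by linarith
    then show ?thesis
    proof cases
      case 1 then show ?thesis by (rule that(3)[OF A])
    next
      case 2 then show ?thesis by (rule that(3)[OF B])
    next
      case 3 then show ?thesis by (rule that(3)[OF C])
    next
      case 4 then show ?thesis by (rule that(1))
    next
      case 5 then show ?thesis by (rule that(2))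
    qed
  qed
  then show ?thesis
  proof cases
    case 1
    then show ?thesis using 2 3 x by (simp add: e)
  next
    case 2
    then show ?thesis using \<open>2 * real N - 1 \<le> hi - lo\<close> 3 x by (auto simp: e)
  next
    case 3
    have "\<bar>x - e\<bar> \<le> hi - lo" using 1 by (auto simp: abs_if)
    with 3 \<open>2 * (hi - lo) - \<bar>x - e\<bar> \<le> variation (x # xs)\<close> show ?thesis by argo
  qed
qed

definition sweep :: "nat \<Rightarrow> loc set" where
  "sweep N = {0, 2} \<times> real ` {0..N}"

text \<open>For \<open>q\<close> near the hub this is almost \<open>3 N\<close>: it does not help to begin a sweep at the far end.\<close>

lemma sweep_tour:
  assumes "N > 0" and qs: "set (q # qs) \<subseteq> {0, 1, 2} \<times> {0..real N}" "sweep N \<subseteq> set (q # qs)"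
    and last: "last (q # qs) = (1, 0)"
  shows "2 * real N + snd q - 2 \<le> tour (theta_dist N) (q # qs)"
proof -
  define P where "P = (\<lambda>q x. \<exists>z::int. x = angle q + 2 * real N * of_int z)"
  obtain xs where xs: "list_all2 P (q # qs) (angle q # xs)"
      "variation (angle q # xs) \<le> tour (theta_dist N) (q # qs)"
    using lift_tour[OF qs(1), of "angle q"] unfolding P_def by (metis (no_types) add.right_neutral mult_zero_right of_int_0)
  have "P (last (q # qs)) (last (angle q # xs))"
  proof -
    have "length qs = length xs" using list_all2_lengthD[OF xs(1)] by simp
    then have "last (q # qs) = (q # qs) ! length xs"
        "last (angle q # xs) = (angle q # xs) ! length xs"
      by (simp_all only: last_conv_nth[OF list.distinct(2)] list.size) simp_all
    then show ?thesis using list_all2_nthD2[OF xs(1), of "length xs"] by simp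
  qed
  then obtain z :: int where z: "last (angle q # xs) = 2 * real N * of_int z"
    unfolding last by (auto simp: P_def angle_def simp del: last.simps)
  have all: "\<exists>z::int. of_int j + 2 * real N * of_int z \<in> set (angle q # xs)"
    if "- int N < j" "j \<le> int N" for j :: int
  proof -
    define r where "r = (if j \<ge> 0 then (0, real (nat j)) else (2, real (nat (- j))) :: loc)"
    have "real (nat j) \<in> real ` {0..N}" "real (nat (- j)) \<in> real ` {0..N}"
      using that by (intro imageI; simp)+
    then have "r \<in> sweep N" unfolding r_def sweep_def by (cases "0 \<le> j") (simp_all only: if_True if_False, blast+)
    then have "r \<in> set (q # qs)" using qs(2) by blast
    then obtain i where i: "i < length (q # qs)" "(q # qs) ! i = r" by (metis in_set_conv_nth)
    then have "P r ((angle q # xs) ! i)" using list_all2_nthD[OF xs(1) i(1)] by simp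
    moreover have "(angle q # xs) ! i \<in> set (angle q # xs)"
      using i(1) list_all2_lengthD[OF xs(1)] by (intro nth_mem) simp
    ultimately obtain x where "x \<in> set (angle q # xs)" "P r x" by blast
    moreover have "angle r = of_int j" by (simp add: r_def angle_def)
    ultimately show ?thesis by (auto simp: P_def)
  qed
  have q: "\<bar>angle q\<bar> = snd q" "snd q \<le> real N" using qs(1) by (auto simp: angle_def)
  then have "\<bar>angle q\<bar> \<le> real N" by simp
  from winding_length[OF \<open>N > 0\<close> this all z] xs(2) q(1) show ?thesis by linarith
qed

section \<open>Pushcarts in the three-aisle warehouse\<close>

lemma trip_next_batch:
  "trip Pushcart w p (events (b # bs)) = trip Pushcart w p (events [b]) + trip Pushcart w (depot w) (events bs)"
proof -
  have "events (b # bs) = events [b] @ events bs" by simp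
  then show ?thesis by (simp only: trip_append) simp
qed

text \<open>All items at one location are picked before the cart moves on.\<close>

definition visit :: "nat list \<Rightarrow> loc list \<Rightarrow> batch" where
  "visit J ss = concat (map (\<lambda>s. map (\<lambda>j. (j, s)) J) ss)"

lemma visit_simps [simp]:
  "visit J [] = []" "visit J (s # ss) = map (\<lambda>j. (j, s)) J @ visit J ss"
  by (simp_all add: visit_def)

lemma set_visit [simp]: "set (visit J ss) = set J \<times> set ss"
  by (induction ss) auto

lemma distinct_visit: "distinct J \<Longrightarrow> distinct ss \<Longrightarrow> distinct (visit J ss)"
  by (induction ss) (auto simp: distinct_map inj_on_def)

definition left_column :: "nat \<Rightarrow> loc list" where
  "left_column N = map (\<lambda>y. (0, real y)) [0..<Suc N]"

definition right_column :: "nat \<Rightarrow> loc list" where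
  "right_column N = map (\<lambda>y. (2, real y)) (rev [0..<Suc N])"

lemma set_columns: "set (left_column N) \<union> set (right_column N) = sweep N"
  "set (left_column N) = {0} \<times> real ` {0..N}" "set (right_column N) = {2} \<times> real ` {0..N}"
  by (auto simp: left_column_def right_column_def sweep_def image_iff simp del: upt_Suc)

lemma tour_left_column: "tour (theta_dist N) (map (\<lambda>y. (0, real y)) [0..<Suc k]) = real k"
proof (induction k)
  case (Suc k)
  have "map (\<lambda>y. (0 :: real, real y)) [0..<Suc (Suc k)]
      = map (\<lambda>y. (0, real y)) [0..<k] @ (0, real k) # [(0, real (Suc k))]" by simp
  then show ?case using Suc by (simp add: tour_append[of _ _ _ "[_]"] theta_dist_def)
qed simp

lemma tour_right_column: "tour (theta_dist N) (map (\<lambda>y. (2, real y)) (rev [0..<Suc k])) = real k"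
  by (induction k) (auto simp: theta_dist_def)

definition loop :: "nat \<Rightarrow> nat list \<Rightarrow> batch \<Rightarrow> batch" where
  "loop N J B = visit J (left_column N) @ B @ visit J (right_column N)"

lemma orders_of_loop: "orders_of (loop N J B) = set J \<union> orders_of B"
  by (auto simp: orders_of_def loop_def image_Un set_columns)

definition pairs :: "nat \<Rightarrow> nat \<Rightarrow> batch list" where
  "pairs N m = map (\<lambda>i. loop N [2 * i + 1, 2 * i + 2] []) [0..<m]"

lemma orders_of_pair: "i < m \<Longrightarrow> orders_of (pairs N m ! i) = {2 * i + 1, 2 * i + 2}"
  by (simp add: pairs_def orders_of_loop) (simp add: orders_of_def)

lemma orders_of_pairs: "(\<Union>b\<in>set (pairs N m). orders_of b) = {1..2 * m}"
proof -
  have "(\<Union>b\<in>set (pairs N m). orders_of b) = (\<Union>i<m. {2 * i + 1, 2 * i + 2})"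
    by (simp add: pairs_def orders_of_loop atLeast0LessThan) (simp add: orders_of_def)
  also have "\<dots> = {1..2 * m}" by (induction m) (auto simp: lessThan_Suc)
  finally show ?thesis .
qed

lemma disjoint_pairs: "sorted_wrt (\<lambda>b b'. orders_of b \<inter> orders_of b' = {}) (pairs N m)"
proof -
  have "length (pairs N m) = m" by (simp add: pairs_def)
  then show ?thesis
    unfolding sorted_wrt_iff_nth_less by (auto simp: orders_of_pair; presburger)
qed

text \<open>The picker turns round at distance 4 from the ends of the middle aisle. Twice this distance exceeds
  4 + 2, where 4 is the length of the cross-aisle parts of a loop and 2 the saving in \<open>sweep_tour\<close>.\<close>

locale theta_instance =
  fixes N :: nat
  assumes N: "20 \<le> N"
begin

abbreviation "w \<equiv> theta_warehouse N"
abbreviation "A \<equiv> {0, 1, 2} \<times> {0..real N}"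
abbreviation "hub \<equiv> (1, real N) :: loc"
abbreviation "C \<equiv> 2 * real N + 4"

text \<open>The first walk up starts at the depot. Each later walk has length \<open>N - 8\<close>, from height 4 to height
  \<open>N - 4\<close> or back, and ends with an arrival.\<close>

definition time :: "nat \<Rightarrow> real" where
  "time i = (if i = 0 then 0 else 4 + real i * (real N - 8))"

definition os :: "nat \<Rightarrow> order list" where
  "os = stream [(0, {hub})] time (sweep N)"

definition pos :: "nat \<Rightarrow> loc" where
  "pos i = (1, if i = 0 then 0 else if even i then 4 else real N - 4)"

lemma simps [simp]: "capacity w = 2" "depot w = (1, 0)"
  by (simp_all add: theta_warehouse_def)

lemma w_class: "valid_warehouse w" "2 \<le> aisles w"
  using N by (simp_all add: valid_warehouse_def theta_grid) (simp_all add: theta_warehouse_def)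

lemma geodesic: "geodesic w (aisle_points w)"
  using N by (intro theta_geodesic) simp

lemma travel: "p \<in> A \<Longrightarrow> q \<in> A \<Longrightarrow> travel w p q = theta_dist N p q"
  using N by (intro theta_travel) auto

lemma in_A: "pos i \<in> A" "(1, 0) \<in> A" "hub \<in> A"
  using N by (auto simp: pos_def)

lemma sweep_A: "sweep N \<subseteq> A"
  by (auto simp: sweep_def)

lemma time: "time 0 = 0" "strict_mono time" "0 \<le> time i"
  "time (Suc i) = time i + (if i = 0 then real N - 4 else real N - 8)"
proof -
  show "time 0 = 0" "0 \<le> time i" using N by (simp_all add: time_def)
  show *: "time (Suc i) = time i + (if i = 0 then real N - 4 else real N - 8)" for i
    by (simp add: time_def algebra_simps)
  show "strict_mono time" unfolding strict_mono_Suc_iff using N by (simp add: *)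
qed

lemma length_os [simp]: "length (os n) = Suc n"
  by (simp add: os_def)

lemma nth_os: "os n ! 0 = (0, {hub})" "1 \<le> j \<Longrightarrow> j \<le> n \<Longrightarrow> os n ! j = (time j, sweep N)"
  using nth_stream[of "j - 1" n "[(0, {hub})]" time "sweep N"]
  by (auto simp: os_def nth_stream_base)

lemma release_le: "j \<le> n \<Longrightarrow> fst (os n ! j) \<le> time n"
  using time by (cases "j = 0") (auto simp: nth_os strict_mono_less_eq)

lemma valid_os: "valid_orders w (os n)"
  unfolding os_def by (rule valid_stream[OF _ time(1,2)]) (use sweep_A in \<open>auto simp: theta_grid sweep_def\<close>)

lemma items_os: "items (os n) = {(0, hub)} \<union> {1..n} \<times> sweep N"
proof -
  have "items (os n) = (\<Union>j\<in>{..n}. {j} \<times> snd (os n ! j))" by (auto simp: items_def less_Suc_eq_le)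
  also have "{..n} = {0} \<union> {1..n}" by auto
  finally show ?thesis by (auto simp: nth_os)
qed

lemma trip_batch:
  assumes "p \<in> A" "snd ` set b \<subseteq> A"
  shows "trip Pushcart w p (events [b]) = tour (theta_dist N) (p # map snd b @ [(1, 0)])"
  using assms
proof (induction b arbitrary: p)
  case Nil
  then show ?case using travel[OF Nil(1) in_A(2)] by simp
next
  case (Cons a b)
  obtain j s where a: "a = (j, s)" by (rule prod.exhaust)
  have s: "s \<in> A" "snd ` set b \<subseteq> A" using Cons.prems(2) by (auto simp: a)
  then show ?case using Cons.IH[OF s] travel[OF Cons.prems(1) s(1)] by (simp add: a)
qed

lemma manhattan_le: "p \<in> A \<Longrightarrow> q \<in> A \<Longrightarrow> \<bar>fst p - fst q\<bar> + \<bar>snd p - snd q\<bar> \<le> theta_dist N p q"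
  unfolding theta_dist_def by auto

lemma trip_ge_variation:
  assumes "p \<in> A" "snd ` set b \<subseteq> A"
  shows "variation (map fst (p # map snd b @ [(1, 0)])) + variation (map snd (p # map snd b @ [(1, 0)]))
    \<le> trip Pushcart w p (events [b])"
  unfolding trip_batch[OF assms]
proof (rule tour_mono)
  fix q r assume "q \<in> set (p # map snd b @ [(1, 0)])" "r \<in> set (p # map snd b @ [(1, 0)])"
  then have "q \<in> A" "r \<in> A" using assms in_A(2) by auto
  then show "\<bar>fst q - fst r\<bar> + \<bar>snd q - snd r\<bar> \<le> theta_dist N q r" by (rule manhattan_le)
qed

lemma hub_trip:
  assumes "p \<in> A" "snd ` set b \<subseteq> A" "hub \<in> snd ` set b"
  shows "2 * real N - snd p \<le> trip Pushcart w p (events [b])"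
proof -
  have "real N \<in> set (snd p # map snd (map snd b) @ [0])" using assms(3) by force
  from variation_visit[OF this]
  have "2 * real N - snd p \<le> variation (map snd (p # map snd b @ [(1, 0)]))" by simp
  then show ?thesis
    using trip_ge_variation[OF assms(1,2)] variation_nonneg[of "map fst (p # map snd b @ [(1, 0)])"]
    by linarith
qed

text \<open>The loop must go to both outer aisles and back, and to the far end and back.\<close>

lemma loop_trip:
  assumes "snd ` set b \<subseteq> A" "sweep N \<subseteq> snd ` set b"
  shows "C \<le> trip Pushcart w (1, 0) (events [b])"
proof -
  have "(0, 0) \<in> sweep N" "(2, 0) \<in> sweep N" "(0, real N) \<in> sweep N"
    by (auto simp: sweep_def intro!: image_eqI[of _ _ 0] image_eqI[of _ _ N])
  then have s: "(0, 0) \<in> set (map snd b)" "(2, 0) \<in> set (map snd b)" "(0, real N) \<in> set (map snd b)"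
    using assms(2) by auto
  then have "0 \<in> set (1 # map fst (map snd b) @ [1])" "2 \<in> set (1 # map fst (map snd b) @ [1])"
      "real N \<in> set (0 # map snd (map snd b) @ [0])"
    by (force simp del: map_map)+
  from variation_visit_two[OF this(1,2)] variation_visit[OF this(3)]
  have "4 \<le> variation (map fst ((1, 0) # map snd b @ [(1, 0)]))"
    "2 * real N \<le> variation (map snd ((1, 0) # map snd b @ [(1, 0)]))" by auto
  then show ?thesis using trip_ge_variation[OF in_A(2) assms(1)] by linarith
qed

lemma sweep_trip:
  assumes "p \<in> A" "snd ` set ((j, s) # c) \<subseteq> A" "sweep N \<subseteq> snd ` set ((j, s) # c)"
  shows "theta_dist N p s + 2 * real N + snd s - 2 \<le> trip Pushcart w p (events [(j, s) # c])"
proof -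
  have "2 * real N + snd s - 2 \<le> tour (theta_dist N) (s # map snd c @ [(1, 0)])"
    by (rule sweep_tour) (use N assms(2,3) in_A(2) in auto)
  then show ?thesis unfolding trip_batch[OF assms(1,2)] by simp
qed

text \<open>The cost of \<open>K\<close> sweeps, at most two per batch, and of the hub if \<open>h\<close> holds. The hub is carried along for
  free if the number of sweeps is odd, since then some batch has a free bin.\<close>

definition backlog :: "nat \<Rightarrow> bool \<Rightarrow> real" where
  "backlog K h = real ((K + 1) div 2) * C + (if h \<and> even K then 2 * real N else 0)"

lemma backlog_values:
  "backlog (2 * m) h = real m * C + (if h then 2 * real N else 0)"
  "backlog (Suc (2 * m)) h = real (Suc m) * C"
  "backlog (Suc (Suc (2 * m))) h = real (Suc m) * C + (if h then 2 * real N else 0)"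
  "backlog (Suc (Suc (Suc (2 * m)))) h = real (Suc (Suc m)) * C"
  by (simp_all add: backlog_def)

lemma backlog_step:
  assumes "k + (if h then 1 else 0) \<le> 2" "k > 0 \<or> h" "\<not> (h \<and> h')"
  shows "backlog (k + K) (h \<or> h') \<le> (if k = 0 then 2 * real N else C) + backlog K h'"
proof -
  obtain m where m: "K = 2 * m \<or> K = Suc (2 * m)" by (metis evenE oddE Suc_eq_plus1)
  have "k = 0 \<or> k = 1 \<or> k = 2" using assms(1) by (auto split: if_splits)
  then consider "k = 0" "h" "\<not> h'" | "k = 1" | "k = 2" "\<not> h" using assms by (auto split: if_splits)
  then show ?thesis
  proof cases
    case 1
    then show ?thesis using m by (auto simp: backlog_values)
  next
    case 2
    then show ?thesis using m by (auto simp: backlog_values distrib_right)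
  next
    case 3
    then show ?thesis using m by (auto simp: backlog_values distrib_right)
  qed
qed

text \<open>What feasibility of a plan means for a single batch: it has whole orders only.\<close>

definition loaded :: "batch \<Rightarrow> bool" where
  "loaded b \<longleftrightarrow> card (orders_of b) \<le> 2 \<and> snd ` set b \<subseteq> A \<and>
     (\<forall>j\<in>orders_of b. if j = 0 then hub \<in> snd ` set b else sweep N \<subseteq> snd ` set b)"

lemma card_orders: "card (orders_of b) = card (orders_of b - {0}) + (if 0 \<in> orders_of b then 1 else 0)"
proof -
  have "finite (orders_of b)" by (simp add: orders_of_def)
  then show ?thesis by (auto simp: card_Diff_singleton card_gt_0_iff dest: card_Suc_Diff1)
qed

text \<open>The batches are added one by one; each pays for the orders that it contributes.\<close>

lemma backlog_trip:
  assumes "\<forall>b\<in>set bs. b \<noteq> [] \<and> loaded b"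
    and "sorted_wrt (\<lambda>b b'. orders_of b \<inter> orders_of b' = {}) bs"
  shows "backlog (card ((\<Union>b\<in>set bs. orders_of b) - {0})) (0 \<in> (\<Union>b\<in>set bs. orders_of b))
    \<le> trip Pushcart w (1, 0) (events bs)"
  using assms
proof (induction bs)
  case Nil
  then show ?case by (simp add: backlog_def)
next
  case (Cons b bs)
  define U where "U = (\<Union>b\<in>set bs. orders_of b)"
  define k where "k = card (orders_of b - {0})"
  define h where "h \<longleftrightarrow> 0 \<in> orders_of b"
  have fin: "finite (orders_of b)" "finite U" by (auto simp: orders_of_def U_def)
  have disj: "orders_of b \<inter> U = {}" using Cons.prems(2) by (auto simp: U_def)
  have b: "b \<noteq> []" "loaded b" using Cons.prems(1) by auto
  have "card (orders_of b) = k + (if h then 1 else 0)" unfolding k_def h_def by (rule card_orders)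
  then have 1: "k + (if h then 1 else 0) \<le> 2" using b by (simp add: loaded_def)
  have ne: "orders_of b \<noteq> {}" using b by (auto simp: orders_of_def)
  then have 2: "k > 0 \<or> h" using fin by (auto simp: k_def h_def card_gt_0_iff)
  have 3: "\<not> (h \<and> 0 \<in> U)" using disj by (auto simp: h_def)
  have "(if k = 0 then 2 * real N else C) \<le> trip Pushcart w (1, 0) (events [b])"
  proof (cases "k = 0")
    case True
    then have "0 \<in> orders_of b" using 2 by (simp add: h_def)
    then show ?thesis using True hub_trip[OF in_A(2), of b] b by (auto simp: loaded_def)
  next
    case False
    then obtain j where "j \<in> orders_of b" "j \<noteq> 0" by (auto simp: k_def card_gt_0_iff)
    then have "sweep N \<subseteq> snd ` set b" using b by (auto simp: loaded_def)
    then show ?thesis using False loop_trip[of b] b by (simp add: loaded_def)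
  qed
  moreover have "backlog (card (U - {0})) (0 \<in> U) \<le> trip Pushcart w (1, 0) (events bs)"
    unfolding U_def by (rule Cons.IH) (use Cons.prems in auto)
  moreover have "card ((orders_of b \<union> U) - {0}) = k + card (U - {0})"
    unfolding k_def Un_Diff by (rule card_Un_disjoint) (use fin disj in auto)
  then have "backlog (card ((orders_of b \<union> U) - {0})) (0 \<in> orders_of b \<union> U)
      \<le> (if k = 0 then 2 * real N else C) + backlog (card (U - {0})) (0 \<in> U)"
    using backlog_step[OF 1 2 3, of "card (U - {0})"] by (simp add: h_def)
  ultimately show ?case
    using trip_next_batch[of w "(1, 0)" b bs] by (simp add: U_def)
qed

lemma loaded_batches:
  assumes "feasible w (os n) {} {} bs" "b \<in> set bs"
  shows "loaded b"
  unfolding loaded_def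
proof (intro conjI ballI)
  show "card (orders_of b) \<le> 2" using assms by (simp add: feasible_iff)
  have "set b \<subseteq> items (os n)" using assms by (auto simp: feasible_iff)
  then show "snd ` set b \<subseteq> A" using in_A(3) sweep_A by (auto simp: items_os)
  fix j assume j: "j \<in> orders_of b"
  then have "j \<le> n" using \<open>set b \<subseteq> items (os n)\<close> by (auto simp: items_os orders_of_def)
  have "\<forall>s\<in>snd (os n ! j). s \<in> snd ` set b"
    using feasible_whole_orders[OF assms j] by force
  then show "if j = 0 then hub \<in> snd ` set b else sweep N \<subseteq> snd ` set b"
    using \<open>j \<le> n\<close> nth_os(1)[of n] nth_os(2)[of j n] by auto
qed

lemma plan_trip:
  assumes f: "feasible w (os n) {} {} (b # bs)"
  defines "J \<equiv> card (orders_of b - {0})"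
  shows "J \<le> n"
    and "trip Pushcart w p (events [b]) + backlog (n - J) (0 \<notin> orders_of b)
      \<le> trip Pushcart w p (events (b # bs))"
proof -
  define U where "U = (\<Union>b\<in>set bs. orders_of b)"
  have fin: "finite (orders_of b)" "finite U" by (auto simp: orders_of_def U_def)
  have disj: "orders_of b \<inter> U = {}" using f by (auto simp: feasible_iff U_def)
  have "orders_of b \<union> U = fst ` set (concat (b # bs))" by (auto simp: U_def orders_of_def image_Un image_UN)
  also have "set (concat (b # bs)) = items (os n)" using f unfolding feasible_iff by blast
  also have "fst ` items (os n) = {..n}"
  proof -
    have "sweep N \<noteq> {}" by (auto simp: sweep_def)
    then have "fst ` items (os n) = insert 0 {1..n}"
      by (simp add: items_os image_Un fst_image_times)
    also have "\<dots> = {..n}" by auto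
    finally show ?thesis .
  qed
  finally have all: "orders_of b \<union> U = {..n}" .
  have "J + card (U - {0}) = card ((orders_of b - {0}) \<union> (U - {0}))"
    unfolding J_def by (intro card_Un_disjoint[symmetric] finite_Diff fin) (use disj in blast)
  also have "(orders_of b - {0}) \<union> (U - {0}) = {..n} - {0}" unfolding all[symmetric] by blast
  also have "card \<dots> = n" by (simp add: card_Diff_singleton)
  finally have "J + card (U - {0}) = n" .
  then have U: "card (U - {0}) = n - J" and "J \<le> n" by auto
  then show "J \<le> n" by simp
  have "0 \<in> orders_of b \<union> U" unfolding all by simp
  then have "0 \<in> U \<longleftrightarrow> 0 \<notin> orders_of b" using disj by blast
  moreover have "backlog (card (U - {0})) (0 \<in> U) \<le> trip Pushcart w (1, 0) (events bs)"
    unfolding U_def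
    by (rule backlog_trip) (use f loaded_batches[OF f] in \<open>auto simp: feasible_iff\<close>)
  ultimately show "trip Pushcart w p (events [b]) + backlog (n - J) (0 \<notin> orders_of b)
      \<le> trip Pushcart w p (events (b # bs))"
    using trip_next_batch[of w p b bs] by (simp add: U)
qed

lemma trip_visit:
  assumes "J \<noteq> []" "p \<in> A" "set ss \<subseteq> A"
  shows "trip Pushcart w p (map (\<lambda>(j, s). Pick j s) (visit J ss) @ es)
    = tour (theta_dist N) (p # ss) + trip Pushcart w (last (p # ss)) es"
  using assms(2,3)
proof (induction ss arbitrary: p)
  case (Cons s ss)
  have s: "s \<in> A" using Cons.prems by simp
  have stay: "trip Pushcart w s (map (\<lambda>(j, s). Pick j s) (map (\<lambda>j. (j, s)) J') @ es') = trip Pushcart w s es'"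
    for J' es' using travel[OF s s] by (induction J') (auto simp: theta_dist_def)
  obtain j J' where J: "J = j # J'" using assms(1) by (cases J) auto
  have "trip Pushcart w p (map (\<lambda>(j, s). Pick j s) (visit J (s # ss)) @ es)
    = theta_dist N p s + trip Pushcart w s (map (\<lambda>(j, s). Pick j s) (visit J ss) @ es)"
    using stay[of J'] travel[OF Cons.prems(1) s] by (simp add: J)
  also have "\<dots> = tour (theta_dist N) (p # s # ss) + trip Pushcart w (last (s # ss)) es"
    using Cons.IH[OF s] Cons.prems by simp
  finally show ?case by simp
qed simp

lemma columns:
  "left_column N = (0, 0) # tl (left_column N)" "last (left_column N) = (0, real N)"
  "right_column N = (2, real N) # tl (right_column N)" "last (right_column N) = (2, 0)"
  "tour (theta_dist N) (left_column N) = real N" "tour (theta_dist N) (right_column N) = real N"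
  "set (left_column N) \<subseteq> A" "set (right_column N) \<subseteq> A"
proof -
  show "left_column N = (0, 0) # tl (left_column N)"
    by (simp add: left_column_def upt_conv_Cons del: upt_Suc)
  show "right_column N = (2, real N) # tl (right_column N)" by (simp add: right_column_def)
  show "last (left_column N) = (0, real N)" by (simp add: left_column_def)
  show "last (right_column N) = (2, 0)"
    by (simp add: right_column_def last_map last_rev del: upt_Suc)
  show "tour (theta_dist N) (left_column N) = real N" unfolding left_column_def by (rule tour_left_column)
  show "tour (theta_dist N) (right_column N) = real N" unfolding right_column_def by (rule tour_right_column)
  show "set (left_column N) \<subseteq> A" "set (right_column N) \<subseteq> A" by (auto simp: set_columns)
qed

lemma tour_into_column:
  "tour (theta_dist N) (p # left_column N) = theta_dist N p (0, 0) + real N"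
  "tour (theta_dist N) (p # right_column N) = theta_dist N p (2, real N) + real N"
proof -
  obtain xs ys where "left_column N = (0, 0) # xs" "right_column N = (2, real N) # ys"
    using columns(1,3) by blast
  then show "tour (theta_dist N) (p # left_column N) = theta_dist N p (0, 0) + real N"
    "tour (theta_dist N) (p # right_column N) = theta_dist N p (2, real N) + real N"
    using columns(5,6) by simp_all
qed

text \<open>The hub lies on the way between the upper ends of the outer aisles, so that it is picked for free.\<close>

lemma trip_loop:
  assumes "J \<noteq> []" "p \<in> A" "B = [] \<or> B = [(0, hub)]"
  shows "trip Pushcart w p (events [loop N J B]) = theta_dist N p (0, 0) + 2 * real N + 3"
proof -
  define up where "up = map (\<lambda>(j, s). Pick j s) (visit J (left_column N))"
  define down where "down = map (\<lambda>(j, s). Pick j s) (visit J (right_column N)) @ [Close]"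
  have e: "events [loop N J B] = up @ map (\<lambda>(j, s). Pick j s) B @ down"
    by (simp add: loop_def up_def down_def)
  have corners: "((0, real N) :: loc) \<in> A" "((2, 0) :: loc) \<in> A" by auto
  obtain xs ys where xs: "left_column N = (0, 0) # xs" and ys: "right_column N = (2, real N) # ys"
    using columns(1,3) by blast
  have last: "last (q # left_column N) = (0, real N)" "last (q # right_column N) = (2, 0)" for q
    using columns(2,4) by (simp_all add: xs ys)
  have "trip Pushcart w q down = theta_dist N q (2, real N) + real N + 1" if "q \<in> A" for q
    unfolding down_def trip_visit[OF assms(1) that columns(8)] tour_into_column last
    using travel[OF corners(2) in_A(2)] by (simp add: theta_dist_def)
  then have down: "trip Pushcart w (0, real N) down = real N + 3" "trip Pushcart w hub down = real N + 2"
    using corners in_A by (auto simp: theta_dist_def)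
  have "trip Pushcart w (0, real N) (map (\<lambda>(j, s). Pick j s) B @ down) = real N + 3"
    using assms(3) down travel[OF corners(1) in_A(3)] by (auto simp: theta_dist_def)
  then show ?thesis
    unfolding e up_def trip_visit[OF assms(1,2) columns(7)] tour_into_column last by simp
qed

lemma loop_locs: "B = [] \<or> B = [(0, hub)] \<Longrightarrow> (j, s) \<in> set (loop N J B) \<Longrightarrow> s \<in> A"
  using columns(7,8) in_A(3) by (auto simp: loop_def)

lemma finish_pairs:
  assumes "t \<le> \<tau>" "\<And>i. i < m \<Longrightarrow> fst (os n ! (2 * i + 1)) \<le> \<tau> + real i * C"
    "\<And>i. i < m \<Longrightarrow> fst (os n ! (2 * i + 2)) \<le> \<tau> + real i * C"
  shows "finish Pushcart w (os n) t (1, 0) (events (pairs N m)) \<le> \<tau> + real m * C"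
proof -
  have len: "length (pairs N m) = m" by (simp add: pairs_def)
  have "finish Pushcart w (os n) t (1, 0) (events (pairs N m)) \<le> \<tau> + 0 + real (length (pairs N m)) * C \<and>
      dest Pushcart w (1, 0) (events (pairs N m)) = (1, 0)"
  proof (rule pipelined_batches[OF geodesic, unfolded theta_grid])
    fix i assume "i < length (pairs N m)"
    then have i: "i < m" and nth: "pairs N m ! i = loop N [2 * i + 1, 2 * i + 2] []"
      by (simp_all add: pairs_def)
    show "trip Pushcart w (1, 0) (events [pairs N m ! i]) \<le> C + (if i = 0 then 0 else 0)"
      unfolding nth using in_A(2) by (subst trip_loop) (auto simp: theta_dist_def)
    show "dest Pushcart w (1, 0) (events [pairs N m ! i]) = (1, 0)" by simp
    fix j s assume js: "(j, s) \<in> set (pairs N m ! i)"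
    then show "s \<in> A" using loop_locs[of "[]"] by (simp add: nth)
    have "j = 2 * i + 1 \<or> j = 2 * i + 2" using js by (auto simp: nth loop_def)
    then show "fst (os n ! j) \<le> \<tau> + real i * C" using assms(2,3)[OF i] by auto
  qed (use assms(1) in_A(2) in auto)
  then show ?thesis by (simp add: len)
qed

text \<open>The best plan for an even number of sweeps, if the picker is in the middle aisle at height 4 or more. It is also good enough for the picker who
  knows the whole stream.\<close>

definition up_plan :: "nat \<Rightarrow> batch list" where
  "up_plan m = [(0, hub)] # pairs N m"

text \<open>The hub shares a loop with the sweep that has no partner.\<close>

definition down_plan :: "nat \<Rightarrow> batch list" where
  "down_plan m = loop N [2 * m + 1] [(0, hub)] # pairs N m"

lemma loop_batch:
  assumes "set J \<subseteq> {1..n}" "distinct J" "length J + length B \<le> 2" "B = [] \<or> B = [(0, hub)]" "J \<noteq> [] \<or> B \<noteq> []"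
  shows "loop N J B \<noteq> []" "distinct (loop N J B)" "card (orders_of (loop N J B)) \<le> capacity w"
    "set (loop N J B) = {(j, s). j \<in> orders_of (loop N J B) \<and> s \<in> snd (os n ! j)}"
proof -
  have d: "distinct (left_column N)" "distinct (right_column N)"
    by (simp_all add: left_column_def right_column_def distinct_map inj_on_def del: upt_Suc)
  show "loop N J B \<noteq> []"
  proof (cases "J = []")
    case False
    have "(0, 0) \<in> set (left_column N)" by (subst columns(1)) simp
    with False have "set (visit J (left_column N)) \<noteq> {}" by auto
    then show ?thesis unfolding loop_def by (metis append_is_Nil_conv set_empty)
  qed (use assms(5) in \<open>simp add: loop_def\<close>)
  show "distinct (loop N J B)"
    using distinct_visit[OF assms(2) d(1)] distinct_visit[OF assms(2) d(2)] assms(4)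
    by (auto simp: loop_def set_columns)
  have "card (set J \<union> orders_of B) \<le> card (set J) + card (orders_of B)" by (rule card_Un_le)
  also have "\<dots> \<le> length J + length B"
    using assms(4) by (intro add_mono card_length) (auto simp: orders_of_def)
  finally show "card (orders_of (loop N J B)) \<le> capacity w" using assms(3) by (simp add: orders_of_loop)
  have sweep: "snd (os n ! j) = sweep N" if "j \<in> set J" for j using that assms(1) by (subst nth_os(2)) auto
  have "set (loop N J B) = set J \<times> sweep N \<union> set B" by (auto simp: loop_def simp flip: set_columns(1))
  also have "\<dots> = {(j, s). j \<in> set J \<union> orders_of B \<and> s \<in> snd (os n ! j)}"
    using assms(4) sweep nth_os(1)[of n] assms(1) by (auto simp: orders_of_def)
  finally show "set (loop N J B) = {(j, s). j \<in> orders_of (loop N J B) \<and> s \<in> snd (os n ! j)}"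
    by (simp add: orders_of_loop)
qed

lemma feasible_plan:
  assumes B: "B = [] \<or> B = [(0, hub)]" and first: "set J \<subseteq> {1..n}" "distinct J" "length J + length B \<le> 2" "J \<noteq> [] \<or> B \<noteq> []"
    and all: "set J \<union> orders_of B \<union> {1..2 * m} = {..n}" and disj: "(set J \<union> orders_of B) \<inter> {1..2 * m} = {}"
  shows "feasible w (os n) {} {} (loop N J B # pairs N m)"
proof -
  have batch: "b \<noteq> [] \<and> distinct b \<and> card (orders_of b) \<le> capacity w \<and>
      set b = {(j, s). j \<in> orders_of b \<and> s \<in> snd (os n ! j)}" if mem: "b \<in> set (loop N J B # pairs N m)" for b
  proof (cases "b = loop N J B")
    case True
    show ?thesis unfolding True by (intro conjI loop_batch[OF first(1-3) B first(4)])
  next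
    case False
    then obtain i where i: "i < m" "b = loop N [2 * i + 1, 2 * i + 2] []"
      using mem by (auto simp: pairs_def)
    have "{1..2 * m} \<subseteq> {..n}" using all by blast
    then have "set [2 * i + 1, 2 * i + 2] \<subseteq> {1..n}" using i(1) by auto
    from loop_batch[OF this, of "[]"] show ?thesis unfolding i(2) by simp
  qed
  have "orders_of b \<subseteq> {1..2 * m}" if "b \<in> set (pairs N m)" for b using that orders_of_pairs[of N m] by blast
  then have "sorted_wrt (\<lambda>b b'. orders_of b \<inter> orders_of b' = {}) (loop N J B # pairs N m)"
    using disjoint_pairs[of N m] disj by (auto simp: orders_of_loop)
  moreover have "(\<Union>b\<in>set (loop N J B # pairs N m). orders_of b) = {..<length (os n)}"
    using all orders_of_pairs[of N m] by (simp add: orders_of_loop lessThan_Suc_atMost)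
  ultimately show ?thesis using batch by (intro feasibleI) blast+
qed

lemma feasible_up: "feasible w (os (2 * m)) {} {} (up_plan m)"
proof -
  have "visit [] ss = []" for ss by (induction ss) auto
  then have "loop N [] [(0, hub)] = [(0, hub)]" by (simp add: loop_def)
  moreover have "insert 0 {Suc 0..2 * m} = {..2 * m}" by auto
  ultimately show ?thesis
    using feasible_plan[of "[(0, hub)]" "[]" "2 * m" m] by (auto simp: up_plan_def orders_of_def)
qed

lemma feasible_down: "feasible w (os (Suc (2 * m))) {} {} (down_plan m)"
  unfolding down_plan_def by (rule feasible_plan) (auto simp: orders_of_def)

lemma finish_up:
  assumes "p \<in> A" "fst p = 1" "0 \<le> t" "t + (2 * real N - snd p) \<le> \<tau>"
    and "\<And>i. i < m \<Longrightarrow> fst (os n ! (2 * i + 1)) \<le> \<tau> + real i * C"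
    "\<And>i. i < m \<Longrightarrow> fst (os n ! (2 * i + 2)) \<le> \<tau> + real i * C"
  shows "finish Pushcart w (os n) t p (events (up_plan m)) \<le> \<tau> + real m * C"
proof -
  have "finish Pushcart w (os n) t p (events (up_plan m))
    = finish Pushcart w (os n) (t + (2 * real N - snd p)) (1, 0) (events (pairs N m))"
  proof -
    have "snd p \<le> real N" using assms(1) by auto
    then have "travel w p hub = real N - snd p" "travel w hub (1, 0) = real N"
        "max (t + (real N - snd p)) 0 = t + (real N - snd p)"
        "t + (real N - snd p) + real N = t + (2 * real N - snd p)"
      using travel[OF assms(1) in_A(3)] travel[OF in_A(3,2)] assms(2,3) by (simp_all add: theta_dist_def)
    then show ?thesis by (simp add: up_plan_def Let_def nth_os) (simp add: algebra_simps)
  qed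
  also have "\<dots> \<le> \<tau> + real m * C" by (rule finish_pairs[OF assms(4-6)])
  finally show ?thesis .
qed

lemma finish_down:
  assumes "p \<in> A" "fst p = 1" "time (Suc (2 * m)) \<le> t"
  shows "finish Pushcart w (os (Suc (2 * m))) t p (events (down_plan m)) \<le> t + snd p + real (Suc m) * C"
proof -
  define n where "n = Suc (2 * m)"
  define b where "b = loop N [n] [(0, hub)]"
  have p: "theta_dist N p (0, 0) \<le> 1 + snd p" using assms(1,2) by (auto simp: theta_dist_def)
  have "finish Pushcart w (os n) t p (events [b]) \<le> t + trip Pushcart w p (events [b])"
  proof (rule finish_le_trip[OF geodesic])
    show "p \<in> aisle_points w" using assms(1) by (simp add: theta_grid)
    show "picks_in (aisle_points w) (events [b])"
      unfolding picks_in_def Pick_in_events theta_grid using loop_locs[of "[(0, hub)]"] by (simp add: b_def)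
    fix j s assume "Pick j s \<in> set (events [b])"
    then have "j \<in> {0, n}" unfolding Pick_in_events by (auto simp: b_def loop_def)
    then show "fst (os n ! j) \<le> t" using release_le[of j n] assms(3) by (auto simp: n_def)
  qed simp
  also have "\<dots> \<le> t + snd p + C" using p unfolding b_def by (subst trip_loop[OF _ assms(1)]) auto
  finally have "finish Pushcart w (os n) (finish Pushcart w (os n) t p (events [b])) (1, 0) (events (pairs N m))
    \<le> (t + snd p + C) + real m * C"
  proof (rule finish_pairs)
    have early: "time n \<le> t + snd p + C + real i * C" for i
      using assms(1,3) by (auto simp: n_def intro: order_trans)
    fix i assume "i < m"
    then show "fst (os n ! (2 * i + 1)) \<le> t + snd p + C + real i * C"
        "fst (os n ! (2 * i + 2)) \<le> t + snd p + C + real i * C"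
      using release_le[of "2 * i + 1" n] release_le[of "2 * i + 2" n] early[of i] by (simp_all add: n_def)
  qed
  note bound = this
  have ev: "events (down_plan m) = events [b] @ events (pairs N m)"
    by (simp add: down_plan_def b_def n_def)
  have home: "dest Pushcart w p (events [b]) = (1, 0)" by simp
  have sum: "t + snd p + C + real m * C = t + snd p + real (Suc m) * C" by (simp add: algebra_simps)
  show ?thesis unfolding n_def[symmetric] ev finish_append home using bound unfolding sum .
qed

lemma backlog_ge: "real ((K + 1) div 2) * C \<le> backlog K h"
  unfolding backlog_def by simp

text \<open>By \<open>sweep_trip\<close>, a first batch with sweeps costs at least \<open>2 N + 2\<close> from height 4. If it has one sweep,
  then the remaining ones still need \<open>m\<close> loops; if it has two, then \<open>m - 1\<close> loops and a batch for the hub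
  remain. Both are worse than fetching the hub first, and so is an empty first batch.\<close>

lemma even_first_batch:
  assumes f: "feasible w (os (2 * m)) {} {} bs" and "m > 0"
    and cheap: "trip Pushcart w (1, 4) (events bs) \<le> (2 * real N - 4) + real m * C"
  shows "hd bs \<noteq> []" "orders_of (hd bs) = {0}"
proof -
  obtain b bs' where bs: "bs = b # bs'" using f by (cases bs) (auto simp: feasible_iff)
  define J where "J = card (orders_of b - {0})"
  have p: "(1, 4) \<in> A" using N by simp
  note J = plan_trip[OF f[unfolded bs], folded J_def]
  have total: "trip Pushcart w (1, 4) (events [b]) + backlog (2 * m - J) (0 \<notin> orders_of b)
      \<le> (2 * real N - 4) + real m * C"
    using J(2)[of "(1, 4)"] cheap by (simp add: bs)
  have b: "loaded b" using loaded_batches[OF f, of b] by (simp add: bs)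
  have card: "J + (if 0 \<in> orders_of b then 1 else 0) \<le> 2"
    using card_orders[of b] b by (simp add: J_def loaded_def)
  have "J = 0"
  proof (rule ccontr)
    assume "J \<noteq> 0"
    then obtain l where l: "l \<in> orders_of b" "l \<noteq> 0" by (auto simp: J_def card_gt_0_iff)
    then obtain j s c where c: "b = (j, s) # c" by (cases b) (auto simp: orders_of_def)
    have s: "snd ` set b \<subseteq> A" "sweep N \<subseteq> snd ` set b" using b l by (auto simp: loaded_def)
    have "s \<in> A" using s(1) by (simp add: c)
    from manhattan_le[OF p this] have "4 - snd s \<le> theta_dist N (1, 4) s" by auto
    with sweep_trip[OF p s[unfolded c]]
    have ge: "2 * real N + 2 \<le> trip Pushcart w (1, 4) (events [b])" by (simp add: c)
    have "J \<le> 2" using card by simp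
    with \<open>J \<noteq> 0\<close> consider "J = 1" | "J = 2" by linarith
    then show False
    proof cases
      case 1
      then have "2 * m - J = Suc (2 * (m - 1))" using \<open>m > 0\<close> by simp
      then have "backlog (2 * m - J) (0 \<notin> orders_of b) = real m * C"
        using \<open>m > 0\<close> by (simp add: backlog_values)
      then show False using total ge by simp
    next
      case 2
      then have "2 * m - J = 2 * (m - 1)" "0 \<notin> orders_of b" using card by (auto split: if_splits)
      then have "backlog (2 * m - J) (0 \<notin> orders_of b) = real (m - 1) * C + 2 * real N"
        by (simp add: backlog_values)
      also have "real (m - 1) = real m - 1" using \<open>m > 0\<close> by simp
      finally show False using total ge N by (simp add: algebra_simps)
    qed
  qed
  then have sub: "orders_of b \<subseteq> {0}" by (auto simp: J_def orders_of_def)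
  have "0 \<in> orders_of b"
  proof (rule ccontr)
    assume 0: "0 \<notin> orders_of b"
    then have "orders_of b = {}" using sub by blast
    then have "b = []" by (simp add: orders_of_def)
    then have "trip Pushcart w (1, 4) (events [b]) = 4"
      using travel[OF p in_A(2)] by (simp add: theta_dist_def)
    then show False using total 0 \<open>J = 0\<close> by (simp add: backlog_values)
  qed
  then show "orders_of (hd bs) = {0}" "hd bs \<noteq> []" using sub by (auto simp: bs orders_of_def)
qed

text \<open>A first batch for the hub alone leaves all sweeps, which need \<open>m + 1\<close> loops. A first batch with sweeps costs
  almost \<open>2 N\<close> plus the height of its first item \<open>s\<close> after the walk to \<open>s\<close>. This excludes a walk by the hub, and
  leaves only items close to the cross-aisle at the depot.\<close>

lemma odd_first_event:
  assumes f: "feasible w (os (Suc (2 * m))) {} {} bs"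
    and cheap: "trip Pushcart w (1, real N - 4) (events bs) \<le> (real N - 4) + real (Suc m) * C"
    and ne: "bs = ((j, s) # c) # bs'"
  shows "fst s \<noteq> 1" "snd s \<le> 5 / 2" "theta_dist N (1, real N - 4) s = real N - 3 + snd s"
proof -
  define b where "b = (j, s) # c"
  define J where "J = card (orders_of b - {0})"
  define p where "p = (1 :: real, real N - 4)"
  have p: "p \<in> A" using N by (simp add: p_def)
  note J = plan_trip[OF f[unfolded ne], folded b_def, folded J_def]
  have total: "trip Pushcart w p (events [b]) + backlog (Suc (2 * m) - J) (0 \<notin> orders_of b)
      \<le> (real N - 4) + real (Suc m) * C"
    using J(2)[of p] cheap by (simp add: ne b_def p_def)
  have b: "loaded b" using loaded_batches[OF f, of b] by (simp add: ne b_def)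
  have card: "J + (if 0 \<in> orders_of b then 1 else 0) \<le> 2"
    using card_orders[of b] b by (simp add: J_def loaded_def)
  have sA: "snd ` set b \<subseteq> A" using b by (simp add: loaded_def)
  then have s: "s \<in> A" by (simp add: b_def)
  have "J \<noteq> 0"
  proof
    assume "J = 0"
    then have "orders_of b \<subseteq> {0}" by (auto simp: J_def orders_of_def)
    then have "0 \<in> orders_of b" by (auto simp: orders_of_def b_def)
    then have "2 * real N - snd p \<le> trip Pushcart w p (events [b])"
      using b by (intro hub_trip[OF p sA]) (auto simp: loaded_def)
    then show False using total \<open>J = 0\<close> by (simp add: backlog_values p_def)
  qed
  then obtain l where "l \<in> orders_of b" "l \<noteq> 0" by (auto simp: J_def card_gt_0_iff)
  then have sw: "sweep N \<subseteq> snd ` set b" using b by (auto simp: loaded_def)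
  have "real m * C \<le> backlog (Suc (2 * m) - J) (0 \<notin> orders_of b)"
  proof -
    have "m \<le> (Suc (2 * m) - J + 1) div 2" using card by (auto split: if_splits)
    then have "real m * C \<le> real ((Suc (2 * m) - J + 1) div 2) * C" by (intro mult_right_mono) auto
    then show ?thesis using backlog_ge by (rule order_trans)
  qed
  then have near: "theta_dist N p s + snd s \<le> real N + 2"
    using total sweep_trip[OF p sA[unfolded b_def] sw[unfolded b_def]]
    by (simp add: b_def algebra_simps)
  show side: "fst s \<noteq> 1"
  proof
    assume "fst s = 1"
    moreover have "(j, s) \<in> items (os (Suc (2 * m)))" using f ne by (auto simp: feasible_iff)
    ultimately have "s = hub" by (auto simp: items_os sweep_def)
    then show False using near by (simp add: theta_dist_def p_def)
  qed
  then have "\<bar>1 - fst s\<bar> = 1" using s by auto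
  then have d: "theta_dist N p s = 1 + min (real N - 4 + snd s) (real N + 4 - snd s)"
    using side by (simp add: theta_dist_def p_def)
  have "real N - 4 + snd s \<le> real N + 4 - snd s"
  proof (rule ccontr)
    assume "\<not> ?thesis"
    then show False using d near by simp
  qed
  then show "theta_dist N (1, real N - 4) s = real N - 3 + snd s" "snd s \<le> 5 / 2"
    using d near by (simp_all add: p_def)
qed

text \<open>The picker walks to an item of an outer aisle in shortest time and hence on the path by
  the depot. Distances from both ends of this path locate her in the middle aisle.\<close>

lemma way_down:
  assumes \<gamma>: "movement w \<gamma>" "\<gamma> t = (1, real N - 4)" "\<gamma> (t + (real N - 3 + snd s)) = s"
    and s: "s \<in> A" "fst s \<noteq> 1" "snd s \<le> 5 / 2"
  shows "\<gamma> (t + (real N - 8)) = (1, 4)"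
proof -
  define r where "r = \<gamma> (t + (real N - 8))"
  define p where "p = (1 :: real, real N - 4)"
  have p: "p \<in> A" and N': "1 \<le> N" using N by (simp_all add: p_def)
  have "theta_dist N p p = 0" "theta_dist N s s = 0" by (simp_all add: theta_dist_def)
  then have near: "theta_dist N p r \<le> real N - 8" "theta_dist N s r \<le> 5 + snd s"
    using movement_theta_dist[OF \<gamma>(1) p N', of t "t + (real N - 8)"]
      movement_theta_dist[OF \<gamma>(1) s(1) N', of "t + (real N - 3 + snd s)" "t + (real N - 8)"]
      N s by (auto simp: \<gamma>(2,3) r_def p_def)
  have "r \<in> grid w" using \<gamma>(1) by (simp add: r_def movement_def)
  then have v: "0 \<le> snd r" "snd r \<le> real N" by (auto simp: theta_grid)
  have s0: "0 \<le> snd s" using s(1) by auto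
  have N20: "20 \<le> real N" using N by simp
  have "fst r = 1"
  proof (rule ccontr)
    assume "fst r \<noteq> 1"
    then have "min (real N - 4 + snd r) (real N + 4 - snd r) \<le> real N - 8"
      using near(1) by (simp add: theta_dist_def p_def)
    then have "12 \<le> snd r" using v by linarith
    moreover have "\<bar>snd s - snd r\<bar> \<le> 5 + snd s \<or>
        min (snd s + snd r) (2 * real N - snd s - snd r) \<le> 5 + snd s"
      using near(2) by (auto simp: theta_dist_def split: if_splits)
    ultimately show False using s0 s(3) v N20 by linarith
  qed
  then have "\<bar>(real N - 4) - snd r\<bar> \<le> real N - 8"
      "min (snd s + snd r) (2 * real N - snd s - snd r) \<le> 5 + snd s - 1"
    using near s(1,2) by (auto simp: theta_dist_def p_def)
  then have "snd r = 4" using s0 s(3) v N20 by linarith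
  with \<open>fst r = 1\<close> show ?thesis by (simp add: r_def prod_eq_iff)
qed

lemma lured:
  assumes opt: "(bs, \<gamma>) \<in> optimal_plans Pushcart w (os i) (idle (time i) (pos i))"
  shows "\<gamma> (time (Suc i)) = pos (Suc i) \<and>
    (\<forall>x\<in>set (takeWhile (\<lambda>(t', q, e). t' \<le> time (Suc i))
        (schedule Pushcart w (os i) (time i) (pos i) (events bs))). snd (snd x) = Close)"
proof -
  have f: "feasible w (os i) {} {} bs" and route: "route Pushcart w (os i) (idle (time i) (pos i)) bs \<gamma>"
    and best: "\<And>bs'. feasible w (os i) {} {} bs' \<Longrightarrow>
      finish Pushcart w (os i) (time i) (pos i) (events bs) \<le> finish Pushcart w (os i) (time i) (pos i) (events bs')"
    using opt by (auto simp: optimal_plans_def completion_finish)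
  have \<gamma>: "movement w \<gamma>" "\<gamma> (time i) = pos i"
    and stops: "\<And>t q e. (t, q, e) \<in> set (schedule Pushcart w (os i) (time i) (pos i) (events bs)) \<Longrightarrow> \<gamma> t = q"
    using route by (auto simp: route_def)
  have lower: "time i + trip Pushcart w (pos i) (events bs) \<le> finish Pushcart w (os i) (time i) (pos i) (events bs)"
    by (rule finish_ge_trip)
  have "items (os i) \<noteq> {}" by (simp add: items_os)
  from feasible_first_pick[OF f this] obtain Cs j s es c where
    e: "events bs = Cs @ Pick j s # es" "Cs = [] \<or> Cs = [Close]" "concat bs = (j, s) # c"
      "(j, s) \<in> items (os i)" "hd bs = [] \<longleftrightarrow> Cs = [Close]" .
  have s: "s \<in> A" and j: "j \<le> i" using e(4) in_A(3) sweep_A by (auto simp: items_os)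
  have rel: "fst (os i ! j) \<le> time i" using release_le[OF j] .
  have N20: "20 \<le> real N" using N by simp
  show ?thesis
  proof (cases "even i")
    case True
    then obtain m where m: "i = 2 * m" by (elim evenE)
    have x: "pos i = (1, snd (pos i))" "snd (pos i) = (if i = 0 then 0 else 4)" using True by (auto simp: pos_def)
    have next_time: "time (Suc i) = time i + (real N - 4 - snd (pos i))" by (simp add: time(4) x(2))
    have first: "s = hub \<and> (Cs = [] \<or> pos i = (1, 0))"
    proof (cases "i = 0")
      case True
      then show ?thesis using e(4) by (auto simp: items_os pos_def)
    next
      case False
      then have "m > 0" using m by simp
      have "finish Pushcart w (os i) (time i) (pos i) (events (up_plan m))
        \<le> time i + (2 * real N - snd (pos i)) + real m * C"
      proof (rule finish_up[OF in_A(1) _ time(3) order_refl])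
        fix l assume "l < m"
        have "0 \<le> real l * C" "snd (pos i) \<le> 4" using x(2) by simp_all
        then have "time i \<le> time i + (2 * real N - snd (pos i)) + real l * C" using N20 by linarith
        then show "fst (os i ! (2 * l + 1)) \<le> time i + (2 * real N - snd (pos i)) + real l * C"
            "fst (os i ! (2 * l + 2)) \<le> time i + (2 * real N - snd (pos i)) + real l * C"
          using release_le[of "2 * l + 1" i] release_le[of "2 * l + 2" i] \<open>l < m\<close> m by linarith+
      qed (simp add: pos_def)
      then have "trip Pushcart w (1, 4) (events bs) \<le> 2 * real N - 4 + real m * C"
        using best[of "up_plan m"] feasible_up[of m] lower x False m by simp
      from even_first_batch[OF f[unfolded m] \<open>m > 0\<close> this]
      have hd: "hd bs \<noteq> []" "orders_of (hd bs) = {0}" by auto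
      then have "(j, s) \<in> set (hd bs)" using e(3) by (cases bs; cases "hd bs") auto
      then have "j = 0" using hd(2) by (force simp: orders_of_def)
      then show ?thesis using e(2,4,5) hd(1) by (auto simp: items_os)
    qed
    define u where "u = time i + (real N - snd (pos i))"
    have "travel w (pos i) hub = real N - snd (pos i)"
      using travel[OF in_A(1,3), of i] x N20 by (simp add: theta_dist_def split: if_splits)
    moreover have "Cs = [Close] \<Longrightarrow> travel w (pos i) (1, 0) = 0 \<and> pos i = (1, 0)"
      using first travel[OF in_A(2,2)] by (auto simp: theta_dist_def)
    moreover have "max (time i + (real N - snd (pos i))) (fst (os i ! j)) = u"
      using rel x(2) N20 by (simp add: u_def split: if_splits)
    ultimately have sch: "schedule Pushcart w (os i) (time i) (pos i) (events bs)
        = map (\<lambda>c. (time i, pos i, Close)) Cs @ (u, hub, Pick j hub) # schedule Pushcart w (os i) u hub es"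
      using e(2) first by (auto simp: e(1) Let_def)
    have late: "\<not> u \<le> time (Suc i)" by (simp add: u_def next_time)
    have "\<gamma> u = hub" by (rule stops[of _ _ "Pick j hub"]) (simp add: sch)
    have "\<gamma> (time (Suc i)) = (1, snd (pos i) + sgn (real N - snd (pos i)) * (time (Suc i) - time i))"
      by (rule movement_along_aisle[OF \<gamma>(1) _ \<open>\<gamma> u = hub\<close>])
        (use \<gamma>(2) x N20 in \<open>auto simp: u_def next_time\<close>)
    also have "\<dots> = pos (Suc i)" using True x(2) N20 by (simp add: next_time pos_def)
    finally show ?thesis using late e(2) by (auto simp: sch)
  next
    case False
    then obtain m where m: "i = Suc (2 * m)" by (auto elim: oddE)
    have x: "pos i = (1, real N - 4)" using False by (auto simp: pos_def)
    have next_time: "time (Suc i) = time i + (real N - 8)"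
      using False by (cases "i = 0") (simp_all add: time(4))
    have next_pos: "pos (Suc i) = (1, 4)" using False by (simp add: pos_def)
    have "finish Pushcart w (os i) (time i) (pos i) (events (down_plan m))
        \<le> time i + snd (pos i) + real (Suc m) * C"
      unfolding m by (rule finish_down[OF in_A(1)]) (simp_all add: pos_def)
    then have cheap: "trip Pushcart w (1, real N - 4) (events bs) \<le> real N - 4 + real (Suc m) * C"
      using best[of "down_plan m"] feasible_down[of m] lower x m by simp
    show ?thesis
    proof (cases "Cs = []")
      case True
      then obtain c' bs' where "bs = ((j, s) # c') # bs'"
        using e(3,5) f by (cases bs; cases "hd bs") (auto simp: feasible_iff)
      note d = odd_first_event[OF f[unfolded m] cheap this]
      define u where "u = time i + (real N - 3 + snd s)"
      have s0: "0 \<le> snd s" using s by auto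
      have "travel w (pos i) s = real N - 3 + snd s" using travel[OF in_A(1) s, of i] d(3) x by simp
      moreover have "max u (fst (os i ! j)) = u" using rel s0 N20 by (simp add: u_def)
      ultimately have sch: "schedule Pushcart w (os i) (time i) (pos i) (events bs)
          = (u, s, Pick j s) # schedule Pushcart w (os i) u s es"
        using True by (simp add: e(1) Let_def u_def)
      have "\<gamma> (time i + (real N - 3 + snd s)) = s"
        by (rule stops[of _ _ "Pick j s"]) (simp add: sch u_def)
      then have "\<gamma> (time i + (real N - 8)) = (1, 4)"
        using \<gamma> x by (intro way_down[OF _ _ _ s d(1,2)]) auto
      moreover have "\<not> u \<le> time (Suc i)" using s0 by (simp add: u_def next_time)
      ultimately show ?thesis by (simp add: sch next_time next_pos)
    next
      case False
      then have Cs: "Cs = [Close]" using e(2) by simp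
      define u where "u = time i + (real N - 4)"
      have "travel w (pos i) (1, 0) = real N - 4"
        using travel[OF in_A(1,2), of i] x N20 by (simp add: theta_dist_def)
      then have sch: "schedule Pushcart w (os i) (time i) (pos i) (events bs)
          = (u, (1, 0), Close) # schedule Pushcart w (os i) u (1, 0) (Pick j s # es)"
        by (simp add: e(1) Cs u_def Let_def)
      have "\<gamma> u = (1, 0)" by (rule stops[of _ _ Close]) (simp add: sch)
      have "\<gamma> (time (Suc i)) = (1, real N - 4 + sgn (0 - (real N - 4)) * (time (Suc i) - time i))"
        by (rule movement_along_aisle[OF \<gamma>(1) _ \<open>\<gamma> u = (1, 0)\<close>])
          (use \<gamma>(2) x N20 in \<open>auto simp: u_def next_time\<close>)
      also have "\<dots> = pos (Suc i)" using N20 by (simp add: next_time next_pos)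
      finally show ?thesis by (simp add: sch u_def next_time)
    qed
  qed
qed

lemma reopt_ge:
  assumes "tie_breaking tb"
  shows "(4 * real N - 12) * real m - C \<le> reopt Pushcart tb w (os (2 * m))"
proof -
  have "\<exists>bs. feasible w (os n) {} {} bs \<and>
      reopt Pushcart tb w (os n) = completion Pushcart w (os n) (time n) (pos n) bs" for n
    unfolding os_def
  proof (rule reopt_lured[OF assms _ _ time(1,2), where pos = pos])
    fix i
    obtain bs where "feasible w (os i) {} {} bs"
    proof (cases "even i")
      case True
      then obtain m where "i = 2 * m" by (elim evenE)
      then show ?thesis using feasible_up[of m] that by blast
    next
      case False
      then obtain m where "i = Suc (2 * m)" by (auto elim: oddE)
      then show ?thesis using feasible_down[of m] that by blast
    qed
    then show "optimal_plans Pushcart w (stream [(0, {hub})] time (sweep N) i) (idle (time i) (pos i)) \<noteq> {}"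
      unfolding os_def[symmetric]
      by (rule optimal_plans_nonempty[OF geodesic valid_os]) (simp_all only: idle_simps theta_grid in_A)
  next
    fix i bs \<gamma> assume "(bs, \<gamma>) \<in> optimal_plans Pushcart w (stream [(0, {hub})] time (sweep N) i) (idle (time i) (pos i))"
    from lured[unfolded os_def, OF this]
    show "\<gamma> (time (Suc i)) = pos (Suc i) \<and>
      (\<forall>x\<in>set (takeWhile (\<lambda>(t', q, e). t' \<le> time (Suc i))
        (schedule Pushcart w (stream [(0, {hub})] time (sweep N) i) (time i) (pos i) (events bs))). snd (snd x) = Close)" .
  qed (auto simp: pos_def)
  then obtain bs where f: "feasible w (os (2 * m)) {} {} bs"
    and eq: "reopt Pushcart tb w (os (2 * m)) = finish Pushcart w (os (2 * m)) (time (2 * m)) (pos (2 * m)) (events bs)"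
    unfolding completion_finish by blast
  obtain b bs' where bs: "bs = b # bs'" using f by (cases bs) (auto simp: feasible_iff)
  define J where "J = card (orders_of b - {0})"
  have "loaded b" using loaded_batches[OF f, of b] by (simp add: bs)
  then have "J \<le> 2" using card_orders[of b] by (simp add: J_def loaded_def split: if_splits)
  have "real m - 1 \<le> real ((2 * m - J + 1) div 2)" using \<open>J \<le> 2\<close> by linarith
  then have "(real m - 1) * C \<le> real ((2 * m - J + 1) div 2) * C" by (intro mult_right_mono) auto
  also have "\<dots> \<le> backlog (2 * m - J) (0 \<notin> orders_of b)" by (rule backlog_ge)
  also have "\<dots> \<le> trip Pushcart w (pos (2 * m)) (events bs)"
  proof -
    have "picks_in (aisle_points w) (events [b])"
      using feasible_picks_in[OF valid_os f] by (simp add: bs)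
    then have "0 \<le> trip Pushcart w (pos (2 * m)) (events [b])"
      by (intro trip_nonneg[OF geodesic]) (simp_all only: theta_grid in_A)
    then show ?thesis using plan_trip(2)[OF f[unfolded bs], of "pos (2 * m)"] by (simp add: bs J_def)
  qed
  finally have "(real m - 1) * C \<le> trip Pushcart w (pos (2 * m)) (events bs)" .
  moreover have "real (2 * m) * (real N - 8) \<le> time (2 * m)" by (simp add: time_def)
  ultimately have "real (2 * m) * (real N - 8) + (real m - 1) * C \<le> reopt Pushcart tb w (os (2 * m))"
    using finish_ge_trip[of "time (2 * m)" Pushcart w "pos (2 * m)" "events bs" "os (2 * m)"]
    by (simp add: eq)
  then show ?thesis by (simp add: algebra_simps)
qed

lemma ciopt_le: "ciopt Pushcart w (os (2 * m)) \<le> C * real m + C"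
proof -
  have early: "fst (os (2 * m) ! l) \<le> C + real i * C" if "1 \<le> l" "l \<le> 2 * i + 2" "l \<le> 2 * m" for l i
  proof -
    have "real l * (real N - 8) \<le> real (2 * i + 2) * (real N - 8)"
      using that(2) N by (intro mult_right_mono) auto
    moreover have "fst (os (2 * m) ! l) = 4 + real l * (real N - 8)"
      using that by (simp add: nth_os time_def)
    ultimately show ?thesis using N by (simp add: algebra_simps)
  qed
  have "finish Pushcart w (os (2 * m)) 0 (1, 0) (events (up_plan m)) \<le> C + real m * C"
    by (rule finish_up[OF in_A(2)]) (use early in auto)
  then show ?thesis
    using ciopt_bounds(2)[OF geodesic valid_os feasible_up, of Pushcart m]
    by (simp add: completion_finish algebra_simps)
qed

end

text \<open>The slopes are \<open>4 N - 12\<close> and \<open>2 N + 4\<close> per two sweeps, and their ratio tends to 2.\<close>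

lemma pushcart_ratio:
  assumes "tie_breaking tb"
  shows "asymp_ratio (reopt Pushcart tb) Pushcart {w. valid_warehouse w \<and> aisles w \<ge> 2} \<ge> 2"
proof -
  have "2 \<le> \<alpha>"
    if comp: "asymp_competitive (reopt Pushcart tb) Pushcart {w. valid_warehouse w \<and> aisles w \<ge> 2} \<alpha>" for \<alpha>
  proof (rule field_le_epsilon)
    fix e :: real assume "e > 0"
    obtain n where n: "20 / e < real n" using reals_Archimedean2 by blast
    define N where "N = n + 20"
    interpret theta_instance N by unfold_locales (simp add: N_def)
    have "4 * real N - 12 \<le> \<alpha> * C"
    proof (rule growth_le_competitive[OF comp, of w "\<lambda>m. os (2 * m)" _ C])
      show "w \<in> {w. valid_warehouse w \<and> aisles w \<ge> 2}" using w_class by simp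
      show "0 \<le> ciopt Pushcart w (os (2 * m))" for m
        by (rule ciopt_bounds(1)[OF geodesic valid_os feasible_up])
    qed (use valid_os ciopt_le reopt_ge[OF assms] N in auto)
    moreover have "20 \<le> e * C"
    proof -
      have "20 \<le> e * real n" using n \<open>e > 0\<close> by (simp add: field_simps)
      also have "\<dots> \<le> e * C" using \<open>e > 0\<close> by (intro mult_left_mono) (auto simp: N_def)
      finally show ?thesis .
    qed
    ultimately have "2 * C \<le> (\<alpha> + e) * C" by (simp add: algebra_simps)
    then show "2 \<le> \<alpha> + e" by (rule mult_right_le_imp_le) simp
  qed
  from asymp_ratio_geI[OF this] show ?thesis by simp
qed

theorem proposition3:
  fixes tb :: tie_rule
  assumes "tie_breaking tb"
  shows "asymp_ratio (reopt Pushcart tb) Pushcart {w. valid_warehouse w \<and> aisles w \<ge> 2} \<ge> 2 \<and>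
         asymp_ratio (reopt Robot tb) Robot {w. valid_warehouse w} \<ge> 2"
  using pushcart_ratio[OF assms] robot_ratio[OF assms] by blast

end
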